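(* The positive definite Olshanski spherical functions of $(G_\infty,K_\infty)$, regarded as functions on $\Pi_q$ via $\phi\mapsto(a\mapsto\phi(g_a))$, are precisely the functions $\psi_b(a)=\exp(-\langle a^2,b\rangle)$ ($a\in\Pi_q$) with $b\in\Pi_q$.
   Context: Let $\mathbb F\in\{\mathbb R,\mathbb C,\mathbb H\}$ and fix an integer $q\ge 1$. $M_{p,q}$ is the space of $p\times q$-matrices over $\mathbb F$, $U_p$ the group of unitary $p\times p$-matrices over $\mathbb F$, $x^*$ the conjugate transpose. For integers $p\ge q$ let $G_p=M_{p,q}\rtimes U_p$, where $U_p$ acts on $M_{p,q}$ by left multiplication, i.e. $(x,u)(y,v)=(x+uy,uv)$, and let $K_p=U_p$ (identified with $\{0\}\times U_p$). $G_p$ is regarded as a closed subgroup of $G_{p+1}$ (append a zero row to $x$ and send $u$ to $\mathrm{diag}(u,1)$), so that $K_p=G_p\cap K_{p+1}$. Let $G_\infty=\lim_{\rightarrow}G_p$, $K_\infty=\lim_{\rightarrow}K_p$ be the inductive limits, with inductive limit topology. A continuous function $\phi:G_\infty\to\mathbb C$, not identically zero, is called an Olshanski spherical function of $(G_\infty,K_\infty)$ if it is $K_\infty$-biinvariant and $\phi(g)\phi(h)=\lim_{p\to\infty}\int_{K_p}\phi(gkh)\,dk$ for all $g,h\in G_\infty$, where $dk$ is the normalized Haar measure of $K_p$. It is called positive definite if $\sum_{k,l=1}^n c_k\overline{c_l}\,\phi(g_kg_l^{-1})\ge0$ for all $n\in\mathbb N$, $g_1,\dots,g_n\in G_\infty$,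 $c_1,\dots,c_n\in\mathbb C$. $H_q$ is the space of Hermitian $q\times q$-matrices over $\mathbb F$ with scalar product $\langle x,y\rangle=\Re\,\mathrm{tr}(xy)$, and $\Pi_q\subset H_q$ is the set of positive semidefinite matrices. For $a\in\Pi_q$, $g_a\in G_\infty$ denotes $\left(\begin{pmatrix}a\\0\end{pmatrix},I\right)$, where $a$ is extended by zero rows and $I$ is the identity. The map $a\mapsto K_\infty g_aK_\infty$ is a homeomorphism from $\Pi_q$ onto $G_\infty/\!/K_\infty$, so continuous $K_\infty$-biinvariant functions on $G_\infty$ are identified with continuous functions on $\Pi_q$. *)

theory Defs
  imports "HOL-Analysis.Analysis" "HOL-Algebra.Coset" "HOL-Library.Groups_Big_Fun"
begin

class conj_div_algebra = real_normed_div_algebra +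
  fixes conjg :: "'a \<Rightarrow> 'a"
    and repart :: "'a \<Rightarrow> real"
  assumes conjg_add: "conjg (x + y) = conjg x + conjg y"
    and conjg_mult: "conjg (x * y) = conjg y * conjg x"
    and conjg_conjg: "conjg (conjg x) = x"
    and add_conjg: "x + conjg x = (2 * repart x) *\<^sub>R 1"
    and mult_conjg: "x * conjg x = (norm x)\<^sup>2 *\<^sub>R 1"

instantiation real :: conj_div_algebra
begin
definition conjg_real :: "real \<Rightarrow> real" where "conjg_real x = x"
definition repart_real :: "real \<Rightarrow> real" where "repart_real x = x"
instance
  by standard (auto simp: conjg_real_def repart_real_def power2_eq_square)
end

instantiation complex :: conj_div_algebra
begin
definition conjg_complex :: "complex \<Rightarrow> complex" where "conjg_complex = cnj"
definition repart_complex :: "complex \<Rightarrow> real" where "repart_complex = Re"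
instance
  by standard
    (auto simp: conjg_complex_def repart_complex_def complex_add_cnj complex_norm_square[symmetric] scaleR_conv_of_real)
end

datatype quat = Quat (qre: real) (qi: real) (qj: real) (qk: real)

lemma quat_eqI:
  "qre x = qre y \<Longrightarrow> qi x = qi y \<Longrightarrow> qj x = qj y \<Longrightarrow> qk x = qk y \<Longrightarrow> x = y"
  by (cases x; cases y) simp

instantiation quat :: ring_1
begin
definition zero_quat :: quat where "zero_quat = Quat 0 0 0 0"
definition one_quat :: quat where "one_quat = Quat 1 0 0 0"
definition plus_quat :: "quat \<Rightarrow> quat \<Rightarrow> quat" where
  "x + y = Quat (qre x + qre y) (qi x + qi y) (qj x + qj y) (qk x + qk y)"
definition uminus_quat :: "quat \<Rightarrow> quat" where
  "- x = Quat (- qre x) (- qi x) (- qj x) (- qk x)"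
definition minus_quat :: "quat \<Rightarrow> quat \<Rightarrow> quat" where
  "x - y = Quat (qre x - qre y) (qi x - qi y) (qj x - qj y) (qk x - qk y)"
definition times_quat :: "quat \<Rightarrow> quat \<Rightarrow> quat" where
  "x * y = Quat
     (qre x * qre y - qi x * qi y - qj x * qj y - qk x * qk y)
     (qre x * qi y + qi x * qre y + qj x * qk y - qk x * qj y)
     (qre x * qj y - qi x * qk y + qj x * qre y + qk x * qi y)
     (qre x * qk y + qi x * qj y - qj x * qi y + qk x * qre y)"
instance
  by standard
    (auto simp: zero_quat_def one_quat_def plus_quat_def uminus_quat_def minus_quat_def
      times_quat_def algebra_simps)
end

lemmas quat_ring_defs = zero_quat_def one_quat_def plus_quat_def uminus_quat_def
  minus_quat_def times_quat_def

instantiation quat :: real_algebra_1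
begin
definition scaleR_quat :: "real \<Rightarrow> quat \<Rightarrow> quat" where
  "r *\<^sub>R x = Quat (r * qre x) (r * qi x) (r * qj x) (r * qk x)"
instance
  by standard (auto simp: scaleR_quat_def quat_ring_defs algebra_simps)
end

instantiation quat :: real_normed_div_algebra
begin
definition norm_quat :: "quat \<Rightarrow> real" where
  "norm_quat x = sqrt ((qre x)\<^sup>2 + (qi x)\<^sup>2 + (qj x)\<^sup>2 + (qk x)\<^sup>2)"
definition sgn_quat :: "quat \<Rightarrow> quat" where
  "sgn_quat x = x /\<^sub>R norm x"
definition dist_quat :: "quat \<Rightarrow> quat \<Rightarrow> real" where
  "dist_quat x y = norm (x - y)"
definition uniformity_quat :: "(quat \<times> quat) filter" where
  "uniformity_quat = (INF e\<in>{0<..}. principal {(x, y). dist x y < e})"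
definition open_quat :: "quat set \<Rightarrow> bool" where
  "open_quat U = (\<forall>x\<in>U. \<forall>\<^sub>F (x', y) in uniformity. x' = x \<longrightarrow> y \<in> U)"
definition inverse_quat :: "quat \<Rightarrow> quat" where
  "inverse_quat x = Quat (qre x) (- qi x) (- qj x) (- qk x) /\<^sub>R (norm x)\<^sup>2"
definition divide_quat :: "quat \<Rightarrow> quat \<Rightarrow> quat" where
  "divide_quat x y = x * inverse y"
instance
proof
  fix x y :: quat and r :: real
  have norm_pair: "norm z = norm (Complex (qre z) (qi z), Complex (qj z) (qk z))" for z
    by (simp add: norm_quat_def norm_Pair cmod_def real_sqrt_pow2)
  have norm_sq: "(norm z)\<^sup>2 = (qre z)\<^sup>2 + (qi z)\<^sup>2 + (qj z)\<^sup>2 + (qk z)\<^sup>2" for z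
    by (simp add: norm_quat_def)
  show norm_0: "norm z = 0 \<longleftrightarrow> z = 0" for z :: quat
    unfolding norm_pair by (cases z) (simp add: zero_quat_def zero_prod_def complex_eq_iff)
  show "norm (x + y) \<le> norm x + norm y"
    unfolding norm_pair
    using norm_triangle_ineq[of "(Complex (qre x) (qi x), Complex (qj x) (qk x))"
        "(Complex (qre y) (qi y), Complex (qj y) (qk y))"]
    by (simp add: plus_quat_def complex_add)
  show "norm (r *\<^sub>R x) = \<bar>r\<bar> * norm x"
  proof -
    have "(norm (r *\<^sub>R x))\<^sup>2 = (\<bar>r\<bar> * norm x)\<^sup>2"
      unfolding power_mult_distrib norm_sq by (simp add: scaleR_quat_def algebra_simps power2_eq_square)
    then show ?thesis
      by (rule power2_eq_imp_eq) (auto simp: norm_quat_def)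
  qed
  show "norm (x * y) = norm x * norm y"
  proof -
    have "(norm (x * y))\<^sup>2 = (norm x * norm y)\<^sup>2"
      unfolding power_mult_distrib norm_sq
      by (simp add: times_quat_def algebra_simps power2_eq_square)
    then show ?thesis
      by (rule power2_eq_imp_eq) (auto simp: norm_quat_def)
  qed
  show "inverse (0::quat) = 0"
    by (simp add: inverse_quat_def zero_quat_def scaleR_quat_def)
  show "x \<noteq> 0 \<Longrightarrow> inverse x * x = 1"
  proof -
    assume "x \<noteq> 0"
    then have n: "(norm x)\<^sup>2 \<noteq> 0" using norm_0 by simp
    have "inverse x * x = (Quat (qre x) (- qi x) (- qj x) (- qk x) * x) /\<^sub>R (norm x)\<^sup>2"
      by (simp add: inverse_quat_def)
    also have "Quat (qre x) (- qi x) (- qj x) (- qk x) * x = (norm x)\<^sup>2 *\<^sub>R 1"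
      unfolding norm_sq
      by (simp add: times_quat_def scaleR_quat_def one_quat_def power2_eq_square)
    finally show ?thesis using n by simp
  qed
  show "x \<noteq> 0 \<Longrightarrow> x * inverse x = 1"
  proof -
    assume "x \<noteq> 0"
    then have n: "(norm x)\<^sup>2 \<noteq> 0" using norm_0 by simp
    have "x * inverse x = (x * Quat (qre x) (- qi x) (- qj x) (- qk x)) /\<^sub>R (norm x)\<^sup>2"
      by (simp add: inverse_quat_def)
    also have "x * Quat (qre x) (- qi x) (- qj x) (- qk x) = (norm x)\<^sup>2 *\<^sub>R 1"
      unfolding norm_sq
      by (simp add: times_quat_def scaleR_quat_def one_quat_def power2_eq_square)
    finally show ?thesis using n by simp
  qed
qed (simp_all only: sgn_quat_def dist_quat_def uniformity_quat_def open_quat_def divide_quat_def)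
end

instantiation quat :: conj_div_algebra
begin
definition conjg_quat :: "quat \<Rightarrow> quat" where
  "conjg_quat x = Quat (qre x) (- qi x) (- qj x) (- qk x)"
definition repart_quat :: "quat \<Rightarrow> real" where "repart_quat = qre"
instance
proof
  fix x y :: quat
  show "conjg (x + y) = conjg x + conjg y"
    by (simp add: conjg_quat_def plus_quat_def)
  show "conjg (x * y) = conjg y * conjg x"
    by (simp add: conjg_quat_def times_quat_def algebra_simps)
  show "conjg (conjg x) = x"
    by (simp add: conjg_quat_def)
  show "x + conjg x = (2 * repart x) *\<^sub>R 1"
    by (simp add: conjg_quat_def repart_quat_def plus_quat_def scaleR_quat_def one_quat_def)
  show "x * conjg x = (norm x)\<^sup>2 *\<^sub>R 1"
    by (simp add: conjg_quat_def norm_quat_def times_quat_def scaleR_quat_def one_quat_def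
        power2_eq_square)
qed
end

text \<open>
  A matrix is a function of two indices counted from 0. A \<open>p \<times> q\<close> matrix is
  extended by 0 outside its index range, a unitary \<open>p \<times> p\<close> matrix by the entries of the
  identity; so the embeddings of the spaces for \<open>p\<close> into those for \<open>p + 1\<close> (appending a zero row,
  respectively \<open>u \<mapsto> diag(u, 1)\<close>) become inclusions, and inductive limits become unions.
\<close>

type_synonym 'a inf_mat = "nat \<Rightarrow> nat \<Rightarrow> 'a"

definition mat_id :: "'a::conj_div_algebra inf_mat" where
  "mat_id = (\<lambda>i j. if i = j then 1 else 0)"

text \<open>\<^const>\<open>Sum_any\<close> sums over the nonzero terms; for all matrices considered below there are only
  finitely many of them.\<close>

definition mat_times :: "'a::conj_div_algebra inf_mat \<Rightarrow> 'a inf_mat \<Rightarrow> 'a inf_mat" where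
  "mat_times A B = (\<lambda>i j. Sum_any (\<lambda>k. A i k * B k j))"

definition mat_star :: "'a::conj_div_algebra inf_mat \<Rightarrow> 'a inf_mat" where
  "mat_star A = (\<lambda>i j. conjg (A j i))"

definition Mats :: "nat \<Rightarrow> nat \<Rightarrow> 'a::conj_div_algebra inf_mat set" where
  "Mats p q = {x. \<forall>i j. p \<le> i \<or> q \<le> j \<longrightarrow> x i j = 0}"

definition Unitaries :: "nat \<Rightarrow> 'a::conj_div_algebra inf_mat set" where
  "Unitaries p = {u. (\<forall>i j. p \<le> i \<or> p \<le> j \<longrightarrow> u i j = mat_id i j) \<and>
     mat_times (mat_star u) u = mat_id \<and> mat_times u (mat_star u) = mat_id}"

definition Hermitians :: "nat \<Rightarrow> 'a::conj_div_algebra inf_mat set" where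
  "Hermitians q = {x \<in> Mats q q. mat_star x = x}"

definition herm_inner :: "nat \<Rightarrow> 'a::conj_div_algebra inf_mat \<Rightarrow> 'a inf_mat \<Rightarrow> real" where
  "herm_inner q x y = repart (\<Sum>i<q. mat_times x y i i)"

text \<open>For Hermitian \<open>a\<close> the number \<open>v\<^sup>* a v\<close> is real, so that taking its real part
  only changes its type.\<close>

definition PSD :: "nat \<Rightarrow> 'a::conj_div_algebra inf_mat set" where
  "PSD q = {a \<in> Hermitians q.
     \<forall>v :: nat \<Rightarrow> 'a. 0 \<le> repart (\<Sum>i<q. \<Sum>j<q. conjg (v i) * a i j * v j)}"

definition grp :: "nat \<Rightarrow> nat \<Rightarrow> ('a::conj_div_algebra inf_mat \<times> 'a inf_mat) monoid" where
  "grp q p = \<lparr>carrier = Mats p q \<times> Unitaries p,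
     mult = (\<lambda>(x, u) (y, v). (\<lambda>i j. x i j + mat_times u y i j, mat_times u v)),
     one = (\<lambda>i j. 0, mat_id)\<rparr>"

definition grp_lim :: "nat \<Rightarrow> ('a::conj_div_algebra inf_mat \<times> 'a inf_mat) monoid" where
  "grp_lim q = \<lparr>carrier = (\<Union>p\<in>{q..}. carrier (grp q p)),
     mult = (\<lambda>(x, u) (y, v). (\<lambda>i j. x i j + mat_times u y i j, mat_times u v)),
     one = (\<lambda>i j. 0, mat_id)\<rparr>"

definition Kgrp :: "nat \<Rightarrow> ('a::conj_div_algebra inf_mat \<times> 'a inf_mat) set" where
  "Kgrp p = {\<lambda>i j. 0} \<times> Unitaries p"

definition Klim :: "nat \<Rightarrow> ('a::conj_div_algebra inf_mat \<times> 'a inf_mat) set" where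
  "Klim q = (\<Union>p\<in>{q..}. Kgrp p)"

text \<open>The topology of the group for a fixed \<open>p\<close> is the one induced by the product topology on
  functions. As only finitely many entries vary, it is the Euclidean one.\<close>

definition lim_topology :: "nat \<Rightarrow> ('a::conj_div_algebra inf_mat \<times> 'a inf_mat) topology" where
  "lim_topology q = topology (\<lambda>W. W \<subseteq> carrier (grp_lim q) \<and>
     (\<forall>p\<ge>q. openin (top_of_set (carrier (grp q p))) (W \<inter> carrier (grp q p))))"

lemma openin_lim_topology:
  fixes W :: "('a::conj_div_algebra inf_mat \<times> 'a inf_mat) set"
  shows "openin (lim_topology q) W \<longleftrightarrow> W \<subseteq> carrier (grp_lim q) \<and>
     (\<forall>p\<ge>q. openin (top_of_set (carrier (grp q p))) (W \<inter> carrier (grp q p)))"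
proof -
  have Int: "openin X (S \<inter> T \<inter> C)" if "openin X (S \<inter> C)" "openin X (T \<inter> C)"
    for X S T and C :: "('a inf_mat \<times> 'a inf_mat) set"
  proof -
    have "S \<inter> T \<inter> C = (S \<inter> C) \<inter> (T \<inter> C)" by blast
    with that show ?thesis by (simp add: openin_Int)
  qed
  have Un: "openin X (\<Union>\<K> \<inter> C)" if "\<And>S. S \<in> \<K> \<Longrightarrow> openin X (S \<inter> C)"
    for X \<K> and C :: "('a inf_mat \<times> 'a inf_mat) set"
  proof -
    have "\<Union>\<K> \<inter> C = (\<Union>S\<in>\<K>. S \<inter> C)" by blast
    moreover have "openin X (\<Union>S\<in>\<K>. S \<inter> C)" using that by (intro openin_Union) auto
    ultimately show ?thesis by (rule ssubst)
  qed
  have "istopology (\<lambda>W :: ('a inf_mat \<times> 'a inf_mat) set. W \<subseteq> carrier (grp_lim q) \<and>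
     (\<forall>p\<ge>q. openin (top_of_set (carrier (grp q p))) (W \<inter> carrier (grp q p))))"
    unfolding istopology_def by (auto intro: Int Un)
  then show ?thesis
    unfolding lim_topology_def by (simp add: topology_inverse')
qed

text \<open>By the convention above, a \<open>q \<times> q\<close> matrix \<open>a\<close> already is its extension by zero rows.\<close>

definition grp_elem :: "'a::conj_div_algebra inf_mat \<Rightarrow> 'a inf_mat \<times> 'a inf_mat" where
  "grp_elem a = (a, mat_id)"

text \<open>On a compact metrizable group \<open>K\<close> there is exactly one left invariant Borel probability
  measure; it is also right invariant.\<close>

definition normalized_haar ::
    "('g::topological_space, 'm) monoid_scheme \<Rightarrow> 'g set \<Rightarrow> 'g measure" where
  "normalized_haar G K = (THE M. sets M = sets (restrict_space borel K) \<and> emeasure M K = 1 \<and>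
     (\<forall>k\<in>K. \<forall>A\<in>sets M. emeasure M (k <#\<^bsub>G\<^esub> A) = emeasure M A))"

definition olshanski_spherical ::
    "nat \<Rightarrow> ('a::conj_div_algebra inf_mat \<times> 'a inf_mat \<Rightarrow> complex) \<Rightarrow> bool" where
  "olshanski_spherical q \<phi> \<longleftrightarrow>
     continuous_map (lim_topology q) euclidean \<phi> \<and>
     (\<exists>g\<in>carrier (grp_lim q). \<phi> g \<noteq> 0) \<and>
     (\<forall>g\<in>carrier (grp_lim q). \<forall>k\<in>Klim q. \<forall>l\<in>Klim q.
        \<phi> (k \<otimes>\<^bsub>grp_lim q\<^esub> g \<otimes>\<^bsub>grp_lim q\<^esub> l) = \<phi> g) \<and>
     (\<forall>g\<in>carrier (grp_lim q). \<forall>h\<in>carrier (grp_lim q).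
        (\<lambda>p. LINT k|normalized_haar (grp q p) (Kgrp p).
               \<phi> (g \<otimes>\<^bsub>grp_lim q\<^esub> k \<otimes>\<^bsub>grp_lim q\<^esub> h)) \<longlonglongrightarrow> \<phi> g * \<phi> h)"

definition positive_definite_on :: "('g, 'm) monoid_scheme \<Rightarrow> ('g \<Rightarrow> complex) \<Rightarrow> bool" where
  "positive_definite_on G \<phi> \<longleftrightarrow>
     (\<forall>(n::nat) g c. (\<forall>k<n. g k \<in> carrier G) \<longrightarrow>
        (\<Sum>k<n. \<Sum>l<n. c k * cnj (c l) * \<phi> (g k \<otimes>\<^bsub>G\<^esub> inv\<^bsub>G\<^esub> (g l))) \<in> \<real>\<^sub>\<ge>\<^sub>0)"

definition psi :: "nat \<Rightarrow> 'a::conj_div_algebra inf_mat \<Rightarrow> 'a inf_mat \<Rightarrow> complex" where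
  "psi q b a = complex_of_real (exp (- herm_inner q (mat_times a a) b))"

end

theory Submission
  imports Defs
begin

text \<open>A biinvariant function \<open>\<phi>\<close> is determined by \<open>F x = \<phi> (x, 1)\<close>, a function of \<open>x\<close> that does not change
under \<open>x \<mapsto> u x\<close> with \<open>u\<close> unitary.

Let \<open>\<phi>\<close> be positive definite and spherical. Then \<open>F\<close> is real and even with \<open>\<bar>F\<bar> \<le> 1 = F 0\<close>, and
\<open>(x, y) \<mapsto> F (x - y)\<close> is a positive definite kernel. The main step is \<open>F (x + y) = F x * F y\<close> for matrices
\<open>x\<close> and \<open>y\<close> without a common nonzero row (\<open>mult_disjoint_rows\<close>). In the Hilbert space of the kernel,
the spherical equation says that the Haar average of the vectors of \<open>k x\<close> over \<open>k \<in> U\<^sub>p\<close> approaches \<open>F x\<close>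
times the vector of \<open>0\<close>. A permutation matrix moves \<open>y\<close> to rows beyond \<open>p\<close>, where \<open>U\<^sub>p\<close> fixes it, so that its inner
product with the average is exactly \<open>F (x + y)\<close>, up to the sign of \<open>x\<close>. To stay with finite sums, the
average is replaced by a mean over \<open>p\<close> well spread points of the orbit (\<open>exists_spread_rotations\<close>).

So \<open>F x\<close> is the product of \<open>h v\<close> over the rows \<open>v\<close> of \<open>x\<close>, for one function \<open>h\<close> of a row. Rotating two rows
into each other shows that \<open>h\<close> is positive and that \<open>- ln h\<close> satisfies the parallelogram law, whence \<open>- ln (h v) = v b v\<^sup>*\<close> with
a positive semidefinite \<open>b\<close> (\<open>hermitian_form_of_parallelogram\<close>) and \<open>F x = exp (- Re tr (x\<^sup>* x b))\<close>.

Conversely, let \<open>F\<close> have this form. The kernel is Gaussian, that is, a rescaled exponential of a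
positive semidefinite kernel, hence positive definite (\<open>exp_posdef\<close>). In \<open>F (x + k y)\<close> the quadratic terms
contribute the factor \<open>F x * F y\<close>, and the mixed term \<open>2 Re tr (y\<^sup>* k\<^sup>* x b)\<close> tends to \<open>0\<close> in mean, because the mean modulus
of an entry of \<open>k \<in> U\<^sub>p\<close> is at most \<open>1 / \<surd>p\<close> (\<open>haar_entry_mean\<close>).

Normalized Haar measure is a definite description, so both directions rest on existence and uniqueness
of the Haar measure of \<open>U\<^sub>p\<close>. For existence, every nonempty compact metric space carries a Borel
probability measure that is invariant under isometries (\<open>isometry_invariant_measure_exists\<close>), built from covering numbers;
left translations are isometries of the Frobenius metric. Uniqueness is an application of Fubini's theorem.

The three skew fields are treated together, as Euclidean spaces with a conjugation.\<close>

section \<open>Isometry-invariant measures on compact metric spaces\<close>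

text \<open>Caratheodory's criterion for metric outer measures. The points of \<open>T\<close> outside \<open>C\<close> are exhausted by the sets \<open>U n\<close>
of points at distance at least \<open>1 / (n + 1)\<close> from \<open>C\<close>. Every second of the rings between consecutive sets \<open>U n\<close> is
separated from the earlier ones, so the measures of the rings have a finite sum, and its tails bound the measure
of what \<open>U n\<close> misses.\<close>

lemma (in Metric_space) closedin_caratheodory:
  fixes \<mu> :: "'a set \<Rightarrow> ennreal"
  assumes oms: "outer_measure_space (Pow M) \<mu>" and fin: "\<mu> M < Orderings.top"
    and sep: "\<And>A B \<delta>. A \<subseteq> M \<Longrightarrow> B \<subseteq> M \<Longrightarrow> 0 < \<delta> \<Longrightarrow> (\<And>a b. a \<in> A \<Longrightarrow> b \<in> B \<Longrightarrow> \<delta> \<le> d a b)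
        \<Longrightarrow> \<mu> A + \<mu> B \<le> \<mu> (A \<union> B)"
    and C: "closedin mtopology C"
  shows "C \<in> lambda_system M (Pow M) \<mu>"
proof -
  have CM: "C \<subseteq> M" using C by (simp add: closedin_metric)
  have mono: "\<mu> A \<le> \<mu> B" if "A \<subseteq> B" "B \<subseteq> M" for A B
    using oms that unfolding outer_measure_space_def increasing_def by auto
  have empty: "\<mu> {} = 0"
    using oms unfolding outer_measure_space_def positive_def by auto
  interpret P: sigma_algebra M "Pow M" by (rule sigma_algebra_Pow)
  have sub: "\<mu> (\<Union>i. A i) \<le> (suminf (\<lambda>i. \<mu> (A i)))" if "\<And>i::nat. A i \<subseteq> M" "disjoint_family A" for A
    using oms that unfolding outer_measure_space_def countably_subadditive_def by blast
  have sub2: "\<mu> (A \<union> B) \<le> \<mu> A + \<mu> B" if "A \<subseteq> M" "B \<subseteq> M" "A \<inter> B = {}" for A B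
    using P.countably_subadditive_subadditive oms that
    unfolding outer_measure_space_def subadditive_def by (metis PowI)
  have main: "\<mu> (T \<inter> C) + \<mu> (T - C) \<le> \<mu> T" if T: "T \<subseteq> M" for T
  proof -
    define U where "U n = {x\<in>T. \<forall>y\<in>C. 1 / real (Suc n) \<le> d x y}" for n
    define R where "R n = U (Suc n) - U n" for n
    have UT: "U n \<subseteq> T" "R n \<subseteq> T" for n by (auto simp: U_def R_def)
    have Umono: "U m \<subseteq> U n" if "m \<le> n" for m n
    proof -
      have "1 / real (Suc n) \<le> 1 / real (Suc m)" using that by (simp add: frac_le)
      then show ?thesis by (auto simp: U_def intro: order_trans)
    qed
    have near: "\<exists>y\<in>C. d x y < 1 / real (Suc n)" if "x \<in> R n" for x n
      using that by (auto simp: R_def U_def not_le)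
    have sepR: "\<exists>\<delta>>0. \<forall>a\<in>A. \<forall>b\<in>R (Suc n). \<delta> \<le> d a b" if A: "A \<subseteq> U n" for A n
    proof (intro exI conjI ballI)
      show "0 < 1 / real (Suc n) - 1 / real (Suc (Suc n))" by (simp add: frac_less2)
      fix a b assume a: "a \<in> A" and b: "b \<in> R (Suc n)"
      from near[OF b] obtain y where y: "y \<in> C" "d b y < 1 / real (Suc (Suc n))" by blast
      have "1 / real (Suc n) \<le> d a y" using a A y by (auto simp: U_def)
      also have "\<dots> \<le> d a b + d b y"
        using a A b y T CM UT by (intro triangle) (blast+)
      finally show "1 / real (Suc n) - 1 / real (Suc (Suc n)) \<le> d a b" using y by simp
    qed
    \<comment> \<open>\<open>c = 0\<close> gives the even rings, \<open>c = 1\<close> the odd ones\<close>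
    have alt: "(\<Sum>k<n. \<mu> (R (2*k+c))) \<le> \<mu> (\<Union>k<n. R (2*k+c))" for n c
    proof (induction n)
      case IH: (Suc n)
      show ?case
      proof (cases n)
        case 0 then show ?thesis by (simp add: lessThan_Suc)
      next
        case (Suc m)
        have "R (2*k+c) \<subseteq> U (Suc (2 * m + c))" if "k < n" for k
          using Umono[of "Suc (2*k+c)" "Suc (2 * m + c)"] that Suc by (auto simp: R_def)
        then have "(\<Union>k<n. R (2*k+c)) \<subseteq> U (Suc (2 * m + c))" by blast
        from sepR[OF this] obtain \<delta> where \<delta>: "0 < \<delta>" 
          "\<forall>a\<in>(\<Union>k<n. R (2*k+c)). \<forall>b\<in>R (2*n+c). \<delta> \<le> d a b" using Suc by auto
        have "\<mu> (\<Union>k<n. R (2*k+c)) + \<mu> (R (2*n+c)) \<le> \<mu> ((\<Union>k<n. R (2*k+c)) \<union> R (2*n+c))"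
        proof (rule sep[OF _ _ \<delta>(1)])
          show "\<And>a b. a \<in> (\<Union>k<n. R (2*k+c)) \<Longrightarrow> b \<in> R (2*n+c) \<Longrightarrow> \<delta> \<le> d a b"
            using \<delta>(2) by blast
        qed (use UT T in fast)+
        also have "(\<Union>k<n. R (2*k+c)) \<union> R (2*n+c) = (\<Union>k<Suc n. R (2*k+c))"
          by (auto simp: less_Suc_eq)
        finally have "\<mu> (\<Union>k<n. R (2*k+c)) + \<mu> (R (2*n+c)) \<le> \<mu> (\<Union>k<Suc n. R (2*k+c))" .
        with IH have "(\<Sum>k<n. \<mu> (R (2*k+c))) + \<mu> (R (2*n+c)) \<le> \<mu> (\<Union>k<Suc n. R (2*k+c))"
          using add_right_mono order_trans by blast
        then show ?thesis by simp
      qed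
    qed (simp add: empty)
    have alt': "(\<Sum>k<n. \<mu> (R (2*k+c))) \<le> \<mu> M" for n c
      by (rule order_trans[OF alt mono]) (use UT T in fast)+
    have split: "(\<Sum>k<2*n. f k) = (\<Sum>k<n. f (2*k+0)) + (\<Sum>k<n. f (2*k+1))" for f :: "nat \<Rightarrow> ennreal" and n
      by (induction n) (simp_all add: ac_simps)
    have "(suminf (\<lambda>k. \<mu> (R k))) \<le> \<mu> M + \<mu> M"
    proof (rule suminf_le_const[OF summableI])
      fix n
      have "(\<Sum>k<n. \<mu> (R k)) \<le> (\<Sum>k<2*n. \<mu> (R k))" by (intro sum_mono2) auto
      also have "\<dots> \<le> \<mu> M + \<mu> M" unfolding split by (intro add_mono alt')
      finally show "(\<Sum>k<n. \<mu> (R k)) \<le> \<mu> M + \<mu> M" .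
    qed
    also have "\<dots> < Orderings.top" using fin by simp
    finally have sumfin: "(suminf (\<lambda>k. \<mu> (R k))) < Orderings.top" .
    define r where "r k = enn2real (\<mu> (R k))" for k
    have r: "\<mu> (R k) = ennreal (r k)" "0 \<le> r k" for k
      using ennreal_suminf_lessD[OF sumfin] by (auto simp: r_def)
    have rs: "summable r"
      using sumfin r by (intro summable_suminf_not_top) auto
    show ?thesis
    proof (rule ennreal_le_epsilon)
      fix e :: real assume e: "0 < e"
      obtain N where N: "\<And>n. N \<le> n \<Longrightarrow> norm (suminf (\<lambda>i. r (i + n))) < e"
        using suminf_exist_split[OF e rs] by blast
      have cover: "T - C \<subseteq> U N \<union> (\<Union>k. R (k + N))"
      proof
        fix x assume x: "x \<in> T - C"
        obtain n where n: "x \<in> U n"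
        proof -
          have "x \<in> topspace mtopology - C" using x T by auto
          moreover have "openin mtopology (topspace mtopology - C)" using C by blast
          ultimately obtain \<epsilon> where \<epsilon>: "0 < \<epsilon>" "mball x \<epsilon> \<subseteq> topspace mtopology - C"
            unfolding openin_mtopology by blast
          obtain n where "1 / real (Suc n) < \<epsilon>" using nat_approx_posE[OF \<epsilon>(1)] by blast
          moreover have "\<epsilon> \<le> d x y" if "y \<in> C" for y
          proof (rule ccontr)
            assume "\<not> \<epsilon> \<le> d x y"
            then have "y \<in> mball x \<epsilon>" using that CM x T by auto
            then show False using \<epsilon>(2) that by auto
          qed
          ultimately have "x \<in> U n" using x by (force simp: U_def)
          then show thesis by (rule that)
        qed
        have "x \<in> U (k + N) \<longrightarrow> x \<in> U N \<union> (\<Union>k. R (k + N))" for k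
        proof (induction k)
          case (Suc k) then show ?case by (auto simp: R_def)
        qed auto
        moreover have "x \<in> U (n + N)" using n Umono[of n "n + N"] by auto
        ultimately show "x \<in> U N \<union> (\<Union>k. R (k + N))" by blast
      qed
      have "disjoint_family R"
      proof (unfold disjoint_family_on_def, intro ballI impI)
        have *: "R m \<inter> R n = {}" if "m < n" for m n
          using Umono[of "Suc m" n] that by (auto simp: R_def)
        fix m n :: nat assume "m \<noteq> n"
        then show "R m \<inter> R n = {}" using *[of m n] *[of n m] by (cases "m < n") auto
      qed
      then have dis: "disjoint_family (\<lambda>k. R (k + N))"
        by (auto simp: disjoint_family_on_def)
      have "\<mu> (T - C) \<le> \<mu> (U N \<union> ((\<Union>k. R (k + N))))"
        by (rule mono[OF cover]) (use UT T in blast)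
      also have "\<dots> \<le> \<mu> (U N) + \<mu> (\<Union>k. R (k + N))"
      proof (rule sub2)
        show "U N \<inter> (\<Union>k. R (k + N)) = {}"
        proof -
          have "U N \<inter> R (k + N) = {}" for k using Umono[of N "k + N"] by (auto simp: R_def)
          then show ?thesis by blast
        qed
      qed (use UT T in blast)+
      also have "\<mu> (\<Union>k. R (k + N)) \<le> (suminf (\<lambda>k. \<mu> (R (k + N))))"
        by (rule sub[OF _ dis]) (use UT T in blast)
      also have "\<dots> = ennreal (suminf (\<lambda>k. r (k + N)))"
        unfolding r by (rule suminf_ennreal2) (use r rs in \<open>auto simp: summable_iff_shift\<close>)
      also have "\<dots> \<le> ennreal e" using N[of N] by (intro ennreal_leI) simp
      finally have 1: "\<mu> (T - C) \<le> \<mu> (U N) + ennreal e" by (simp add: add_left_mono)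
      have "\<mu> (T \<inter> C) + \<mu> (U N) \<le> \<mu> ((T \<inter> C) \<union> U N)"
      proof (rule sep)
        show "0 < 1 / real (Suc N)" by simp
        fix a b assume "a \<in> T \<inter> C" "b \<in> U N"
        then show "1 / real (Suc N) \<le> d a b" by (subst commute) (auto simp: U_def)
      qed (use UT T in blast)+
      also have "\<dots> \<le> \<mu> T" by (rule mono) (use UT T in blast)+
      finally have 2: "\<mu> (T \<inter> C) + \<mu> (U N) \<le> \<mu> T" .
      have "\<mu> (T \<inter> C) + \<mu> (T - C) \<le> \<mu> (T \<inter> C) + (\<mu> (U N) + ennreal e)"
        by (rule add_left_mono[OF 1])
      also have "\<dots> \<le> \<mu> T + ennreal e" by (metis 2 add.assoc add_right_mono)
      finally show "\<mu> (T \<inter> C) + \<mu> (T - C) \<le> \<mu> T + ennreal e" .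
    qed
  qed
  have "\<mu> (T \<inter> C) + \<mu> (T - C) = \<mu> T" if T: "T \<subseteq> M" for T
  proof (rule antisym[OF main[OF T]])
    have "\<mu> ((T \<inter> C) \<union> (T - C)) \<le> \<mu> (T \<inter> C) + \<mu> (T - C)"
      by (rule sub2) (use T in auto)
    also have "(T \<inter> C) \<union> (T - C) = T" by blast
    finally show "\<mu> T \<le> \<mu> (T \<inter> C) + \<mu> (T - C)" .
  qed
  then show ?thesis
    using CM by (simp add: P.lambda_system_eq)
qed

context Metric_space
begin

text \<open>A least number exists only for sets that finitely many \<open>r\<close>-balls cover, in particular for all subsets of a totally
bounded space; elsewhere the value is arbitrary.\<close>

definition cover_num :: "real \<Rightarrow> 'a set \<Rightarrow> nat" where
  "cover_num r A = (LEAST n. \<exists>S. finite S \<and> S \<subseteq> M \<and> card S = n \<and> A \<subseteq> (\<Union>s\<in>S. mball s r))"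

lemma cover_num_le:
  "finite S \<Longrightarrow> S \<subseteq> M \<Longrightarrow> A \<subseteq> (\<Union>s\<in>S. mball s r) \<Longrightarrow> cover_num r A \<le> card S"
  unfolding cover_num_def by (rule Least_le) blast

lemma cover_num_attained:
  assumes "mtotally_bounded M" "0 < r" "A \<subseteq> M"
  obtains S where "finite S" "S \<subseteq> M" "card S = cover_num r A" "A \<subseteq> (\<Union>s\<in>S. mball s r)"
proof -
  have "\<exists>S. finite S \<and> S \<subseteq> M \<and> M \<subseteq> (\<Union>s\<in>S. mball s r)"
    using assms(1,2) unfolding mtotally_bounded_def by simp
  then obtain S0 where S0: "finite S0" "S0 \<subseteq> M" "M \<subseteq> (\<Union>s\<in>S0. mball s r)" by (elim exE conjE)
  have "\<exists>n S. finite S \<and> S \<subseteq> M \<and> card S = n \<and> A \<subseteq> (\<Union>s\<in>S. mball s r)"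
    by (rule exI[of _ "card S0"], rule exI[of _ S0], intro conjI S0(1,2) refl order_trans[OF assms(3) S0(3)])
  then have "\<exists>S. finite S \<and> S \<subseteq> M \<and> card S = cover_num r A \<and> A \<subseteq> (\<Union>s\<in>S. mball s r)"
    unfolding cover_num_def by (rule LeastI_ex)
  then show thesis by (elim exE conjE) (rule that)
qed

lemma cover_num_empty: "cover_num r {} = 0"
  using cover_num_le[of "{}" "{}" r] by simp

lemma cover_num_mono:
  assumes "mtotally_bounded M" "0 < r" "A \<subseteq> B" "B \<subseteq> M"
  shows "cover_num r A \<le> cover_num r B"
proof -
  from cover_num_attained[OF assms(1,2,4)] obtain S where
    "finite S" "S \<subseteq> M" "card S = cover_num r B" "B \<subseteq> (\<Union>s\<in>S. mball s r)" .
  then show ?thesis using cover_num_le[of S A r] assms(3) by auto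
qed

lemma cover_num_Un:
  assumes "mtotally_bounded M" "0 < r" "A \<subseteq> M" "B \<subseteq> M"
  shows "cover_num r (A \<union> B) \<le> cover_num r A + cover_num r B"
proof -
  from cover_num_attained[OF assms(1-3)] obtain S where
    S: "finite S" "S \<subseteq> M" "card S = cover_num r A" "A \<subseteq> (\<Union>s\<in>S. mball s r)" .
  from cover_num_attained[OF assms(1,2,4)] obtain T where
    T: "finite T" "T \<subseteq> M" "card T = cover_num r B" "B \<subseteq> (\<Union>s\<in>T. mball s r)" .
  have "cover_num r (A \<union> B) \<le> card (S \<union> T)"
    by (rule cover_num_le) (use S T in auto)
  also have "\<dots> \<le> card S + card T" by (rule card_Un_le)
  finally show ?thesis using S T by simp
qed

text \<open>No ball of radius \<open>r\<close> meets two sets at distance at least \<open>2 r\<close>, so the balls of an optimal cover of the union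
split into a cover of each part.\<close>

lemma cover_num_separated:
  assumes "mtotally_bounded M" "0 < r" "A \<subseteq> M" "B \<subseteq> M"
    and far: "\<And>a b. a \<in> A \<Longrightarrow> b \<in> B \<Longrightarrow> 2 * r \<le> d a b"
  shows "cover_num r A + cover_num r B \<le> cover_num r (A \<union> B)"
proof -
  have "A \<union> B \<subseteq> M" using assms by blast
  from cover_num_attained[OF assms(1,2) this] obtain S where
    S: "finite S" "S \<subseteq> M" "card S = cover_num r (A \<union> B)" "A \<union> B \<subseteq> (\<Union>s\<in>S. mball s r)" .
  define SA where "SA = {s\<in>S. mball s r \<inter> A \<noteq> {}}"
  define SB where "SB = {s\<in>S. mball s r \<inter> B \<noteq> {}}"
  have "cover_num r A \<le> card SA" 
  proof (rule cover_num_le)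
    show "A \<subseteq> (\<Union>s\<in>SA. mball s r)" using S(4) unfolding SA_def by blast
  qed (use S in \<open>auto simp: SA_def\<close>)
  moreover have "cover_num r B \<le> card SB" 
  proof (rule cover_num_le)
    show "B \<subseteq> (\<Union>s\<in>SB. mball s r)" using S(4) unfolding SB_def by blast
  qed (use S in \<open>auto simp: SB_def\<close>)
  moreover have "card SA + card SB = card (SA \<union> SB)"
  proof (rule card_Un_disjoint[symmetric])
    show "SA \<inter> SB = {}"
    proof (rule ccontr)
      assume "SA \<inter> SB \<noteq> {}"
      then obtain s a b where *: "s \<in> M" "a \<in> M" "b \<in> M" "a \<in> A" "b \<in> B" "d s a < r" "d s b < r"
        using S(2) unfolding SA_def SB_def by auto
      then have "d a b < 2 * r" using triangle''[of a s b] by simp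
      moreover have "2 * r \<le> d a b" using far * by blast
      ultimately show False by simp
    qed
  qed (use S in \<open>auto simp: SA_def SB_def\<close>)
  moreover have "card (SA \<union> SB) \<le> card S"
    by (rule card_mono) (use S in \<open>auto simp: SA_def SB_def\<close>)
  ultimately show ?thesis using S(3) by linarith
qed

definition isometry :: "('a \<Rightarrow> 'a) \<Rightarrow> bool" where
  "isometry f \<longleftrightarrow> f ` M = M \<and> (\<forall>x\<in>M. \<forall>y\<in>M. d (f x) (f y) = d x y)"

lemma isometry_inverse:
  assumes "isometry f"
  shows "\<exists>g. isometry g \<and> (\<forall>x\<in>M. g (f x) = x) \<and> (\<forall>x\<in>M. f (g x) = x)"
proof -
  have inj: "inj_on f M"
  proof (rule inj_onI)
    fix x y assume "x \<in> M" "y \<in> M" "f x = f y"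
    moreover have "f y \<in> M" using assms \<open>y \<in> M\<close> unfolding isometry_def by auto
    moreover have "d (f x) (f y) = d x y"
      using assms \<open>x \<in> M\<close> \<open>y \<in> M\<close> unfolding isometry_def by blast
    ultimately have "d x y = 0" by simp
    then show "x = y" using \<open>x \<in> M\<close> \<open>y \<in> M\<close> by simp
  qed
  have 1: "the_inv_into M f (f x) = x" if "x \<in> M" for x
    by (rule the_inv_into_f_f[OF inj that])
  have 2: "f (the_inv_into M f x) = x" if "x \<in> M" for x
    using assms that by (intro f_the_inv_into_f[OF inj]) (auto simp: isometry_def)
  have 3: "the_inv_into M f x \<in> M" if "x \<in> M" for x
    using assms that by (intro the_inv_into_into[OF inj]) (auto simp: isometry_def)
  have "the_inv_into M f ` M = M"
  proof
    show "M \<subseteq> the_inv_into M f ` M"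
    proof
      fix x assume "x \<in> M"
      moreover then have "f x \<in> M" using assms by (auto simp: isometry_def)
      ultimately show "x \<in> the_inv_into M f ` M"
        by (intro image_eqI[of _ _ "f x"]) (simp_all add: 1)
    qed
  qed (use 3 in auto)
  moreover have "d (the_inv_into M f x) (the_inv_into M f y) = d x y" if "x \<in> M" "y \<in> M" for x y
  proof -
    have "d (f (the_inv_into M f x)) (f (the_inv_into M f y)) = d (the_inv_into M f x) (the_inv_into M f y)"
      using assms 3 that unfolding isometry_def by blast
    then show ?thesis using 2 that by simp
  qed
  ultimately have "isometry (the_inv_into M f)" by (auto simp: isometry_def)
  then show ?thesis using 1 2 by blast
qed

lemma cover_num_isometry_le:
  assumes "mtotally_bounded M" "0 < r" "A \<subseteq> M" "isometry f"
  shows "cover_num r (f ` A) \<le> cover_num r A"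
proof -
  from cover_num_attained[OF assms(1-3)] obtain S where
    S: "finite S" "S \<subseteq> M" "card S = cover_num r A" "A \<subseteq> (\<Union>s\<in>S. mball s r)" .
  have "cover_num r (f ` A) \<le> card (f ` S)"
  proof (rule cover_num_le)
    show "f ` A \<subseteq> (\<Union>s\<in>f ` S. mball s r)"
    proof
      fix y assume "y \<in> f ` A"
      then obtain x s where "x \<in> A" "y = f x" "s \<in> S" "x \<in> mball s r" using S(4) by blast
      moreover from this have "d (f s) (f x) = d s x" "f s \<in> M" "f x \<in> M"
        using assms(4) unfolding isometry_def by auto
      ultimately have "y \<in> mball (f s) r" by simp
      then show "y \<in> (\<Union>s\<in>f ` S. mball s r)" using \<open>s \<in> S\<close> by blast
    qed
    show "f ` S \<subseteq> M" using S(2) assms(4) unfolding isometry_def by blast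
  qed (use S(1) in simp)
  also have "\<dots> \<le> card S" by (rule card_image_le[OF S(1)])
  finally show ?thesis using S by simp
qed

lemma isometry_image_subset: "isometry f \<Longrightarrow> A \<subseteq> M \<Longrightarrow> f ` A \<subseteq> M"
  by (auto simp: isometry_def)

lemma cover_num_isometry:
  assumes "mtotally_bounded M" "0 < r" "A \<subseteq> M" "isometry f"
  shows "cover_num r (f ` A) = cover_num r A"
proof (rule antisym[OF cover_num_isometry_le[OF assms]])
  from isometry_inverse[OF assms(4)] obtain g where
    g: "isometry g" "\<forall>x\<in>M. g (f x) = x" by (elim exE conjE)
  have "(\<lambda>x. g (f x)) ` A = id ` A" using g(2) assms(3) by (intro image_cong) auto
  then have "g ` f ` A = A" by (simp add: image_image)
  then show "cover_num r A \<le> cover_num r (f ` A)"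
    using cover_num_isometry_le[OF assms(1,2) isometry_image_subset[OF assms(4,3)] g(1)] by simp
qed

text \<open>The covering numbers divided by that of the whole space lie in the product of copies of \<open>{0..1}\<close>
over all subsets, which is compact by Tychonoff's theorem. A cluster point for \<open>r \<rightarrow> 0\<close> inherits every closed
relation that holds for all small radii; additivity on separated sets is one that holds only eventually.\<close>

lemma invariant_content_exists:
  assumes tb: "mtotally_bounded M" and ne: "M \<noteq> {}"
  obtains c :: "'a set \<Rightarrow> real" where "c M = 1" "c {} = 0" "\<And>A. 0 \<le> c A"
    "\<And>A B. A \<subseteq> B \<Longrightarrow> B \<subseteq> M \<Longrightarrow> c A \<le> c B"
    "\<And>A B. A \<subseteq> M \<Longrightarrow> B \<subseteq> M \<Longrightarrow> c (A \<union> B) \<le> c A + c B"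
    "\<And>A B \<delta>. A \<subseteq> M \<Longrightarrow> B \<subseteq> M \<Longrightarrow> 0 < \<delta> \<Longrightarrow> (\<And>a b. a \<in> A \<Longrightarrow> b \<in> B \<Longrightarrow> \<delta> \<le> d a b)
        \<Longrightarrow> c A + c B \<le> c (A \<union> B)"
    "\<And>f A. isometry f \<Longrightarrow> A \<subseteq> M \<Longrightarrow> c (f ` A) = c A"
proof -
  define r where "r n = 1 / real (Suc n)" for n
  have r: "0 < r n" for n by (simp add: r_def)
  define \<rho> where "\<rho> n A = (if A \<subseteq> M then real (cover_num (r n) A) / real (cover_num (r n) M) else 0)" for n A
  have pos: "0 < cover_num (r n) M" for n
  proof -
    obtain S where "finite S" "card S = cover_num (r n) M" "M \<subseteq> (\<Union>s\<in>S. mball s (r n))"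
      by (rule cover_num_attained[OF tb r order_refl])
    moreover from this have "S \<noteq> {}" using ne by auto
    ultimately show ?thesis using card_gt_0_iff[of S] by simp
  qed
  have ratio01: "\<rho> n A \<in> {0..1}" for n A
    using cover_num_mono[OF tb r, of A M n] pos[of n] by (auto simp: \<rho>_def)
  define F where "F = filtermap \<rho> sequentially"
  have F: "F \<noteq> bot" by (simp add: F_def filtermap_bot_iff)
  have "compactin (product_topology (\<lambda>_. euclidean) UNIV) (Pi\<^sub>E UNIV (\<lambda>_::'a set. {0..1::real}))"
    unfolding compactin_PiE by simp
  then have "compact (Pi\<^sub>E UNIV (\<lambda>_::'a set. {0..1::real}))"
    by (simp only: euclidean_product_topology compactin_euclidean_iff)
  moreover have "eventually (\<lambda>f. f \<in> Pi\<^sub>E UNIV (\<lambda>_::'a set. {0..1::real})) F"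
    unfolding F_def eventually_filtermap using ratio01 by (auto simp: PiE_def)
  ultimately obtain c where c: "inf (nhds c) F \<noteq> bot"
    using F unfolding compact_filter by blast
  \<comment> \<open>along \<open>G\<close> the ratios converge to \<open>c\<close> at every set\<close>
  define G where "G = inf (nhds c) F"
  have G: "G \<noteq> bot" using c by (simp add: G_def)
  have lim: "((\<lambda>f. f A) \<longlongrightarrow> c A) G" for A
  proof -
    have "((\<lambda>f. f A) \<longlongrightarrow> c A) (nhds c)"
    proof -
      have "continuous_on UNIV (\<lambda>f :: 'a set \<Rightarrow> real. f A)" by (rule continuous_on_product_coordinates)
      then have "((\<lambda>f. f A) \<longlongrightarrow> c A) (at c)" unfolding continuous_on_def by simp
      then show ?thesis by (rule tendsto_at_iff_tendsto_nhds[of "\<lambda>f. f A" c, THEN iffD1])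
    qed
    then show ?thesis unfolding G_def by (rule tendsto_mono[OF inf_le1])
  qed
  have ev: "eventually P G" if "\<forall>\<^sub>F n in sequentially. P (\<rho> n)" for P
  proof -
    have "eventually P F" using that by (simp add: F_def eventually_filtermap)
    then show ?thesis unfolding G_def by (rule filter_leD[OF inf_le2])
  qed
  have closed: "u \<le> v" if "(U \<longlongrightarrow> u) G" "(V \<longlongrightarrow> v) G" "\<forall>\<^sub>F n in sequentially. U (\<rho> n) \<le> V (\<rho> n)"
    for u v :: real and U V
    by (rule tendsto_le[OF G that(2,1) ev]) (rule that(3))
  have closed_eq: "u = v" if "(U \<longlongrightarrow> u) G" "(V \<longlongrightarrow> v) G" "\<And>n. U (\<rho> n) = V (\<rho> n)"
    for u v :: real and U V
    using closed[OF that(1,2)] closed[OF that(2,1)] that(3) by (simp add: order_antisym)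
  show thesis
  proof (rule that[of c])
    have "\<rho> n M = 1" for n using pos[of n] by (simp add: \<rho>_def)
    then show "c M = 1" by (rule closed_eq[OF lim tendsto_const])
    have "\<rho> n {} = 0" for n by (simp add: \<rho>_def cover_num_empty)
    then show "c {} = 0" by (rule closed_eq[OF lim tendsto_const])
    show "0 \<le> c A" for A
      by (rule closed[OF tendsto_const lim]) (use ratio01 in simp)
    show "c A \<le> c B" if "A \<subseteq> B" "B \<subseteq> M" for A B
      by (rule closed[OF lim lim])
        (use that cover_num_mono[OF tb r that] in \<open>simp add: \<rho>_def divide_right_mono\<close>)
    show "c (A \<union> B) \<le> c A + c B" if "A \<subseteq> M" "B \<subseteq> M" for A B
    proof -
      have "\<rho> n (A \<union> B) \<le> \<rho> n A + \<rho> n B" for n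
      proof -
        have "real (cover_num (r n) (A \<union> B)) \<le> real (cover_num (r n) A) + real (cover_num (r n) B)"
          using cover_num_Un[OF tb r that, of n] by linarith
        from divide_right_mono[OF this, of "real (cover_num (r n) M)"]
        show ?thesis
          using that by (simp add: \<rho>_def add_divide_distrib)
      qed
      then have "\<forall>\<^sub>F n in sequentially. \<rho> n (A \<union> B) \<le> \<rho> n A + \<rho> n B" by simp
      then show ?thesis
        by (rule closed[OF lim tendsto_add[OF lim lim]])
    qed
    show "c A + c B \<le> c (A \<union> B)" if *: "A \<subseteq> M" "B \<subseteq> M" "0 < \<delta>" "\<And>a b. a \<in> A \<Longrightarrow> b \<in> B \<Longrightarrow> \<delta> \<le> d a b" for A B \<delta>
    proof (rule closed[OF tendsto_add[OF lim lim] lim])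
      have "0 < \<delta> / 2" using *(3) by simp
      then obtain N where N: "1 / real (Suc N) < \<delta> / 2" by (rule nat_approx_posE)
      show "\<forall>\<^sub>F n in sequentially. \<rho> n A + \<rho> n B \<le> \<rho> n (A \<union> B)"
      proof (rule eventually_sequentiallyI)
        fix n assume "N \<le> n"
        then have "r n \<le> 1 / real (Suc N)" by (simp add: r_def frac_le)
        with N have "2 * r n \<le> \<delta>" by simp
        then have "2 * r n \<le> d a b" if "a \<in> A" "b \<in> B" for a b using *(4)[OF that] by simp
        from cover_num_separated[OF tb r *(1,2) this]
        have "real (cover_num (r n) A) + real (cover_num (r n) B) \<le> real (cover_num (r n) (A \<union> B))"
          by linarith
        from divide_right_mono[OF this, of "real (cover_num (r n) M)"]
        show "\<rho> n A + \<rho> n B \<le> \<rho> n (A \<union> B)"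
          using *(1,2) by (simp add: \<rho>_def add_divide_distrib)
      qed
    qed
    show "c (f ` A) = c A" if "isometry f" "A \<subseteq> M" for f A
    proof -
      have "\<rho> n (f ` A) = \<rho> n A" for n
        using isometry_image_subset[OF that] that(2)
        by (simp add: \<rho>_def cover_num_isometry[OF tb r that(2,1)])
      then show ?thesis by (rule closed_eq[OF lim lim])
    qed
  qed
qed

end

context Metric_space
begin

lemma isometry_openin:
  assumes f: "isometry f" and U: "openin mtopology U"
  shows "openin mtopology (f ` U)"
proof (unfold openin_mtopology, intro conjI allI impI)
  have UM: "U \<subseteq> M" using openin_subset[OF U] by simp
  then show "f ` U \<subseteq> M" by (rule isometry_image_subset[OF f])
  fix y assume "y \<in> f ` U"
  then obtain x where x: "x \<in> U" "y = f x" by blast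
  then obtain r where r: "0 < r" "mball x r \<subseteq> U" using U unfolding openin_mtopology by blast
  have "mball y r \<subseteq> f ` U"
  proof
    fix z assume z: "z \<in> mball y r"
    then have "z \<in> f ` M" using f by (simp add: isometry_def)
    then obtain w where w: "w \<in> M" "z = f w" by blast
    have "d x w = d y z" using f x w UM unfolding isometry_def by auto
    then have "w \<in> mball x r" using z w x UM by auto
    then show "z \<in> f ` U" using r(2) w(2) by blast
  qed
  with r(1) show "\<exists>r>0. mball y r \<subseteq> f ` U" by blast
qed

text \<open>Covering by countably many open sets, weighted with the content, gives an outer measure. Since the space is compact,
finite subadditivity of the content already forces total mass \<open>1\<close>. Intersecting the covering sets with separated
neighbourhoods makes the outer measure additive on separated sets, so closed sets are measurable.\<close>

theorem isometry_invariant_measure_exists: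
  assumes cpt: "compact_space mtopology" and ne: "M \<noteq> {}"
  shows "\<exists>N. sets N = sigma_sets M {U. openin mtopology U} \<and> emeasure N M = 1 \<and>
    (\<forall>f A. isometry f \<longrightarrow> A \<in> sets N \<longrightarrow> f ` A \<in> sets N \<and> emeasure N (f ` A) = emeasure N A)"
proof (rule invariant_content_exists[OF _ ne])
  show "mtotally_bounded M"
    using cpt compactin_imp_mtotally_bounded[of M] by (simp add: compact_space_def)
  fix c :: "'a set \<Rightarrow> real" assume c: "c M = 1" "c {} = 0" "\<And>A. 0 \<le> c A"
    and c_mono: "\<And>A B. A \<subseteq> B \<Longrightarrow> B \<subseteq> M \<Longrightarrow> c A \<le> c B"
    and c_sub: "\<And>A B. A \<subseteq> M \<Longrightarrow> B \<subseteq> M \<Longrightarrow> c (A \<union> B) \<le> c A + c B"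
    and c_sep: "\<And>A B \<delta>. A \<subseteq> M \<Longrightarrow> B \<subseteq> M \<Longrightarrow> 0 < \<delta> \<Longrightarrow> (\<And>a b. a \<in> A \<Longrightarrow> b \<in> B \<Longrightarrow> \<delta> \<le> d a b)
        \<Longrightarrow> c A + c B \<le> c (A \<union> B)"
    and c_iso: "\<And>f A. isometry f \<Longrightarrow> A \<subseteq> M \<Longrightarrow> c (f ` A) = c A"
  define covers where "covers A = {U :: nat \<Rightarrow> 'a set. (\<forall>i. openin mtopology (U i)) \<and> A \<subseteq> (\<Union>i. U i)}" for A
  define \<mu> where "\<mu> A = (INF U\<in>covers A. suminf (\<lambda>i. ennreal (c (U i))))" for A
  have \<mu>_le: "\<mu> A \<le> suminf (\<lambda>i. ennreal (c (U i)))" if "U \<in> covers A" for A U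
    unfolding \<mu>_def by (rule INF_lower[OF that])
  have open_sub: "openin mtopology U \<Longrightarrow> U \<subseteq> M" for U using openin_subset[of mtopology U] by simp
  have \<mu>_empty: "\<mu> {} = 0"
  proof -
    have "(\<lambda>_. {}) \<in> covers {}" by (simp add: covers_def)
    from \<mu>_le[OF this] show ?thesis by (simp add: c)
  qed
  have \<mu>_mono: "\<mu> A \<le> \<mu> B" if "A \<subseteq> B" for A B
    unfolding \<mu>_def by (rule INF_superset_mono) (use that in \<open>auto simp: covers_def\<close>)
  have \<mu>_M_le: "\<mu> M \<le> 1"
  proof -
    have "(\<lambda>i::nat. if i = 0 then M else {}) \<in> covers M"
      using openin_topspace[of mtopology] by (auto simp: covers_def)
    from \<mu>_le[OF this] have "\<mu> M \<le> suminf (\<lambda>i. ennreal (c (if i = (0::nat) then M else {})))" .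
    also have "\<dots> = (\<Sum>i\<in>{0}. ennreal (c (if i = (0::nat) then M else {})))"
      by (rule suminf_finite) (auto simp: c)
    finally show ?thesis by (simp add: c)
  qed
  have c_finite: "c (\<Union>i\<in>I. U i) \<le> (\<Sum>i\<in>I. c (U i))" if "finite I" "\<And>i. U i \<subseteq> M"
    for I and U :: "nat \<Rightarrow> 'a set"
    using that(1)
  proof (induction I)
    case (insert i I)
    have "c (U i \<union> (\<Union>i\<in>I. U i)) \<le> c (U i) + c (\<Union>i\<in>I. U i)"
      by (rule c_sub) (use that(2) in auto)
    with insert show ?case by simp
  qed (simp add: c)
  have \<mu>_M_ge: "1 \<le> \<mu> M"
    unfolding \<mu>_def
  proof (rule INF_greatest)
    fix U assume "U \<in> covers M"
    then have U: "\<And>i. openin mtopology (U i)" "M \<subseteq> (\<Union>i. U i)" by (auto simp: covers_def)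
    have "compactin mtopology M" using cpt by (simp add: compact_space_def)
    moreover have "\<forall>V\<in>range U. openin mtopology V" using U(1) by simp
    ultimately have "\<exists>\<F>. finite \<F> \<and> \<F> \<subseteq> range U \<and> M \<subseteq> \<Union>\<F>"
      using U(2) unfolding compactin_def by simp
    then obtain \<F> where F: "finite \<F>" "\<F> \<subseteq> range U" "M \<subseteq> \<Union>\<F>" by (elim exE conjE)
    obtain I where I: "finite I" "\<F> = U ` I" using finite_subset_image[OF F(1,2)] by (elim exE conjE)
    have "(\<Union>i\<in>I. U i) = M"
    proof
      show "(\<Union>i\<in>I. U i) \<subseteq> M" using open_sub[OF U(1)] by blast
      show "M \<subseteq> (\<Union>i\<in>I. U i)" using F(3) I(2) by simp
    qed
    then have "1 \<le> (\<Sum>i\<in>I. c (U i))"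
      using c_finite[OF I(1), of U] open_sub[OF U(1)] c(1) by simp
    then have "1 \<le> ennreal (\<Sum>i\<in>I. c (U i))" by simp
    also have "\<dots> = (\<Sum>i\<in>I. ennreal (c (U i)))" by (simp add: c sum_ennreal)
    also have "\<dots> \<le> suminf (\<lambda>i. ennreal (c (U i)))" by (rule sum_le_suminf) (use I(1) in auto)
    finally show "1 \<le> suminf (\<lambda>i. ennreal (c (U i)))" .
  qed
  have \<mu>_sub: "\<mu> (\<Union>i. A i) \<le> suminf (\<lambda>i. \<mu> (A i))" for A :: "nat \<Rightarrow> 'a set"
  proof (rule ennreal_le_epsilon)
    fix e :: real assume e: "0 < e" and fin: "suminf (\<lambda>i. \<mu> (A i)) < Orderings.top"
    have "\<exists>U\<in>covers (A n). suminf (\<lambda>i. ennreal (c (U i))) < \<mu> (A n) + ennreal (e * (1/2)^Suc n)" for n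
    proof -
      have "\<mu> (A n) < Orderings.top" using ennreal_suminf_lessD[OF fin] .
      then have "\<mu> (A n) < \<mu> (A n) + ennreal (e * (1/2)^Suc n)" using e by (simp add: less_top)
      then show ?thesis unfolding \<mu>_def INF_less_iff .
    qed
    then obtain B where B: "\<And>n. B n \<in> covers (A n)"
      "\<And>n. suminf (\<lambda>i. ennreal (c (B n i))) < \<mu> (A n) + ennreal (e * (1/2)^Suc n)" by metis
    define C where "C = case_prod B o prod_decode"
    have C: "B n i = C (prod_encode (n, i))" for n i by (simp add: C_def)
    have "C \<in> covers (\<Union>i. A i)"
    proof -
      have "openin mtopology (C k)" for k
        using B(1) by (simp add: C_def covers_def split: prod.split)
      moreover have "(\<Union>i. A i) \<subseteq> (\<Union>k. C k)"
      proof
        fix x assume "x \<in> (\<Union>i. A i)"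
        then obtain n where "x \<in> A n" by blast
        then obtain i where "x \<in> B n i" using B(1)[of n] by (auto simp: covers_def)
        then show "x \<in> (\<Union>k. C k)" unfolding C by blast
      qed
      ultimately show ?thesis by (simp add: covers_def)
    qed
    from \<mu>_le[OF this] have "\<mu> (\<Union>i. A i) \<le> suminf (\<lambda>i. ennreal (c (C i)))" .
    also have "\<dots> = suminf (\<lambda>n. suminf (\<lambda>i. ennreal (c (B n i))))"
      unfolding C_def comp_def by (subst suminf_ennreal_2dimen[symmetric, where f="\<lambda>p. ennreal (c (case_prod B p))"])
        (auto simp: comp_def)
    also have "\<dots> \<le> suminf (\<lambda>n. \<mu> (A n) + ennreal (e * (1/2)^Suc n))"
      by (intro suminf_le less_imp_le[OF B(2)]) auto
    also have "\<dots> = suminf (\<lambda>n. \<mu> (A n)) + suminf (\<lambda>n. ennreal (e * (1/2)^Suc n))"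
      by (rule suminf_add[symmetric]) auto
    also have "suminf (\<lambda>n. ennreal (e * (1/2)^Suc n)) = ennreal e"
    proof -
      have "(\<lambda>n. e * (1/2)^Suc n) sums (e * 1)" by (rule sums_mult[OF power_half_series])
      then show ?thesis using e by (intro suminf_ennreal_eq) auto
    qed
    finally show "\<mu> (\<Union>i. A i) \<le> suminf (\<lambda>i. \<mu> (A i)) + ennreal e" .
  qed
  have oms: "outer_measure_space (Pow M) \<mu>"
    unfolding outer_measure_space_def positive_def increasing_def countably_subadditive_def
    by (intro conjI ballI allI impI \<mu>_empty \<mu>_sub) (rule \<mu>_mono)
  have sep: "\<mu> A + \<mu> B \<le> \<mu> (A \<union> B)" if A: "A \<subseteq> M" and B: "B \<subseteq> M" and \<delta>: "0 < \<delta>"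
    and far: "\<And>a b. a \<in> A \<Longrightarrow> b \<in> B \<Longrightarrow> \<delta> \<le> d a b" for A B \<delta>
    unfolding \<mu>_def[of "A \<union> B"]
  proof (rule INF_greatest)
    fix U assume "U \<in> covers (A \<union> B)"
    then have U: "\<And>i. openin mtopology (U i)" "A \<union> B \<subseteq> (\<Union>i. U i)" by (auto simp: covers_def)
    \<comment> \<open>a third of \<open>\<delta>\<close> still leaves a distance of \<open>\<delta>/3\<close> between the neighbourhoods\<close>
    define nb where "nb S = (\<Union>a\<in>S. mball a (\<delta>/3))" for S
    have nb: "openin mtopology (nb S)" for S by (auto simp: nb_def)
    have nb_sup: "S \<subseteq> nb S" if "S \<subseteq> M" for S
    proof
      fix x assume "x \<in> S"
      moreover from this have "x \<in> mball x (\<delta>/3)" using that \<delta> by auto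
      ultimately show "x \<in> nb S" unfolding nb_def by blast
    qed
    have "A \<subseteq> (\<Union>i. U i \<inter> nb A)" "B \<subseteq> (\<Union>i. U i \<inter> nb B)"
      using U(2) nb_sup[OF A] nb_sup[OF B] by blast+
    then have "(\<lambda>i. U i \<inter> nb A) \<in> covers A" "(\<lambda>i. U i \<inter> nb B) \<in> covers B"
      by (simp_all add: covers_def openin_Int[OF U(1) nb])
    then have "\<mu> A + \<mu> B \<le> suminf (\<lambda>i. ennreal (c (U i \<inter> nb A))) + suminf (\<lambda>i. ennreal (c (U i \<inter> nb B)))"
      by (intro add_mono \<mu>_le)
    also have "\<dots> = suminf (\<lambda>i. ennreal (c (U i \<inter> nb A)) + ennreal (c (U i \<inter> nb B)))"
      by (rule suminf_add) auto
    also have "\<dots> \<le> suminf (\<lambda>i. ennreal (c (U i)))"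
    proof (intro suminf_le)
      fix i
      have "c (U i \<inter> nb A) + c (U i \<inter> nb B) \<le> c (U i \<inter> nb A \<union> U i \<inter> nb B)"
      proof (rule c_sep)
        fix x y assume "x \<in> U i \<inter> nb A" "y \<in> U i \<inter> nb B"
        then obtain a b where *: "a \<in> A" "b \<in> B" "a \<in> M" "b \<in> M" "x \<in> M" "y \<in> M" "d a x < \<delta>/3" "d b y < \<delta>/3"
          unfolding nb_def by auto
        have "d a b \<le> d a x + d x b" "d x b \<le> d x y + d y b" using * by (auto intro: triangle)
        then show "\<delta>/3 \<le> d x y" using far[OF *(1,2)] * commute[of y b] by linarith
      next
        show "0 < \<delta> / 3" using \<delta> by simp
      qed (use open_sub[OF U(1)[of i]] in blast)+
      also have "\<dots> \<le> c (U i)" by (rule c_mono) (use open_sub[OF U(1)[of i]] in blast)+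
      finally show "ennreal (c (U i \<inter> nb A)) + ennreal (c (U i \<inter> nb B)) \<le> ennreal (c (U i))"
        by (simp add: c ennreal_plus[symmetric] del: ennreal_plus)
    qed auto
    finally show "\<mu> A + \<mu> B \<le> suminf (\<lambda>i. ennreal (c (U i)))" .
  qed
  have fin: "\<mu> M < Orderings.top" using le_less_trans[OF \<mu>_M_le] by simp
  interpret P: sigma_algebra M "Pow M" by (rule sigma_algebra_Pow)
  define L where "L = lambda_system M (Pow M) \<mu>"
  have ms: "measure_space M L \<mu>" unfolding L_def by (rule P.caratheodory_lemma[OF oms])
  then interpret L: sigma_algebra M L by (simp add: measure_space_def)
  have open_L: "U \<in> L" if U: "openin mtopology U" for U
  proof -
    have "closedin mtopology (M - U)" using U by (simp add: closedin_def Diff_Diff_Int Int_absorb1 open_sub)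
    then have "M - U \<in> L" unfolding L_def
    proof (rule closedin_caratheodory[OF oms fin, rotated])
      fix A B and \<delta> :: real
      assume "A \<subseteq> M" "B \<subseteq> M" "0 < \<delta>" "\<And>a b. a \<in> A \<Longrightarrow> b \<in> B \<Longrightarrow> \<delta> \<le> d a b"
      then show "\<mu> A + \<mu> B \<le> \<mu> (A \<union> B)" by (rule sep)
    qed
    then have "M - (M - U) \<in> L" by (rule L.compl_sets)
    then show ?thesis using open_sub[OF U] by (simp add: Diff_Diff_Int Int_absorb1)
  qed
  define N where "N = measure_of M {U. openin mtopology U} \<mu>"
  have opens: "{U. openin mtopology U} \<subseteq> Pow M" using open_sub by blast
  have sets_N: "sets N = sigma_sets M {U. openin mtopology U}"
    unfolding N_def by (rule sets_measure_of[OF opens])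
  have sets_L: "sets N \<subseteq> L" unfolding sets_N by (rule L.sigma_sets_subset) (use open_L in blast)
  have em: "emeasure N A = \<mu> A" if "A \<in> sets N" for A
  proof (rule emeasure_measure_of[OF N_def opens _ _ that])
    show "positive (sets N) \<mu>" by (simp add: positive_def \<mu>_empty)
    show "countably_additive (sets N) \<mu>"
      using ms sets_L unfolding measure_space_def countably_additive_def by blast
  qed
  have \<mu>_iso_le: "\<mu> (f ` A) \<le> \<mu> A" if f: "isometry f" for f A
    unfolding \<mu>_def[of A]
  proof (rule INF_greatest)
    fix U assume "U \<in> covers A"
    then have U: "\<And>i. openin mtopology (U i)" "A \<subseteq> (\<Union>i. U i)" by (auto simp: covers_def)
    have "f ` A \<subseteq> (\<Union>i. f ` U i)" using U(2) by blast
    then have "(\<lambda>i. f ` U i) \<in> covers (f ` A)"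
      using isometry_openin[OF f U(1)] by (simp add: covers_def)
    from \<mu>_le[OF this] show "\<mu> (f ` A) \<le> suminf (\<lambda>i. ennreal (c (U i)))"
      using c_iso[OF f open_sub[OF U(1)]] by simp
  qed
  show "\<exists>N. sets N = sigma_sets M {U. openin mtopology U} \<and> emeasure N M = 1 \<and>
    (\<forall>f A. isometry f \<longrightarrow> A \<in> sets N \<longrightarrow> f ` A \<in> sets N \<and> emeasure N (f ` A) = emeasure N A)"
  proof (intro exI[of _ N] conjI allI impI)
    show "sets N = sigma_sets M {U. openin mtopology U}" by (rule sets_N)
    have "M \<in> sets N" unfolding sets_N by (rule sigma_sets_top)
    then show "emeasure N M = 1" using em \<mu>_M_le \<mu>_M_ge by (simp add: order_antisym)
    fix f A assume f: "isometry f" and A: "A \<in> sets N"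
    from isometry_inverse[OF f] obtain g where
      g: "isometry g" "\<forall>x\<in>M. g (f x) = x" by (elim exE conjE)
    have inj: "inj_on f M" by (rule inj_on_inverseI[of _ g]) (simp add: g(2))
    have fM: "f ` M = M" using f by (simp add: isometry_def)
    have "f ` A \<in> sigma_sets M {U. openin mtopology U} \<and> A \<subseteq> M"
      using A unfolding sets_N
    proof (induction A rule: sigma_sets.induct)
      case (Basic a) then show ?case using isometry_openin[OF f, of a] open_sub[of a] by auto
    next
      case (Compl a)
      then have "f ` (M - a) = M - f ` a" using inj_on_image_set_diff[OF inj, of M a] fM by auto
      then show ?case using Compl by (auto intro: sigma_sets.Compl)
    next
      case (Union a)
      then show ?case unfolding image_UN by (auto intro: sigma_sets.Union)
    qed (auto intro: sigma_sets.Empty)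
    then have fA: "f ` A \<in> sets N" and AM: "A \<subseteq> M" unfolding sets_N by auto
    have "(\<lambda>x. g (f x)) ` A = id ` A" using g(2) AM by (intro image_cong) auto
    then have "g ` f ` A = A" by (simp add: image_image)
    then have "\<mu> (f ` A) = \<mu> A"
      using \<mu>_iso_le[OF f, of A] \<mu>_iso_le[OF g(1), of "f ` A"] by simp
    then show "emeasure N (f ` A) = emeasure N A" using em[OF A] em[OF fA] by simp
    show "f ` A \<in> sets N" by (rule fA)
  qed
qed

end

section \<open>Uniqueness of left-invariant probability measures\<close>

text \<open>The measure of \<open>{(x, y). x\<^sup>-\<^sup>1 y \<in> A}\<close> can be computed in both orders: \<open>x\<^sup>-\<^sup>1 y\<close> is a left translate of \<open>y\<close>, and its
inverse \<open>y\<^sup>-\<^sup>1 x\<close> is a left translate of \<open>x\<close>. The right hand side depends only on \<open>M\<close>, so there is at most one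
choice of \<open>N\<close>.\<close>

lemma left_invariant_emeasure_eq_inverse:
  fixes M N :: "'g measure" and m :: "'g \<Rightarrow> 'g \<Rightarrow> 'g" and i :: "'g \<Rightarrow> 'g"
  assumes M1: "emeasure M (space M) = 1" and N1: "emeasure N (space N) = 1"
    and setsN: "sets N = sets M"
    and m: "(\<lambda>(x, y). m x y) \<in> M \<Otimes>\<^sub>M M \<rightarrow>\<^sub>M M" and i: "i \<in> M \<rightarrow>\<^sub>M M"
    and flip: "\<And>x y. x \<in> space M \<Longrightarrow> y \<in> space M \<Longrightarrow> i (m (i y) x) = m (i x) y"
    and leftM: "\<And>k A. k \<in> space M \<Longrightarrow> A \<in> sets M \<Longrightarrow> emeasure M ({x\<in>space M. m k x \<in> A}) = emeasure M A"
    and leftN: "\<And>k A. k \<in> space M \<Longrightarrow> A \<in> sets M \<Longrightarrow> emeasure N ({x\<in>space M. m k x \<in> A}) = emeasure N A"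
    and A: "A \<in> sets M"
  shows "emeasure N A = emeasure M {x\<in>space M. i x \<in> A}"
proof -
  have sp: "space N = space M" by (rule sets_eq_imp_space_eq[OF setsN])
  have m2: "(\<lambda>x. m (f x) (g x)) \<in> L \<rightarrow>\<^sub>M M" if "f \<in> L \<rightarrow>\<^sub>M M" "g \<in> L \<rightarrow>\<^sub>M M" for f g and L :: "'h measure"
    using measurable_compose[OF measurable_Pair[OF that] m] by simp
  have ix: "i x \<in> space M" if "x \<in> space M" for x by (rule measurable_space[OF i that])
  interpret M: finite_measure M by standard (simp add: M1)
  interpret N: finite_measure N by standard (simp add: N1)
  interpret pair_sigma_finite M N ..
  have [measurable_cong]: "sets N = sets M" by (rule setsN)
  note [measurable] = A i
  have meas: "(\<lambda>(x, y). indicator A (m (i x) y) :: ennreal) \<in> borel_measurable (M \<Otimes>\<^sub>M N)"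
  proof -
    have "(\<lambda>z. m (i (fst z)) (snd z)) \<in> M \<Otimes>\<^sub>M N \<rightarrow>\<^sub>M M"
      by (rule m2) measurable
    then show ?thesis unfolding split_beta' by measurable
  qed
  have mk: "(\<lambda>y. m k y) \<in> M \<rightarrow>\<^sub>M M" if "k \<in> space M" for k
    by (rule m2[OF measurable_const[OF that] measurable_ident_sets[OF refl]])
  have ind_eq: "(\<integral>\<^sup>+ x. indicator A (f x) \<partial>L) = emeasure L {x\<in>space M. f x \<in> A}"
    if "f \<in> M \<rightarrow>\<^sub>M M" "sets L = sets M" for f and L :: "'g measure"
  proof -
    have sL: "space L = space M" by (rule sets_eq_imp_space_eq[OF that(2)])
    have "(\<integral>\<^sup>+ x. indicator A (f x) \<partial>L) = (\<integral>\<^sup>+ x. indicator {x\<in>space M. f x \<in> A} x \<partial>L)"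
      by (rule nn_integral_cong) (simp add: indicator_def sL)
    also have "\<dots> = emeasure L {x\<in>space M. f x \<in> A}"
    proof (rule nn_integral_indicator)
      have "f -` A \<inter> space M \<in> sets M" by (rule measurable_sets[OF that(1) A])
      also have "f -` A \<inter> space M = {x\<in>space M. f x \<in> A}" by auto
      finally show "{x\<in>space M. f x \<in> A} \<in> sets L" using that(2) by simp
    qed
    finally show ?thesis .
  qed
  define B where "B = {x\<in>space M. i x \<in> A}"
  have B: "B \<in> sets M" unfolding B_def by measurable
  have "emeasure N A = (\<integral>\<^sup>+ x. emeasure N A \<partial>M)" by (simp add: M1)
  also have "\<dots> = (\<integral>\<^sup>+ x. (\<integral>\<^sup>+ y. indicator A (m (i x) y) \<partial>N) \<partial>M)"
    by (rule nn_integral_cong) (simp add: ind_eq mk ix setsN leftN[OF ix A])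
  also have "\<dots> = (\<integral>\<^sup>+ y. (\<integral>\<^sup>+ x. indicator A (m (i x) y) \<partial>M) \<partial>N)"
    by (rule Fubini'[OF meas, symmetric])
  also have "\<dots> = (\<integral>\<^sup>+ y. emeasure M B \<partial>N)"
  proof (rule nn_integral_cong)
    fix y assume "y \<in> space N"
    then have y: "y \<in> space M" by (simp add: sp)
    have "(\<integral>\<^sup>+ x. indicator A (m (i x) y) \<partial>M) = emeasure M {x\<in>space M. m (i x) y \<in> A}"
      by (rule ind_eq[OF m2[OF i measurable_const[OF y]] refl])
    also have "{x\<in>space M. m (i x) y \<in> A} = {x\<in>space M. m (i y) x \<in> B}"
      using flip[OF _ y] measurable_space[OF mk[OF ix[OF y]]] unfolding B_def by auto
    also have "emeasure M \<dots> = emeasure M B" by (rule leftM[OF ix[OF y] B])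
    finally show "(\<integral>\<^sup>+ x. indicator A (m (i x) y) \<partial>M) = emeasure M B" .
  qed
  also have "\<dots> = emeasure M B" using N1 by simp
  finally show ?thesis by (simp add: B_def)
qed

section \<open>Conjugation and real part\<close>

lemma conjg_0 [simp]: "conjg 0 = (0::'a::conj_div_algebra)"
  using conjg_add[of "0::'a" 0] by simp

lemma norm_conjg [simp]: "norm (conjg x) = norm (x::'a::conj_div_algebra)"
proof (cases "x = 0")
  case False
  have "norm (x * conjg x) = norm ((norm x)\<^sup>2 *\<^sub>R (1::'a))" by (simp only: mult_conjg)
  then have "norm x * norm (conjg x) = norm x * norm x" by (simp add: norm_mult power2_eq_square)
  with False show ?thesis by simp
qed simp

lemma conjg_eq_0_iff [simp]: "conjg x = 0 \<longleftrightarrow> x = (0::'a::conj_div_algebra)"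
  by (metis norm_conjg norm_eq_zero)

lemma conjg_scaleR_1: "conjg (r *\<^sub>R (1::'a::conj_div_algebra)) = r *\<^sub>R 1"
proof (cases "r = 0")
  case False
  have "(r *\<^sub>R (1::'a)) * conjg (r *\<^sub>R 1) = (norm (r *\<^sub>R (1::'a)))\<^sup>2 *\<^sub>R 1" by (rule mult_conjg)
  then have "r *\<^sub>R conjg (r *\<^sub>R (1::'a)) = r *\<^sub>R (r *\<^sub>R 1)" by (simp add: power2_eq_square)
  then show ?thesis by (rule scaleR_left_imp_eq[OF False])
qed simp

lemma conjg_1 [simp]: "conjg (1::'a::conj_div_algebra) = 1"
  using conjg_scaleR_1[of 1, where 'a='a] by simp

lemma conjg_scaleR [simp]: "conjg (r *\<^sub>R x) = r *\<^sub>R conjg (x::'a::conj_div_algebra)"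
proof -
  have "conjg ((r *\<^sub>R 1) * x) = conjg x * conjg (r *\<^sub>R 1)" by (rule conjg_mult)
  then show ?thesis by (simp add: conjg_scaleR_1)
qed

lemma bounded_linear_conjg: "bounded_linear (conjg :: 'a::conj_div_algebra \<Rightarrow> 'a)"
  by (rule bounded_linear_intro[of _ 1]) (simp_all add: conjg_add)

lemma conjg_minus [simp]: "conjg (- x) = - conjg (x::'a::conj_div_algebra)"
  using conjg_scaleR[of "-1" x] by simp

lemma conjg_sum: "conjg (sum f A) = (\<Sum>x\<in>A. conjg (f x :: 'a::conj_div_algebra))"
  by (rule linear_sum[OF bounded_linear.linear[OF bounded_linear_conjg]])

lemma continuous_on_conjg [continuous_intros]:
  "continuous_on S f \<Longrightarrow> continuous_on S (\<lambda>x. conjg (f x :: 'a::conj_div_algebra))"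
  by (rule bounded_linear.continuous_on[OF bounded_linear_conjg])

lemma conjg_mult_self: "conjg x * x = (norm x)\<^sup>2 *\<^sub>R (1::'a::conj_div_algebra)"
  using mult_conjg[of "conjg x"] by (simp add: conjg_conjg)

lemma repart_eqI: "x + conjg x = (2 * r) *\<^sub>R (1::'a::conj_div_algebra) \<Longrightarrow> repart x = r"
  unfolding add_conjg by (simp add: scaleR_cancel_right)

lemma repart_add: "repart (x + y) = repart x + repart (y::'a::conj_div_algebra)"
proof (rule repart_eqI)
  have "(x + y) + conjg (x + y) = (x + conjg x) + (y + conjg y)" by (simp add: conjg_add)
  then show "(x + y) + conjg (x + y) = (2 * (repart x + repart y)) *\<^sub>R 1"
    unfolding add_conjg by (simp add: scaleR_add_left algebra_simps)
qed

lemma repart_scaleR [simp]: "repart (r *\<^sub>R x) = r * repart (x::'a::conj_div_algebra)"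
proof (rule repart_eqI)
  have "r *\<^sub>R x + conjg (r *\<^sub>R x) = r *\<^sub>R (x + conjg x)" by (simp add: scaleR_add_right)
  then show "r *\<^sub>R x + conjg (r *\<^sub>R x) = (2 * (r * repart x)) *\<^sub>R 1"
    unfolding add_conjg by simp
qed

lemma repart_1 [simp]: "repart (1::'a::conj_div_algebra) = 1"
  by (rule repart_eqI) (simp add: scaleR_2)

lemma repart_conjg [simp]: "repart (conjg x) = repart (x::'a::conj_div_algebra)"
  by (rule repart_eqI) (simp add: conjg_conjg add.commute add_conjg)

lemma repart_le_norm: "\<bar>repart x\<bar> \<le> norm (x::'a::conj_div_algebra)"
proof -
  have "norm ((2 * repart x) *\<^sub>R (1::'a)) \<le> norm x + norm (conjg x)"
    unfolding add_conjg[symmetric] by (rule norm_triangle_ineq)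
  then show ?thesis by simp
qed

lemma bounded_linear_repart: "bounded_linear (repart :: 'a::conj_div_algebra \<Rightarrow> real)"
  by (rule bounded_linear_intro[of _ 1]) (simp_all add: repart_add repart_le_norm)

lemma repart_0 [simp]: "repart (0::'a::conj_div_algebra) = 0"
  using repart_scaleR[of 0 "0::'a"] by simp

lemma repart_minus [simp]: "repart (- x) = - repart (x::'a::conj_div_algebra)"
  using repart_scaleR[of "-1" x] by simp

lemma repart_diff: "repart (x - y) = repart x - repart (y::'a::conj_div_algebra)"
  using repart_add[of x "- y"] by simp

lemma repart_sum: "repart (sum f A) = (\<Sum>x\<in>A. repart (f x :: 'a::conj_div_algebra))"
  by (rule linear_sum[OF bounded_linear.linear[OF bounded_linear_repart]])

lemma continuous_on_repart [continuous_intros]: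
  "continuous_on S f \<Longrightarrow> continuous_on S (\<lambda>x. repart (f x :: 'a::conj_div_algebra))"
  by (rule bounded_linear.continuous_on[OF bounded_linear_repart])

text \<open>The real part is invariant under conjugation by \<open>y\<close>, as \<open>z + conjg z\<close> is central; the factor \<open>conjg y\<close> replaces
\<open>inverse y\<close> up to a real multiple. This is the cyclicity of the real trace over a noncommutative field.\<close>

lemma repart_mult_commute: "repart (x * y) = repart (y * (x::'a::conj_div_algebra))"
proof (cases "y = 0")
  case False
  have "y * (x * y + conjg (x * y)) * conjg y = y * ((2 * repart (x * y)) *\<^sub>R 1) * conjg y"
    by (simp only: add_conjg)
  also have "\<dots> = ((norm y)\<^sup>2 * (2 * repart (x * y))) *\<^sub>R 1" by (simp add: mult_conjg mult.commute)
  also have "y * (x * y + conjg (x * y)) * conjg y = y * x * (y * conjg y) + (y * conjg y) * (conjg x * conjg y)"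
    by (simp add: conjg_mult algebra_simps)
  also have "\<dots> = (norm y)\<^sup>2 *\<^sub>R (y * x + conjg (y * x))"
    by (simp add: mult_conjg conjg_mult scaleR_add_right)
  also have "\<dots> = ((norm y)\<^sup>2 * (2 * repart (y * x))) *\<^sub>R 1" unfolding add_conjg by simp
  finally show ?thesis using False by simp
qed simp

lemma repart_mult_conjg_self [simp]: "repart (x * conjg x) = (norm (x::'a::conj_div_algebra))\<^sup>2"
  by (simp add: mult_conjg)

lemma repart_mult_conjg_commute: "repart (x * conjg y) = repart (y * conjg (x::'a::conj_div_algebra))"
  using repart_conjg[of "x * conjg y"] by (simp add: conjg_mult conjg_conjg)

text \<open>Both sides are the polarization of the squared norm.\<close>

lemma inner_eq_repart:
  "x \<bullet> y = repart (x * conjg (y::'a::{conj_div_algebra, real_inner}))"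
proof -
  have "(norm (x + y))\<^sup>2 = repart ((x + y) * conjg (x + y))" by simp
  also have "\<dots> = (norm x)\<^sup>2 + (norm y)\<^sup>2 + 2 * repart (x * conjg y)"
    using repart_mult_conjg_commute[of y x]
    by (simp add: conjg_add algebra_simps repart_add)
  finally show ?thesis
    by (simp add: power2_norm_eq_inner inner_add_left inner_add_right inner_commute)
qed

instantiation quat :: euclidean_space
begin
definition inner_quat :: "quat \<Rightarrow> quat \<Rightarrow> real" where
  "inner_quat x y = qre x * qre y + qi x * qi y + qj x * qj y + qk x * qk y"
definition Basis_quat :: "quat set" where
  "Basis_quat = {Quat 1 0 0 0, Quat 0 1 0 0, Quat 0 0 1 0, Quat 0 0 0 1}"
instance
proof
  fix x y z :: quat and r :: real
  show "x \<bullet> y = y \<bullet> x" by (simp add: inner_quat_def mult.commute)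
  show "(x + y) \<bullet> z = x \<bullet> z + y \<bullet> z" by (simp add: inner_quat_def plus_quat_def algebra_simps)
  show "r *\<^sub>R x \<bullet> y = r * (x \<bullet> y)" by (simp add: inner_quat_def scaleR_quat_def algebra_simps)
  show "0 \<le> x \<bullet> x" by (simp add: inner_quat_def)
  show norm_eq: "norm x = sqrt (x \<bullet> x)" for x :: quat
    by (simp add: inner_quat_def norm_quat_def power2_eq_square)
  show zero: "x \<bullet> x = 0 \<longleftrightarrow> x = 0" for x :: quat
    using norm_eq[of x] norm_eq_zero[of x] by simp
  show "(Basis :: quat set) \<noteq> {}" "finite (Basis :: quat set)" by (simp_all add: Basis_quat_def)
  have "\<forall>u\<in>Basis::quat set. \<forall>v\<in>Basis. u \<bullet> v = (if u = v then 1 else 0)"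
    by (simp add: Basis_quat_def inner_quat_def)
  then show "u \<in> Basis \<Longrightarrow> v \<in> Basis \<Longrightarrow> u \<bullet> v = (if u = v then 1 else 0)" for u v :: quat
    by blast
  have "(\<forall>u\<in>Basis. x \<bullet> u = 0) \<longleftrightarrow> qre x = 0 \<and> qi x = 0 \<and> qj x = 0 \<and> qk x = 0" for x :: quat
    by (simp add: Basis_quat_def inner_quat_def)
  then show "(\<forall>u\<in>Basis. x \<bullet> u = 0) \<longleftrightarrow> x = 0" for x :: quat
    by (cases x) (simp add: zero_quat_def)
qed
end

section \<open>Finitary matrices and unitary groups\<close>

type_synonym 'a mpair = "'a inf_mat \<times> 'a inf_mat"

abbreviation haarK :: "nat \<Rightarrow> nat \<Rightarrow> 'a::conj_div_algebra mpair measure" where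
  "haarK q p \<equiv> normalized_haar (grp q p) (Kgrp p)"

text \<open>For matrices with finite rows, sums of products over all indices are finite sums, which makes the product associative.\<close>

definition rowfin :: "'a::conj_div_algebra inf_mat \<Rightarrow> bool" where
  "rowfin A \<longleftrightarrow> (\<forall>i. finite {k. A i k \<noteq> 0})"

lemma mat_times_eq_sum_left:
  assumes "finite S" "\<And>k. k \<notin> S \<Longrightarrow> A i k = 0"
  shows "mat_times A B i j = (\<Sum>k\<in>S. A i k * B k j)"
  unfolding mat_times_def by (rule Sum_any.expand_superset) (use assms in \<open>auto intro: ccontr\<close>)

lemma mat_times_eq_sum_right:
  assumes "finite S" "\<And>k. k \<notin> S \<Longrightarrow> B k j = 0"
  shows "mat_times A B i j = (\<Sum>k\<in>S. A i k * B k j)"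
  unfolding mat_times_def by (rule Sum_any.expand_superset) (use assms in \<open>auto intro: ccontr\<close>)

lemma mat_times_assoc:
  assumes A: "rowfin A" and B: "rowfin B"
  shows "mat_times (mat_times A B) C = mat_times A (mat_times B C)"
proof (intro ext)
  fix i j
  define S where "S = {l. A i l \<noteq> 0}"
  define T where "T = (\<Union>l\<in>S. {k. B l k \<noteq> 0})"
  have S: "finite S" using A by (simp add: S_def rowfin_def)
  have T: "finite T" using B S by (simp add: T_def rowfin_def)
  have AB: "mat_times A B i k = (\<Sum>l\<in>S. A i l * B l k)" for k
    by (rule mat_times_eq_sum_left[OF S]) (simp add: S_def)
  have BC: "mat_times B C l j = (\<Sum>k\<in>T. B l k * C k j)" if "l \<in> S" for l
    by (rule mat_times_eq_sum_left[OF T]) (use that in \<open>auto simp: T_def\<close>)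
  have "mat_times (mat_times A B) C i j = (\<Sum>k\<in>T. mat_times A B i k * C k j)"
  proof (rule mat_times_eq_sum_left[OF T])
    fix k assume "k \<notin> T"
    then have "B l k = 0" if "l \<in> S" for l using that by (auto simp: T_def)
    then show "mat_times A B i k = 0" unfolding AB by simp
  qed
  also have "\<dots> = (\<Sum>k\<in>T. \<Sum>l\<in>S. A i l * (B l k * C k j))"
    unfolding AB by (simp add: sum_distrib_right mult.assoc)
  also have "\<dots> = (\<Sum>l\<in>S. \<Sum>k\<in>T. A i l * (B l k * C k j))" by (rule sum.swap)
  also have "\<dots> = (\<Sum>l\<in>S. A i l * mat_times B C l j)"
    by (intro sum.cong refl) (simp add: BC sum_distrib_left)
  also have "\<dots> = mat_times A (mat_times B C) i j"
    by (rule mat_times_eq_sum_left[OF S, symmetric]) (simp add: S_def)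
  finally show "mat_times (mat_times A B) C i j = mat_times A (mat_times B C) i j" .
qed

lemma rowfin_mat_times:
  assumes A: "rowfin A" and B: "rowfin B"
  shows "rowfin (mat_times A B)"
  unfolding rowfin_def
proof
  fix i
  define S where "S = {l. A i l \<noteq> 0}"
  have S: "finite S" using A by (simp add: S_def rowfin_def)
  have AB: "mat_times A B i k = (\<Sum>l\<in>S. A i l * B l k)" for k
    by (rule mat_times_eq_sum_left[OF S]) (simp add: S_def)
  have "{k. mat_times A B i k \<noteq> 0} \<subseteq> (\<Union>l\<in>S. {k. B l k \<noteq> 0})"
  proof
    fix k assume "k \<in> {k. mat_times A B i k \<noteq> 0}"
    then have "(\<Sum>l\<in>S. A i l * B l k) \<noteq> 0" by (simp add: AB)
    then obtain l where "l \<in> S" "A i l * B l k \<noteq> 0" by (rule sum.not_neutral_contains_not_neutral)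
    then show "k \<in> (\<Union>l\<in>S. {k. B l k \<noteq> 0})" by auto
  qed
  moreover have "finite (\<Union>l\<in>S. {k. B l k \<noteq> 0})" using B S by (simp add: rowfin_def)
  ultimately show "finite {k. mat_times A B i k \<noteq> 0}" by (rule finite_subset)
qed

lemma mat_times_id_left [simp]: "mat_times mat_id A = A"
proof (intro ext)
  show "mat_times mat_id A i j = A i j" for i j
    using mat_times_eq_sum_left[of "{i}" mat_id i A j] by (simp add: mat_id_def)
qed

lemma mat_times_id_right [simp]: "mat_times A mat_id = A"
proof (intro ext)
  show "mat_times A mat_id i j = A i j" for i j
    using mat_times_eq_sum_right[of "{j}" mat_id j A i] by (simp add: mat_id_def)
qed

lemma mat_times_zero_right [simp]: "mat_times A (\<lambda>i j. 0) = (\<lambda>i j. 0)"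
  by (intro ext) (simp add: mat_times_eq_sum_right[of "{}"])

lemma mat_times_add_right:
  assumes "rowfin A"
  shows "mat_times A (\<lambda>i j. x i j + y i j) = (\<lambda>i j. mat_times A x i j + mat_times A y i j)"
proof (intro ext)
  fix i j
  have S: "finite {k. A i k \<noteq> 0}" using assms by (simp add: rowfin_def)
  have *: "mat_times A B i j = (\<Sum>k | A i k \<noteq> 0. A i k * B k j)" for B
    by (rule mat_times_eq_sum_left[OF S]) simp
  show "mat_times A (\<lambda>i j. x i j + y i j) i j = mat_times A x i j + mat_times A y i j"
    unfolding * by (simp add: distrib_left sum.distrib)
qed

lemma mat_times_minus_right:
  "mat_times A (\<lambda>i j. - x i j) = (\<lambda>i j. - mat_times A x i j)"
proof (intro ext)
  show "mat_times A (\<lambda>i j. - x i j) i j = - mat_times A x i j" for i j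
    unfolding mat_times_def by (simp add: Sum_any.expand_set sum_negf)
qed

lemma mat_star_star [simp]: "mat_star (mat_star A) = A"
  by (simp add: mat_star_def conjg_conjg)

lemma mat_star_times: "mat_star (mat_times A B) = mat_times (mat_star B) (mat_star A)"
proof (intro ext)
  fix i j
  have "{k. conjg (A j k * B k i) \<noteq> 0} = {k. A j k * B k i \<noteq> 0}" by simp
  then show "mat_star (mat_times A B) i j = mat_times (mat_star B) (mat_star A) i j"
    unfolding mat_star_def mat_times_def
    by (simp add: Sum_any.expand_set conjg_sum flip: conjg_mult)
qed

lemma mat_star_id [simp]: "mat_star mat_id = mat_id"
  by (intro ext) (simp add: mat_star_def mat_id_def)

lemma MatsD: "x \<in> Mats p q \<Longrightarrow> p \<le> i \<or> q \<le> j \<Longrightarrow> x i j = 0"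
  by (auto simp: Mats_def)

lemma Mats_mono: "p \<le> p' \<Longrightarrow> x \<in> Mats p q \<Longrightarrow> x \<in> Mats p' q"
  by (auto simp: Mats_def)

lemma rowfin_Mats: "x \<in> Mats p q \<Longrightarrow> rowfin x"
  unfolding rowfin_def
proof
  fix i assume "x \<in> Mats p q"
  then have "{k. x i k \<noteq> 0} \<subseteq> {..<q}" by (force simp: Mats_def not_le[symmetric])
  then show "finite {k. x i k \<noteq> 0}" by (rule finite_subset) simp
qed

lemma zero_Mats [simp]: "(\<lambda>i j. 0) \<in> Mats p q" by (simp add: Mats_def)

lemma add_Mats: "x \<in> Mats p q \<Longrightarrow> y \<in> Mats p q \<Longrightarrow> (\<lambda>i j. x i j + y i j) \<in> Mats p q"
  by (simp add: Mats_def)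

lemma minus_Mats: "x \<in> Mats p q \<Longrightarrow> (\<lambda>i j. - x i j) \<in> Mats p q"
  by (simp add: Mats_def)

lemma Unitaries_outside: "u \<in> Unitaries p \<Longrightarrow> p \<le> i \<or> p \<le> j \<Longrightarrow> u i j = mat_id i j"
  by (auto simp: Unitaries_def)

lemma Unitaries_mono: "p \<le> p' \<Longrightarrow> u \<in> Unitaries p \<Longrightarrow> u \<in> Unitaries p'"
  by (auto simp: Unitaries_def)

lemma Unitaries_star_times: "u \<in> Unitaries p \<Longrightarrow> mat_times (mat_star u) u = mat_id"
  and Unitaries_times_star: "u \<in> Unitaries p \<Longrightarrow> mat_times u (mat_star u) = mat_id"
  by (auto simp: Unitaries_def)

lemma id_Unitaries [simp]: "mat_id \<in> Unitaries p"
  by (simp add: Unitaries_def)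

lemma star_Unitaries: "u \<in> Unitaries p \<Longrightarrow> mat_star u \<in> Unitaries p"
  by (auto simp: Unitaries_def mat_star_def mat_id_def conjg_conjg)

lemma rowfin_Unitaries: "u \<in> Unitaries p \<Longrightarrow> rowfin u"
  unfolding rowfin_def
proof
  fix i assume "u \<in> Unitaries p"
  then have "u i k = 0" if "p \<le> k" "k \<noteq> i" for k
    using that Unitaries_outside[of u p i k] by (simp add: mat_id_def)
  then have "{k. u i k \<noteq> 0} \<subseteq> insert i {..<p}" by (force simp: not_le[symmetric])
  then show "finite {k. u i k \<noteq> 0}" by (rule finite_subset) simp
qed

lemma Unitaries_times:
  assumes u: "u \<in> Unitaries p"
  shows "mat_times u y i j = (if i < p then \<Sum>k<p. u i k * y k j else y i j)"
proof (cases "i < p")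
  case True
  have "mat_times u y i j = (\<Sum>k\<in>{..<p}. u i k * y k j)"
    by (rule mat_times_eq_sum_left) (use True Unitaries_outside[OF u, of i] in \<open>auto simp: mat_id_def\<close>)
  with True show ?thesis by simp
next
  case False
  have "mat_times u y i j = (\<Sum>k\<in>{i}. u i k * y k j)"
    by (rule mat_times_eq_sum_left) (use False Unitaries_outside[OF u, of i] in \<open>auto simp: mat_id_def\<close>)
  with False show ?thesis using Unitaries_outside[OF u, of i i] by (simp add: mat_id_def)
qed

lemma times_Unitaries:
  assumes u: "u \<in> Unitaries p" and v: "v \<in> Unitaries p"
  shows "mat_times u v \<in> Unitaries p"
proof -
  note rf = rowfin_Unitaries[OF u] rowfin_Unitaries[OF v] rowfin_Unitaries[OF star_Unitaries[OF u]]
    rowfin_Unitaries[OF star_Unitaries[OF v]]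
  have 1: "mat_times (mat_star (mat_times u v)) (mat_times u v)
      = mat_times (mat_star v) (mat_times (mat_times (mat_star u) u) v)"
    by (simp only: mat_star_times mat_times_assoc rf rowfin_mat_times)
  have 2: "mat_times (mat_times u v) (mat_star (mat_times u v))
      = mat_times u (mat_times (mat_times v (mat_star v)) (mat_star u))"
    by (simp only: mat_star_times mat_times_assoc rf rowfin_mat_times)
  have out: "mat_times u v i j = mat_id i j" if "p \<le> i \<or> p \<le> j" for i j
  proof (cases "i < p")
    case True
    then have j: "p \<le> j" using that by simp
    have "u i k * v k j = 0" if "k < p" for k
      using Unitaries_outside[OF v, of k j] j that by (simp add: mat_id_def)
    then have "(\<Sum>k<p. u i k * v k j) = 0" by (intro sum.neutral) simp
    then show ?thesis using True j by (simp add: Unitaries_times[OF u] mat_id_def)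
  next
    case False
    then show ?thesis using Unitaries_outside[OF v, of i j] by (simp add: Unitaries_times[OF u])
  qed
  show ?thesis
    unfolding Unitaries_def using out
    by (simp add: 1 2 Unitaries_star_times[OF u] Unitaries_times_star[OF v]
        Unitaries_star_times[OF v] Unitaries_times_star[OF u])
qed

lemma Unitaries_times_Mats:
  assumes u: "u \<in> Unitaries p" and x: "x \<in> Mats n q" and "p \<le> n"
  shows "mat_times u x \<in> Mats n q"
  using x \<open>p \<le> n\<close> unfolding Mats_def by (auto simp: Unitaries_times[OF u])

lemma Unitaries_column_inner:
  assumes u: "u \<in> Unitaries p" and "i < p" "j < p"
  shows "(\<Sum>k<p. conjg (u k i) * u k j) = (if i = j then 1 else 0)"
  using fun_cong[OF fun_cong[OF Unitaries_star_times[OF u]], of i j] assms(2)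
  unfolding Unitaries_times[OF star_Unitaries[OF u]] by (simp add: mat_star_def mat_id_def)

lemma UnitariesI:
  assumes out: "\<And>i j. p \<le> i \<or> p \<le> j \<Longrightarrow> u i j = mat_id i j"
    and col: "\<And>i j. i < p \<Longrightarrow> j < p \<Longrightarrow> (\<Sum>k<p. conjg (u k i) * u k j) = mat_id i j"
    and row: "\<And>i j. i < p \<Longrightarrow> j < p \<Longrightarrow> (\<Sum>k<p. u i k * conjg (u j k)) = mat_id i j"
  shows "u \<in> Unitaries p"
proof -
  have *: "mat_times A B i j = mat_id i j"
    if A: "\<And>i j. p \<le> i \<or> p \<le> j \<Longrightarrow> A i j = mat_id i j"
      and B: "\<And>i j. p \<le> i \<or> p \<le> j \<Longrightarrow> B i j = mat_id i j"
      and AB: "\<And>i j. i < p \<Longrightarrow> j < p \<Longrightarrow> (\<Sum>k<p. A i k * B k j) = mat_id i j" for A B :: "'a inf_mat" and i j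
  proof (cases "i < p")
    case True
    have "mat_times A B i j = (\<Sum>k<p. A i k * B k j)"
      by (rule mat_times_eq_sum_left) (use True A[of i] in \<open>auto simp: mat_id_def\<close>)
    moreover have "(\<Sum>k<p. A i k * B k j) = mat_id i j" if "p \<le> j"
    proof -
      have "A i k * B k j = 0" if "k < p" for k using B[of k j] \<open>p \<le> j\<close> that by (simp add: mat_id_def)
      then have "(\<Sum>k<p. A i k * B k j) = 0" by (intro sum.neutral) simp
      then show ?thesis using True that by (simp add: mat_id_def)
    qed
    ultimately show ?thesis using AB[OF True, of j] by (cases "j < p") auto
  next
    case False
    have "mat_times A B i j = (\<Sum>k\<in>{i}. A i k * B k j)"
      by (rule mat_times_eq_sum_left) (use False A[of i] in \<open>auto simp: mat_id_def\<close>)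
    then show ?thesis using False A[of i i] B[of i j] by (simp add: mat_id_def)
  qed
  have s: "mat_star u i j = mat_id i j" if "p \<le> i \<or> p \<le> j" for i j
    using out[of j i] that by (auto simp: mat_star_def mat_id_def)
  have "mat_times (mat_star u) u = mat_id" 
    by (intro ext *[OF s out]) (auto simp: mat_star_def col)
  moreover have "mat_times u (mat_star u) = mat_id" 
    by (intro ext *[OF out s]) (auto simp: mat_star_def row)
  ultimately show ?thesis using out by (simp add: Unitaries_def)
qed

definition perm_mat :: "(nat \<Rightarrow> nat) \<Rightarrow> 'a::conj_div_algebra inf_mat" where
  "perm_mat \<sigma> = (\<lambda>i j. if j = \<sigma> i then 1 else 0)"

lemma mat_times_perm: "mat_times (perm_mat \<sigma>) y = (\<lambda>i j. y (\<sigma> i) j)"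
proof (intro ext)
  show "mat_times (perm_mat \<sigma>) y i j = y (\<sigma> i) j" for i j
    using mat_times_eq_sum_left[of "{\<sigma> i}" "perm_mat \<sigma>" i y j] by (simp add: perm_mat_def)
qed

lemma perm_Unitaries:
  assumes "\<sigma> permutes {..<p}"
  shows "(perm_mat \<sigma> :: 'a::conj_div_algebra inf_mat) \<in> Unitaries p"
proof (rule UnitariesI)
  have inj: "\<sigma> i = \<sigma> j \<longleftrightarrow> i = j" for i j using permutes_inj[OF assms] by (auto dest: injD)
  have lt: "\<sigma> i < p \<longleftrightarrow> i < p" for i using permutes_in_image[OF assms, of i] by simp
  have out: "\<sigma> i = i" if "p \<le> i" for i using permutes_not_in[OF assms, of i] that by simp
  fix i j
  show "p \<le> i \<or> p \<le> j \<Longrightarrow> (perm_mat \<sigma> :: 'a inf_mat) i j = mat_id i j"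
    using out[of i] out[of j] inj[of i j] by (auto simp: perm_mat_def mat_id_def)
  assume "i < p" "j < p"
  then have "(\<Sum>k<p. (perm_mat \<sigma> i k :: 'a) * conjg (perm_mat \<sigma> j k)) = (\<Sum>k<p. if k = \<sigma> i then mat_id i j else 0)"
    using inj by (intro sum.cong) (auto simp: perm_mat_def mat_id_def)
  then show "(\<Sum>k<p. (perm_mat \<sigma> i k :: 'a) * conjg (perm_mat \<sigma> j k)) = mat_id i j"
    using lt \<open>i < p\<close> by simp
  obtain i' where i': "\<sigma> i' = i" "i' < p" using permutes_surj[OF assms] lt \<open>i < p\<close> by (metis surjD)
  have "(\<Sum>k<p. conjg (perm_mat \<sigma> k i :: 'a) * perm_mat \<sigma> k j) = (\<Sum>k<p. if k = i' then mat_id i j else 0)"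
    using inj i' by (intro sum.cong) (auto simp: perm_mat_def mat_id_def)
  then show "(\<Sum>k<p. conjg (perm_mat \<sigma> k i :: 'a) * perm_mat \<sigma> k j) = mat_id i j"
    using i' by simp
qed

definition scal_mat :: "nat \<Rightarrow> 'a \<Rightarrow> 'a::conj_div_algebra inf_mat" where
  "scal_mat p c = (\<lambda>i j. if i = j then (if i < p then c else 1) else 0)"

lemma mat_times_scal: "mat_times (scal_mat p c) y = (\<lambda>i j. if i < p then c * y i j else y i j)"
proof (intro ext)
  show "mat_times (scal_mat p c) y i j = (if i < p then c * y i j else y i j)" for i j
    using mat_times_eq_sum_left[of "{i}" "scal_mat p c" i y j] by (simp add: scal_mat_def)
qed

text \<open>Of use for \<open>c = -1\<close> on all rows and for arbitrary \<open>c\<close> of norm \<open>1\<close> on the first row.\<close>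

lemma scal_Unitaries:
  assumes "norm c = 1" shows "scal_mat p c \<in> Unitaries p"
proof (rule UnitariesI)
  fix i j
  show "p \<le> i \<or> p \<le> j \<Longrightarrow> scal_mat p c i j = mat_id i j" by (auto simp: scal_mat_def mat_id_def)
  assume "i < p" "j < p"
  have "(\<Sum>k<p. conjg (scal_mat p c k i) * scal_mat p c k j) = (\<Sum>k<p. if k = i then mat_id i j else 0)"
    using assms conjg_mult_self[of c] by (intro sum.cong) (auto simp: scal_mat_def mat_id_def)
  then show "(\<Sum>k<p. conjg (scal_mat p c k i) * scal_mat p c k j) = mat_id i j" using \<open>i < p\<close> by simp
  have "(\<Sum>k<p. scal_mat p c i k * conjg (scal_mat p c j k)) = (\<Sum>k<p. if k = i then mat_id i j else 0)"
    using assms mult_conjg[of c] by (intro sum.cong) (auto simp: scal_mat_def mat_id_def)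
  then show "(\<Sum>k<p. scal_mat p c i k * conjg (scal_mat p c j k)) = mat_id i j" using \<open>i < p\<close> by simp
qed

definition rot_mat :: "real \<Rightarrow> real \<Rightarrow> 'a::conj_div_algebra inf_mat" where
  "rot_mat c s = (\<lambda>i j. if i = 0 \<and> j = 0 \<or> i = 1 \<and> j = 1 then c *\<^sub>R 1 else if i = 0 \<and> j = 1 then - s *\<^sub>R 1
     else if i = 1 \<and> j = 0 then s *\<^sub>R 1 else mat_id i j)"

lemma rot_Unitaries:
  assumes "c\<^sup>2 + s\<^sup>2 = 1"
  shows "(rot_mat c s :: 'a::conj_div_algebra inf_mat) \<in> Unitaries 2"
proof (rule UnitariesI)
  have c: "c * c + s * s = 1" using assms by (simp add: power2_eq_square)
  have *: "{..<2::nat} = {0, 1}" by auto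
  fix i j :: nat
  show "2 \<le> i \<or> 2 \<le> j \<Longrightarrow> (rot_mat c s :: 'a inf_mat) i j = mat_id i j"
    by (auto simp: rot_mat_def mat_id_def)
  assume "i < 2" "j < 2"
  then have ij: "i = 0 \<or> i = 1" "j = 0 \<or> j = 1" by auto
  show "(\<Sum>k<2. conjg (rot_mat c s k i :: 'a) * rot_mat c s k j) = mat_id i j"
    unfolding * using ij c by (auto simp: rot_mat_def mat_id_def conjg_scaleR_1 mult.commute add.commute simp flip: scaleR_add_left)
  show "(\<Sum>k<2. (rot_mat c s i k :: 'a) * conjg (rot_mat c s j k)) = mat_id i j"
    unfolding * using ij c by (auto simp: rot_mat_def mat_id_def conjg_scaleR_1 mult.commute add.commute simp flip: scaleR_add_left)
qed

text \<open>Orthonormality of the columns, written for a single vector.\<close>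

lemma Unitaries_isometric:
  assumes u: "u \<in> Unitaries p"
  shows "(\<Sum>i<p. (norm (\<Sum>k<p. u i k * z k))\<^sup>2) = (\<Sum>k<p. (norm (z k))\<^sup>2)"
proof -
  have "(\<Sum>i<p. (norm (\<Sum>k<p. u i k * z k))\<^sup>2) = repart (\<Sum>i<p. conjg (\<Sum>k<p. u i k * z k) * (\<Sum>l<p. u i l * z l))"
    by (simp add: repart_sum conjg_mult_self)
  also have "(\<Sum>i<p. conjg (\<Sum>k<p. u i k * z k) * (\<Sum>l<p. u i l * z l))
      = (\<Sum>i<p. \<Sum>k<p. \<Sum>l<p. conjg (z k) * (conjg (u i k) * u i l) * z l)"
    by (simp add: conjg_sum conjg_mult sum_product mult.assoc)
  also have "\<dots> = (\<Sum>k<p. \<Sum>l<p. \<Sum>i<p. conjg (z k) * (conjg (u i k) * u i l) * z l)"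
    by (rule trans[OF sum.swap]) (intro sum.cong refl sum.swap)
  also have "\<dots> = (\<Sum>k<p. \<Sum>l<p. conjg (z k) * (\<Sum>i<p. conjg (u i k) * u i l) * z l)"
    by (simp add: sum_distrib_left sum_distrib_right)
  also have "\<dots> = (\<Sum>k<p. \<Sum>l<p. if l = k then conjg (z k) * z k else 0)"
    by (intro sum.cong refl) (auto simp: Unitaries_column_inner[OF u])
  also have "\<dots> = (\<Sum>k<p. conjg (z k) * z k)" by simp
  also have "repart \<dots> = (\<Sum>k<p. (norm (z k))\<^sup>2)" by (simp add: repart_sum conjg_mult_self)
  finally show ?thesis .
qed

lemma Unitaries_column_norm:
  assumes u: "u \<in> Unitaries p" and "j < p"
  shows "(\<Sum>i<p. (norm (u i j))\<^sup>2) = 1"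
proof -
  have "repart (\<Sum>k<p. conjg (u k j) * u k j) = 1"
    using Unitaries_column_inner[OF assms assms(2)] by simp
  then show ?thesis by (simp add: repart_sum conjg_mult_self)
qed

lemma Unitaries_entry_le:
  assumes u: "u \<in> Unitaries p"
  shows "norm (u i j) \<le> 1"
proof (cases "i < p \<and> j < p")
  case True
  then have "(norm (u i j))\<^sup>2 \<le> (\<Sum>i<p. (norm (u i j))\<^sup>2)" by (intro member_le_sum) auto
  then have "(norm (u i j))\<^sup>2 \<le> 1\<^sup>2" using Unitaries_column_norm[OF u] True by simp
  then show ?thesis by (rule power2_le_imp_le) simp
next
  case False
  then show ?thesis using Unitaries_outside[OF u, of i j] by (auto simp: mat_id_def not_less)
qed

section \<open>The Haar measure of the unitary groups\<close>

lemma continuous_on_entry: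
  fixes f :: "'b::topological_space \<Rightarrow> nat \<Rightarrow> nat \<Rightarrow> 'a::topological_space"
  assumes "continuous_on S f"
  shows "continuous_on S (\<lambda>x. f x i j)"
  by (rule continuous_on_product_then_coordinatewise[OF continuous_on_product_then_coordinatewise[OF assms]])

lemma continuous_on_matI:
  fixes f :: "'b::topological_space \<Rightarrow> nat \<Rightarrow> nat \<Rightarrow> 'a::topological_space"
  assumes "\<And>i j. continuous_on S (\<lambda>x. f x i j)"
  shows "continuous_on S f"
  by (rule continuous_on_coordinatewise_then_product[OF continuous_on_coordinatewise_then_product[OF assms]])

lemma continuous_on_mat_times:
  fixes f g :: "'b::topological_space \<Rightarrow> 'a::conj_div_algebra inf_mat"
  assumes f: "continuous_on S f" and g: "continuous_on S g" and u: "\<And>x. x \<in> S \<Longrightarrow> f x \<in> Unitaries p"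
  shows "continuous_on S (\<lambda>x. mat_times (f x) (g x))"
proof (rule continuous_on_matI)
  fix i j
  have "continuous_on S (\<lambda>x. if i < p then \<Sum>k<p. f x i k * g x k j else g x i j)"
    by (cases "i < p") (simp_all add: continuous_on_sum continuous_on_mult continuous_on_entry[OF f] continuous_on_entry[OF g])
  then show "continuous_on S (\<lambda>x. mat_times (f x) (g x) i j)"
    by (rule continuous_on_eq) (simp add: Unitaries_times[OF u])
qed

lemma continuous_on_mat_star:
  fixes f :: "'b::topological_space \<Rightarrow> 'a::conj_div_algebra inf_mat"
  assumes f: "continuous_on S f"
  shows "continuous_on S (\<lambda>x. mat_star (f x))"
  by (rule continuous_on_matI) (simp add: mat_star_def continuous_on_conjg continuous_on_entry[OF f])

lemma compact_PiE_UNIV: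
  fixes S :: "'i \<Rightarrow> 'b::topological_space set"
  assumes "\<And>i. compact (S i)"
  shows "compact (Pi\<^sub>E UNIV S)"
proof -
  have "compactin (product_topology (\<lambda>_. euclidean) UNIV) (Pi\<^sub>E UNIV S)"
    unfolding compactin_PiE using assms by simp
  then show ?thesis by (simp only: euclidean_product_topology compactin_euclidean_iff)
qed

lemma Unitaries_row_inner:
  assumes u: "u \<in> Unitaries p" and "i < p" "j < p"
  shows "(\<Sum>k<p. u i k * conjg (u j k)) = mat_id i j"
  using Unitaries_column_inner[OF star_Unitaries[OF u] assms(2,3)]
  by (simp add: mat_star_def mat_id_def conjg_conjg)

text \<open>A closed subset of a product of closed unit balls and, at the indices outside the \<open>p \<times> p\<close> block, single points.\<close>

lemma compact_Unitaries:
  "compact (Unitaries p :: 'a::{conj_div_algebra, euclidean_space} inf_mat set)"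
proof -
  define B where "B i = Pi\<^sub>E UNIV (\<lambda>j. if i < p \<and> j < p then cball 0 1 else {mat_id i j :: 'a})" for i
  define E where "E = {u :: 'a inf_mat. \<forall>i<p. \<forall>j<p. (\<Sum>k<p. conjg (u k i) * u k j) = mat_id i j \<and>
     (\<Sum>k<p. u i k * conjg (u j k)) = mat_id i j}"
  have ent: "continuous_on UNIV (\<lambda>u :: 'a inf_mat. u i j)" for i j
    by (rule continuous_on_entry) (rule continuous_on_id)
  have "E = (\<Inter>i\<in>{..<p}. \<Inter>j\<in>{..<p}. {u. (\<Sum>k<p. conjg (u k i) * u k j) = mat_id i j} \<inter>
     {u. (\<Sum>k<p. u i k * conjg (u j k)) = mat_id i j})"
    by (auto simp: E_def)
  also have "closed \<dots>"
    by (intro closed_INT ballI closed_Int closed_Collect_eq continuous_intros ent)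
  finally have "closed E" .
  moreover have "compact (Pi\<^sub>E UNIV B)"
    by (intro compact_PiE_UNIV) (simp add: B_def compact_PiE_UNIV)
  ultimately have "compact (Pi\<^sub>E UNIV B \<inter> E)" by (intro compact_Int_closed)
  also have "Pi\<^sub>E UNIV B \<inter> E = Unitaries p"
  proof (intro equalityI subsetI)
    fix u assume u: "u \<in> Pi\<^sub>E UNIV B \<inter> E"
    show "u \<in> Unitaries p"
    proof (rule UnitariesI)
      fix i j
      have "u i \<in> B i" using u by (auto simp: PiE_def)
      then have *: "u i j \<in> (if i < p \<and> j < p then cball 0 1 else {mat_id i j})" by (simp add: B_def PiE_iff)
      show "u i j = mat_id i j" if "p \<le> i \<or> p \<le> j"
        using * that by (auto simp: not_less[symmetric])
    qed (use u in \<open>auto simp: E_def\<close>)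
  next
    fix u :: "'a inf_mat" assume u: "u \<in> Unitaries p"
    have "u i j \<in> (if i < p \<and> j < p then cball 0 1 else {mat_id i j})" for i j
      using Unitaries_entry_le[OF u, of i j] Unitaries_outside[OF u, of i j] by (auto simp: not_less)
    then have "u \<in> Pi\<^sub>E UNIV B" by (simp add: B_def PiE_iff)
    then show "u \<in> Pi\<^sub>E UNIV B \<inter> E"
      using Unitaries_row_inner[OF u] Unitaries_column_inner[OF u] by (simp add: E_def mat_id_def)
  qed
  finally show ?thesis .
qed

lemma compact_Kgrp: "compact (Kgrp p :: 'a::{conj_div_algebra, euclidean_space} mpair set)"
  unfolding Kgrp_def by (intro compact_Times compact_Unitaries) simp

lemma in_Kgrp: "k \<in> Kgrp p \<longleftrightarrow> fst k = (\<lambda>i j. 0) \<and> snd k \<in> Unitaries p"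
  by (cases k) (auto simp: Kgrp_def)

text \<open>The Frobenius distance, a metric for the topology of entrywise convergence that left translations preserve.\<close>

definition frob_dist :: "nat \<Rightarrow> 'a::conj_div_algebra mpair \<Rightarrow> 'a mpair \<Rightarrow> real" where
  "frob_dist p k l = L2_set (\<lambda>(i, j). norm (snd k i j - snd l i j)) ({..<p} \<times> {..<p})"

lemma Metric_space_frob:
  "Metric_space (Kgrp p :: 'a::conj_div_algebra mpair set) (frob_dist p)"
proof
  fix x y z :: "'a mpair"
  show "0 \<le> frob_dist p x y" by (simp add: frob_dist_def)
  show "frob_dist p x y = frob_dist p y x" by (simp add: frob_dist_def norm_minus_commute)
  show "frob_dist p x y = 0 \<longleftrightarrow> x = y" if "x \<in> Kgrp p" "y \<in> Kgrp p"
  proof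
    assume "frob_dist p x y = 0"
    then have "\<forall>(i,j)\<in>{..<p} \<times> {..<p}. norm (snd x i j - snd y i j) = 0"
      by (simp add: frob_dist_def L2_set_eq_0_iff split_beta')
    then have "snd x i j = snd y i j" if "i < p" "j < p" for i j using that by auto
    moreover have "snd x i j = snd y i j" if "\<not> (i < p \<and> j < p)" for i j
      using \<open>x \<in> Kgrp p\<close> \<open>y \<in> Kgrp p\<close> that Unitaries_outside[of "snd x" p i j] Unitaries_outside[of "snd y" p i j]
      by (auto simp: in_Kgrp not_less)
    ultimately have "snd x = snd y" by blast
    then show "x = y" using that by (auto simp: in_Kgrp prod_eq_iff)
  qed (simp add: frob_dist_def L2_set_eq_0_iff split_beta')
  have "frob_dist p x z \<le> L2_set (\<lambda>ij. norm (snd x (fst ij) (snd ij) - snd y (fst ij) (snd ij)) +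
      norm (snd y (fst ij) (snd ij) - snd z (fst ij) (snd ij))) ({..<p} \<times> {..<p})"
    unfolding frob_dist_def split_beta'
  proof (rule L2_set_mono)
    fix ij :: "nat \<times> nat"
    show "norm (snd x (fst ij) (snd ij) - snd z (fst ij) (snd ij)) \<le> norm (snd x (fst ij) (snd ij) - snd y (fst ij) (snd ij)) +
      norm (snd y (fst ij) (snd ij) - snd z (fst ij) (snd ij))"
      using norm_triangle_ineq[of "snd x (fst ij) (snd ij) - snd y (fst ij) (snd ij)" "snd y (fst ij) (snd ij) - snd z (fst ij) (snd ij)"]
      by simp
  qed simp
  also have "\<dots> \<le> frob_dist p x y + frob_dist p y z"
    unfolding frob_dist_def split_beta' by (rule L2_set_triangle_ineq)
  finally show "frob_dist p x z \<le> frob_dist p x y + frob_dist p y z" .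
qed

lemma continuous_on_frob: "continuous_on UNIV (frob_dist p (x :: 'a::conj_div_algebra mpair))"
proof -
  have ent: "continuous_on UNIV (\<lambda>l :: 'a mpair. snd l i j)" for i j
    by (rule continuous_on_entry[OF continuous_on_snd[OF continuous_on_id]])
  show ?thesis
    unfolding frob_dist_def L2_set_def split_beta' by (intro continuous_intros ent)
qed

text \<open>A continuous metric on a compact space induces its topology: a point of an open set has positive distance from
the complement, which is compact.\<close>

lemma frob_topology:
  "Metric_space.mtopology (Kgrp p :: 'a::{conj_div_algebra, euclidean_space} mpair set) (frob_dist p)
    = top_of_set (Kgrp p)"
proof -
  interpret Metric_space "Kgrp p :: 'a mpair set" "frob_dist p" by (rule Metric_space_frob)
  have "openin mtopology U \<longleftrightarrow> openin (top_of_set (Kgrp p)) U" for U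
  proof
    assume U: "openin mtopology U"
    show "openin (top_of_set (Kgrp p)) U"
    proof (subst openin_subopen, intro ballI)
      fix x assume x: "x \<in> U"
      then obtain r where r: "0 < r" "mball x r \<subseteq> U" "x \<in> Kgrp p" using U unfolding openin_mtopology by blast
      have "open {y. frob_dist p x y < r}"
        using open_Collect_less[OF continuous_on_frob continuous_on_const] .
      then have "openin (top_of_set (Kgrp p)) (Kgrp p \<inter> {y. frob_dist p x y < r})" by (rule openin_open_Int)
      also have "Kgrp p \<inter> {y. frob_dist p x y < r} = mball x r" using r(3) by auto
      finally show "\<exists>T. openin (top_of_set (Kgrp p)) T \<and> x \<in> T \<and> T \<subseteq> U" using r by auto
    qed
  next
    assume U: "openin (top_of_set (Kgrp p)) U"
    then have UK: "U \<subseteq> Kgrp p" using openin_imp_subset by blast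
    have "closedin (top_of_set (Kgrp p)) (Kgrp p - U)" using U by (simp add: closedin_def Diff_Diff_Int Int_absorb1 UK)
    then have C: "compact (Kgrp p - U)" using closedin_compact[OF compact_Kgrp] by blast
    show "openin mtopology U"
    proof (unfold openin_mtopology, intro conjI allI impI UK)
      fix x assume x: "x \<in> U"
      show "\<exists>r>0. mball x r \<subseteq> U"
      proof (cases "Kgrp p - U = {}")
        case True
        then have "mball x 1 \<subseteq> U" by auto
        then show ?thesis by (intro exI[of _ 1]) simp
      next
        case False
        have "continuous_on (Kgrp p - U) (frob_dist p x)"
          by (rule continuous_on_subset[OF continuous_on_frob subset_UNIV])
        from continuous_attains_inf[OF C False this]
        obtain y where y: "y \<in> Kgrp p - U" "\<forall>z\<in>Kgrp p - U. frob_dist p x y \<le> frob_dist p x z" by blast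
        have "0 < frob_dist p x y" using x y(1) UK by (intro mdist_pos_less) auto
        moreover have "mball x (frob_dist p x y) \<subseteq> U" using y(2) by force
        ultimately show ?thesis by (intro exI[of _ "frob_dist p x y"]) simp
      qed
    qed
  qed
  then show ?thesis by (simp add: topology_eq)
qed

text \<open>Product and inverse of \<open>Kgrp p\<close>; the formulas are the same for all \<open>p\<close>.\<close>

definition kmult :: "'a::conj_div_algebra mpair \<Rightarrow> 'a mpair \<Rightarrow> 'a mpair" where
  "kmult k l = (\<lambda>i j. 0, mat_times (snd k) (snd l))"

definition kinv :: "'a::conj_div_algebra mpair \<Rightarrow> 'a mpair" where
  "kinv k = (\<lambda>i j. 0, mat_star (snd k))"

lemma kmult_in: "k \<in> Kgrp p \<Longrightarrow> l \<in> Kgrp p \<Longrightarrow> kmult k l \<in> Kgrp p"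
  by (simp add: in_Kgrp kmult_def times_Unitaries)

lemma kinv_in: "k \<in> Kgrp p \<Longrightarrow> kinv k \<in> Kgrp p"
  by (simp add: in_Kgrp kinv_def star_Unitaries)

lemma kmult_kinv_left: "k \<in> Kgrp p \<Longrightarrow> l \<in> Kgrp p \<Longrightarrow> kmult (kinv k) (kmult k l) = l"
  using rowfin_Unitaries[of "snd k" p] rowfin_Unitaries[OF star_Unitaries[of "snd k" p]] Unitaries_star_times[of "snd k" p]
  by (cases l) (simp add: in_Kgrp kmult_def kinv_def flip: mat_times_assoc)

lemma kmult_kinv_right: "k \<in> Kgrp p \<Longrightarrow> l \<in> Kgrp p \<Longrightarrow> kmult k (kmult (kinv k) l) = l"
  using rowfin_Unitaries[of "snd k" p] rowfin_Unitaries[OF star_Unitaries[of "snd k" p]] Unitaries_times_star[of "snd k" p]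
  by (cases l) (simp add: in_Kgrp kmult_def kinv_def flip: mat_times_assoc)

lemma l_coset_Kgrp:
  assumes "k \<in> Kgrp p" "A \<subseteq> Kgrp p"
  shows "k <#\<^bsub>grp q p\<^esub> A = kmult k ` A"
proof -
  have "mult (grp q p) k a = kmult k a" if "a \<in> A" for a
    using that assms by (cases k; cases a) (auto simp: grp_def kmult_def in_Kgrp)
  then show ?thesis by (auto simp: l_coset_def)
qed

lemma kmult_vimage:
  assumes k: "k \<in> Kgrp p" and A: "A \<subseteq> Kgrp p"
  shows "{x\<in>Kgrp p. kmult k x \<in> A} = kinv k <#\<^bsub>grp q p\<^esub> A"
  unfolding l_coset_Kgrp[OF kinv_in[OF k] A]
proof (intro equalityI subsetI)
  fix x assume x: "x \<in> {x\<in>Kgrp p. kmult k x \<in> A}"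
  show "x \<in> kmult (kinv k) ` A"
    by (rule image_eqI[of _ _ "kmult k x"]) (use x kmult_kinv_left[OF k, of x] in auto)
next
  fix x assume "x \<in> kmult (kinv k) ` A"
  then obtain a where a: "a \<in> A" "x = kmult (kinv k) a" by blast
  then have "a \<in> Kgrp p" using A by blast
  then show "x \<in> {x\<in>Kgrp p. kmult k x \<in> A}"
    using a kmult_kinv_right[OF k] kmult_in[OF kinv_in[OF k]] by simp
qed

lemma kmult_isometry:
  fixes k :: "'a::conj_div_algebra mpair"
  assumes k: "k \<in> Kgrp p"
  shows "Metric_space.isometry (Kgrp p) (frob_dist p) (kmult k)"
proof -
  interpret Metric_space "Kgrp p :: 'a mpair set" "frob_dist p" by (rule Metric_space_frob)
  show ?thesis
    unfolding isometry_def
  proof (intro conjI ballI)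
    show "kmult k ` Kgrp p = Kgrp p"
    proof
      show "Kgrp p \<subseteq> kmult k ` Kgrp p"
      proof
        fix l :: "'a mpair" assume l: "l \<in> Kgrp p"
        show "l \<in> kmult k ` Kgrp p"
          by (rule image_eqI[of _ _ "kmult (kinv k) l"]) (simp_all add: kmult_kinv_right[OF k l] kmult_in[OF kinv_in[OF k] l])
      qed
    qed (use kmult_in[OF k] in blast)
    fix x y :: "'a mpair"
    have u: "snd k \<in> Unitaries p" using k by (simp add: in_Kgrp)
    have *: "mat_times (snd k) (snd x) i j - mat_times (snd k) (snd y) i j
       = (\<Sum>l<p. snd k i l * (snd x l j - snd y l j))" if "i < p" for i j
      using that by (simp add: Unitaries_times[OF u] right_diff_distrib sum_subtractf)
    have "(\<Sum>(i,j)\<in>{..<p} \<times> {..<p}. (norm (mat_times (snd k) (snd x) i j - mat_times (snd k) (snd y) i j))\<^sup>2)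
      = (\<Sum>j<p. \<Sum>i<p. (norm (\<Sum>l<p. snd k i l * (snd x l j - snd y l j)))\<^sup>2)"
      unfolding sum.cartesian_product[symmetric] by (subst sum.swap) (simp add: *)
    also have "\<dots> = (\<Sum>j<p. \<Sum>i<p. (norm (snd x i j - snd y i j))\<^sup>2)"
      by (simp add: Unitaries_isometric[OF u])
    also have "\<dots> = (\<Sum>(i,j)\<in>{..<p} \<times> {..<p}. (norm (snd x i j - snd y i j))\<^sup>2)"
      unfolding sum.cartesian_product[symmetric] by (rule sum.swap)
    finally show "frob_dist p (kmult k x) (kmult k y) = frob_dist p x y"
      by (simp add: frob_dist_def L2_set_def kmult_def split_beta')
  qed
qed

lemma measurable_Pair_continuous:
  fixes K :: "'g::second_countable_topology set"
  assumes M: "sets M = sets (restrict_space borel K)" and f: "continuous_on (K \<times> K) f"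
    and range: "\<And>x. x \<in> K \<times> K \<Longrightarrow> f x \<in> K"
  shows "f \<in> M \<Otimes>\<^sub>M M \<rightarrow>\<^sub>M M"
proof -
  have sp: "space M = K" using sets_eq_imp_space_eq[OF M] by (simp add: space_restrict_space)
  have id: "(\<lambda>x. x) \<in> borel_measurable M"
    unfolding measurable_cong_sets[OF M refl] by (rule measurable_restrict_space1) simp
  have "(\<lambda>z. (fst z, snd z)) \<in> borel_measurable (M \<Otimes>\<^sub>M M)"
    by (intro borel_measurable_Pair measurable_compose[OF measurable_fst id] measurable_compose[OF measurable_snd id])
  then have "(\<lambda>z. z) \<in> M \<Otimes>\<^sub>M M \<rightarrow>\<^sub>M restrict_space borel (K \<times> K)"
    by (intro measurable_restrict_space2) (auto simp: space_pair_measure sp)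
  then have "(\<lambda>z. f z) \<in> borel_measurable (M \<Otimes>\<^sub>M M)"
    by (rule measurable_compose[OF _ borel_measurable_continuous_on_restrict[OF f]])
  then have "f \<in> M \<Otimes>\<^sub>M M \<rightarrow>\<^sub>M restrict_space borel K"
    by (intro measurable_restrict_space2) (auto simp: space_pair_measure sp intro!: range)
  then show ?thesis unfolding measurable_cong_sets[OF refl M] .
qed

lemma measurable_continuous:
  assumes M: "sets M = sets (restrict_space borel K)" and f: "continuous_on K f"
  shows "f \<in> borel_measurable M"
  unfolding measurable_cong_sets[OF M refl] by (rule borel_measurable_continuous_on_restrict[OF f])

text \<open>Left translations are isometries of the Frobenius metric, which gives existence. Uniqueness: every candidate agrees
with the image of one fixed candidate under inversion.\<close>

lemma haar_ex1:
  "\<exists>!M. sets M = sets (restrict_space borel (Kgrp p :: 'a::{conj_div_algebra, euclidean_space} mpair set)) \<and> emeasure M (Kgrp p) = 1 \<and>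
     (\<forall>k\<in>Kgrp p. \<forall>A\<in>sets M. emeasure M (k <#\<^bsub>grp q p\<^esub> A) = emeasure M A)"
  (is "\<exists>!M. ?P M")
proof -
  let ?K = "Kgrp p :: 'a mpair set"
  interpret Metric_space ?K "frob_dist p" by (rule Metric_space_frob)
  have Kcl: "closed ?K" by (rule compact_imp_closed[OF compact_Kgrp])
  have Ksets: "sigma_sets ?K {U. openin (top_of_set ?K) U} = sets (restrict_space borel ?K)"
  proof -
    have "?K \<in> sigma_sets UNIV {S. open S}"
      using borel_closed[OF Kcl] by (simp add: sets_borel)
    then have "(\<inter>) ?K ` sigma_sets UNIV {S. open S} = sigma_sets ?K ((\<inter>) ?K ` {S. open S})"
      by (rule sigma_sets_Int) simp
    moreover have "(\<inter>) ?K ` {S. open S} = {U. openin (top_of_set ?K) U}"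
      by (auto simp: openin_open)
    ultimately show ?thesis by (simp add: sets_restrict_space sets_borel)
  qed
  have "compact_space mtopology"
    unfolding frob_topology by (rule compact_space_subtopology) (simp add: compact_Kgrp)
  moreover have "?K \<noteq> {}"
  proof -
    have "(\<lambda>i j. 0, mat_id) \<in> ?K" by (simp add: in_Kgrp)
    then show ?thesis by blast
  qed
  ultimately have "\<exists>N. sets N = sigma_sets ?K {U. openin mtopology U} \<and> emeasure N ?K = 1 \<and>
    (\<forall>f A. isometry f \<longrightarrow> A \<in> sets N \<longrightarrow> f ` A \<in> sets N \<and> emeasure N (f ` A) = emeasure N A)"
    by (rule isometry_invariant_measure_exists)
  then obtain N where N: "sets N = sets (restrict_space borel ?K)" "emeasure N ?K = 1"
    "\<forall>f A. isometry f \<longrightarrow> A \<in> sets N \<longrightarrow> f ` A \<in> sets N \<and> emeasure N (f ` A) = emeasure N A"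
    unfolding frob_topology Ksets by (elim exE conjE)
  have PN: "?P N"
  proof (intro conjI ballI N(1,2))
    fix k A assume k: "k \<in> ?K" and A: "A \<in> sets N"
    have "A \<subseteq> ?K" using sets.sets_into_space[OF A] sets_eq_imp_space_eq[OF N(1)] by (simp add: space_restrict_space)
    then have "k <#\<^bsub>grp q p\<^esub> A = kmult k ` A" by (rule l_coset_Kgrp[OF k])
    then show "emeasure N (k <#\<^bsub>grp q p\<^esub> A) = emeasure N A"
      using N(3) kmult_isometry[OF k] A by simp
  qed
  have cm: "continuous_on (?K \<times> ?K) (\<lambda>(x, y). kmult x y)"
  proof -
    have "continuous_on (?K \<times> ?K) (\<lambda>z. snd (fst z))" "continuous_on (?K \<times> ?K) (\<lambda>z. snd (snd z))"
      by (rule continuous_on_snd[OF continuous_on_fst[OF continuous_on_id]]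
          continuous_on_snd[OF continuous_on_snd[OF continuous_on_id]])+
    then have "continuous_on (?K \<times> ?K) (\<lambda>z. mat_times (snd (fst z)) (snd (snd z)))"
      by (rule continuous_on_mat_times[where p=p]) (auto simp: in_Kgrp)
    then show ?thesis unfolding kmult_def split_beta' by (intro continuous_on_Pair continuous_on_const)
  qed
  have ci: "continuous_on ?K kinv"
    unfolding kinv_def
    by (intro continuous_on_Pair continuous_on_const continuous_on_mat_star continuous_on_snd continuous_on_id)
  have left: "emeasure M {x\<in>space M. kmult k x \<in> A} = emeasure M A" if M: "?P M" and k: "k \<in> space M" and A: "A \<in> sets M" for M k A
  proof -
    have sp: "space M = ?K" using M sets_eq_imp_space_eq[of M] by (simp add: space_restrict_space)
    have AK: "A \<subseteq> ?K" using sets.sets_into_space[OF A] sp by simp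
    have k: "k \<in> ?K" using k sp by simp
    have "{x\<in>space M. kmult k x \<in> A} = kinv k <#\<^bsub>grp q p\<^esub> A"
      unfolding sp by (rule kmult_vimage[OF k AK])
    also have "emeasure M \<dots> = emeasure M A" using M kinv_in[OF k] A by simp
    finally show ?thesis .
  qed
  have eq: "emeasure M A = emeasure N {x\<in>space N. kinv x \<in> A}" if M: "?P M" and A: "A \<in> sets N" for M A
  proof (rule left_invariant_emeasure_eq_inverse[where m=kmult, OF _ _ _ _ _ _ _ _ A])
    have spN: "space N = ?K" using sets_eq_imp_space_eq[OF N(1)] by (simp add: space_restrict_space)
    have spM: "space M = ?K" using M sets_eq_imp_space_eq[of M] by (simp add: space_restrict_space)
    show "emeasure N (space N) = 1" "emeasure M (space M) = 1" using N(2) M by (simp_all add: spN spM)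
    show sM: "sets M = sets N" using M N(1) by simp
    show "(\<lambda>(x, y). kmult x y) \<in> N \<Otimes>\<^sub>M N \<rightarrow>\<^sub>M N"
      by (rule measurable_Pair_continuous[OF N(1) cm]) (auto intro: kmult_in)
    have "kinv \<in> N \<rightarrow>\<^sub>M restrict_space borel ?K"
      by (rule measurable_restrict_space2) (auto simp: spN kinv_in intro: measurable_continuous[OF N(1) ci])
    then show "kinv \<in> N \<rightarrow>\<^sub>M N" unfolding measurable_cong_sets[OF refl N(1)] .
    show "kinv (kmult (kinv y) x) = kmult (kinv x) y" if "x \<in> space N" "y \<in> space N" for x y :: "'a mpair"
      by (simp add: kinv_def kmult_def mat_star_times)
    show "emeasure N {x\<in>space N. kmult k x \<in> A} = emeasure N A" if "k \<in> space N" "A \<in> sets N" for k A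
      by (rule left[OF PN that])
    show "emeasure M {x\<in>space N. kmult k x \<in> A} = emeasure M A" if "k \<in> space N" "A \<in> sets N" for k A
      using left[OF M, of k A] that spN spM sM by simp
  qed
  show ?thesis
  proof (rule ex1I[of ?P, OF PN])
    fix M assume M: "?P M"
    show "M = N"
    proof (rule measure_eqI)
      show sM: "sets M = sets N" using M N(1) by simp
      fix A assume "A \<in> sets M"
      then have A: "A \<in> sets N" using sM by simp
      show "emeasure M A = emeasure N A" using eq[OF M A] eq[OF PN A] by simp
    qed
  qed
qed

lemma haar:
  fixes q p defines "H \<equiv> (haarK q p :: 'a::{conj_div_algebra, euclidean_space} mpair measure)"
  shows sets_haar: "sets H = sets (restrict_space borel (Kgrp p))"
    and emeasure_haar: "emeasure H (Kgrp p) = 1"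
    and haar_left: "k \<in> Kgrp p \<Longrightarrow> A \<in> sets H \<Longrightarrow> emeasure H (k <#\<^bsub>grp q p\<^esub> A) = emeasure H A"
proof -
  have P: "sets H = sets (restrict_space borel (Kgrp p)) \<and> emeasure H (Kgrp p) = 1 \<and>
     (\<forall>k\<in>Kgrp p. \<forall>A\<in>sets H. emeasure H (k <#\<^bsub>grp q p\<^esub> A) = emeasure H A)"
    unfolding H_def normalized_haar_def by (rule theI'[OF haar_ex1])
  show "sets H = sets (restrict_space borel (Kgrp p))" "emeasure H (Kgrp p) = 1" using P by simp_all
  show "emeasure H (k <#\<^bsub>grp q p\<^esub> A) = emeasure H A" if "k \<in> Kgrp p" "A \<in> sets H"
    using P that by simp
qed

lemma space_haar: "space ((haarK q p :: 'a::{conj_div_algebra, euclidean_space} mpair measure)) = Kgrp p"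
  using sets_eq_imp_space_eq[OF sets_haar] by (simp add: space_restrict_space)

lemma finite_measure_haar: "finite_measure ((haarK q p :: 'a::{conj_div_algebra, euclidean_space} mpair measure))"
  by (rule finite_measureI) (simp add: space_haar emeasure_haar)

lemma measure_haar [simp]: "measure (haarK q p) (Kgrp p :: 'a::{conj_div_algebra, euclidean_space} mpair set) = 1"
  by (simp add: measure_def emeasure_haar)

lemma haar_integrable:
  fixes f :: "'a::{conj_div_algebra, euclidean_space} mpair \<Rightarrow> 'b::{banach, second_countable_topology}"
  assumes f: "continuous_on (Kgrp p) f"
  shows "integrable (haarK q p) f"
proof -
  interpret finite_measure "(haarK q p :: 'a mpair measure)" by (rule finite_measure_haar)
  have "bounded (f ` Kgrp p)" by (rule compact_imp_bounded[OF compact_continuous_image[OF f compact_Kgrp]])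
  then obtain B where B: "\<And>k. k \<in> Kgrp p \<Longrightarrow> norm (f k) \<le> B" by (auto simp: bounded_iff)
  show ?thesis
    by (rule integrable_const_bound[where B=B])
      (auto simp: space_haar B intro!: AE_I2 measurable_continuous[OF sets_haar f])
qed

lemma haar_integral_left:
  fixes f :: "'a::{conj_div_algebra, euclidean_space} mpair \<Rightarrow> 'b::{banach, second_countable_topology}"
  assumes f: "continuous_on (Kgrp p) f" and k: "k \<in> Kgrp p"
  shows "(LINT l|haarK q p. f (kmult k l)) = (LINT l|haarK q p. f l)"
proof -
  let ?H = "(haarK q p :: 'a mpair measure)"
  have u: "snd k \<in> Unitaries p" using k by (simp add: in_Kgrp)
  have "continuous_on (Kgrp p) (kmult k)"
    unfolding kmult_def
    by (intro continuous_on_Pair continuous_on_const continuous_on_mat_times[where p=p] continuous_on_snd continuous_on_id u)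
  then have "kmult k \<in> borel_measurable ?H" by (rule measurable_continuous[OF sets_haar])
  then have "kmult k \<in> ?H \<rightarrow>\<^sub>M restrict_space borel (Kgrp p)"
    by (intro measurable_restrict_space2) (auto simp: space_haar kmult_in[OF k])
  then have m: "kmult k \<in> ?H \<rightarrow>\<^sub>M ?H" unfolding measurable_cong_sets[OF refl sets_haar] .
  have "distr ?H ?H (kmult k) = ?H"
  proof (rule measure_eqI)
    fix A assume "A \<in> sets (distr ?H ?H (kmult k))"
    then have A: "A \<in> sets ?H" by simp
    have AK: "A \<subseteq> Kgrp p" using sets.sets_into_space[OF A] by (simp add: space_haar)
    have "kmult k -` A \<inter> Kgrp p = {x\<in>Kgrp p. kmult k x \<in> A}" by auto
    also have "\<dots> = kinv k <#\<^bsub>grp q p\<^esub> A" by (rule kmult_vimage[OF k AK])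
    finally show "emeasure (distr ?H ?H (kmult k)) A = emeasure ?H A"
      by (simp add: emeasure_distr[OF m A] space_haar haar_left[OF kinv_in[OF k] A])
  qed simp
  then show ?thesis
    using integral_distr[OF m measurable_continuous[OF sets_haar f]] by simp
qed

section \<open>Hermitian forms from the parallelogram law\<close>

text \<open>The difference to the linear function with the same value at \<open>1\<close> vanishes on the integers, so it is
periodic and bounded; being additive, it is \<open>0\<close>.\<close>

lemma additive_bounded_linear:
  fixes f :: "real \<Rightarrow> real"
  assumes add: "\<And>s t. f (s + t) = f s + f t" and bnd: "\<And>t. \<bar>t\<bar> \<le> 1 \<Longrightarrow> \<bar>f t\<bar> \<le> C"
  shows "f t = t * f 1"
proof -
  define g where "g t = f t - t * f 1" for t
  have gadd: "g (s + t) = g s + g t" for s t by (simp add: g_def add algebra_simps)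
  have g0: "g 0 = 0" using gadd[of 0 0] by simp
  have gnat: "g (real n * t) = real n * g t" for n t
    by (induction n) (simp_all add: g0 gadd algebra_simps)
  have g1: "g 1 = 0" by (simp add: g_def)
  have gint: "g (of_int m) = 0" for m
  proof (cases m rule: int_cases2)
    case (nonneg n)
    then show ?thesis using gnat[of n 1] g1 by simp
  next
    case (nonpos n)
    then show ?thesis using gadd[of "- real n" "real n"] gnat[of n 1] g0 g1 by simp
  qed
  have gb: "\<bar>g s\<bar> \<le> C + \<bar>f 1\<bar>" for s
  proof -
    have "g s = g (of_int \<lfloor>s\<rfloor>) + g (frac s)" unfolding gadd[symmetric] by (simp add: frac_def)
    then have "g s = g (frac s)" using gint by simp
    have fr: "\<bar>frac s\<bar> \<le> 1" using frac_lt_1[of s] by (simp add: frac_ge_0 less_imp_le)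
    then have "\<bar>frac s * f 1\<bar> \<le> 1 * \<bar>f 1\<bar>" unfolding abs_mult by (intro mult_right_mono) auto
    then show ?thesis using bnd[OF fr] \<open>g s = g (frac s)\<close> unfolding g_def by linarith
  qed
  have "g t = 0"
  proof (rule ccontr)
    assume "g t \<noteq> 0"
    then obtain n where "C + \<bar>f 1\<bar> < real n * \<bar>g t\<bar>"
      using reals_Archimedean3[of "\<bar>g t\<bar>"] by auto
    then show False using gb[of "real n * t"] by (simp add: gnat abs_mult)
  qed
  then show ?thesis by (simp add: g_def)
qed

text \<open>The argument of Jordan and von Neumann: polarization gives a symmetric biadditive \<open>B\<close>, which is real bilinear because \<open>l\<close> is bounded
on segments. Invariance under scalars of norm \<open>1\<close> moves scalars from the second argument of \<open>B\<close> to the first as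
conjugates. The entry \<open>b i j\<close> represents the linear form \<open>c \<mapsto> B (c e\<^sub>i) e\<^sub>j\<close> on the field by the inner product
\<open>Re (c * conjg e)\<close>.\<close>

lemma hermitian_form_of_parallelogram:
  fixes l :: "(nat \<Rightarrow> 'a::{conj_div_algebra, euclidean_space}) \<Rightarrow> real"
  assumes nonneg: "\<And>v. 0 \<le> l v"
    and par: "\<And>v w. l (\<lambda>i. v i + w i) + l (\<lambda>i. v i - w i) = 2 * l v + 2 * l w"
    and unit: "\<And>c v. norm c = 1 \<Longrightarrow> l (\<lambda>i. c * v i) = l v"
    and contr: "\<And>t v. \<bar>t\<bar> \<le> 1 \<Longrightarrow> l (\<lambda>i. t *\<^sub>R v i) \<le> l v"
    and trunc: "\<And>v. l v = l (\<lambda>i. if i < q then v i else 0)"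
  shows "\<exists>b\<in>PSD q. \<forall>v. l v = repart (\<Sum>i<q. \<Sum>j<q. v i * b i j * conjg (v j))"
proof -
  define B where "B v w = (l (\<lambda>i. v i + w i) - l (\<lambda>i. v i - w i)) / 4" for v w
  have l0: "l (\<lambda>i. 0) = 0" using par[of "\<lambda>i. 0" "\<lambda>i. 0"] by simp
  have neg: "l (\<lambda>i. - v i) = l v" for v using unit[of "-1" v] by simp
  have Bsym: "B v w = B w v" for v w
    using neg[of "\<lambda>i. v i - w i"] by (simp add: B_def add.commute)
  have Bdiag: "B v v = l v" for v
    using par[of v v] l0 by (simp add: B_def)
  have Bneg: "B v (\<lambda>i. - w i) = - B v w" for v w
    unfolding B_def minus_divide_left minus_diff_eq by simp
  have B0: "B v (\<lambda>i. 0) = 0" for v by (simp add: B_def)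
  have Bpar: "B (\<lambda>i. u i + v i) w + B (\<lambda>i. u i - v i) w = 2 * B u w" for u v w
  proof -
    have e: "(\<lambda>i. u i + v i + w i) = (\<lambda>i. u i + w i + v i)" "(\<lambda>i. u i - v i + w i) = (\<lambda>i. u i + w i - v i)"
      "(\<lambda>i. u i + v i - w i) = (\<lambda>i. u i - w i + v i)" "(\<lambda>i. u i - v i - w i) = (\<lambda>i. u i - w i - v i)"
      by (simp_all add: fun_eq_iff)
    have p: "l (\<lambda>i. u i + v i + w i) + l (\<lambda>i. u i - v i + w i) = 2 * l (\<lambda>i. u i + w i) + 2 * l v"
      using par[of "\<lambda>i. u i + w i" v] by (simp only: e)
    have m: "l (\<lambda>i. u i + v i - w i) + l (\<lambda>i. u i - v i - w i) = 2 * l (\<lambda>i. u i - w i) + 2 * l v"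
      using par[of "\<lambda>i. u i - w i" v] by (simp only: e)
    have "(a - c) / 4 + (b - d) / 4 = 2 * ((e - g) / 4)" if "a + b = 2 * e + 2 * h" "c + d = 2 * g + 2 * h"
      for a b c d e g h :: real using that by (simp add: field_simps)
    from this[OF p m] show ?thesis unfolding B_def .
  qed
  have Bdouble: "B (\<lambda>i. u i + u i) w = 2 * B u w" for u w
    using Bpar[of u u w] B0[of w] Bsym[of "\<lambda>i. 0" w] by simp
  have Badd: "B (\<lambda>i. u i + v i) w = B u w + B v w" for u v w
  proof -
    \<comment> \<open>\<open>u\<close> and \<open>v\<close> are the sum and the difference of \<open>s\<close> and \<open>t\<close>\<close>
    define s where "s i = (1/2) *\<^sub>R (u i + v i)" for i
    define t where "t i = (1/2) *\<^sub>R (u i - v i)" for i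
    have "s i + t i = (1/2) *\<^sub>R (u i + u i)" "s i - t i = (1/2) *\<^sub>R (v i + v i)"
      "s i + s i = (1/2) *\<^sub>R ((u i + v i) + (u i + v i))" for i
      unfolding s_def t_def scaleR_add_right[symmetric] scaleR_diff_right[symmetric] by simp_all
    then have 1: "(\<lambda>i. s i + t i) = u" "(\<lambda>i. s i - t i) = v" "(\<lambda>i. s i + s i) = (\<lambda>i. u i + v i)"
      unfolding scaleR_half_double by simp_all
    show ?thesis using Bpar[of s t w] Bdouble[of s w] by (simp only: 1)
  qed
  have bnd: "\<bar>(x - y) / 4\<bar> \<le> a + b" if "x + y \<le> 2 * a + 2 * b" "0 \<le> x" "0 \<le> y" "0 \<le> a" "0 \<le> b"
    for x y a b :: real using that by (simp add: abs_le_iff field_simps)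
  have Bscale: "B (\<lambda>i. t *\<^sub>R v i) w = t * B v w" for t v w
  proof -
    have "B (\<lambda>i. t *\<^sub>R v i) w = t * B (\<lambda>i. 1 *\<^sub>R v i) w"
    proof (rule additive_bounded_linear)
      fix s t :: real
      show "B (\<lambda>i. (s + t) *\<^sub>R v i) w = B (\<lambda>i. s *\<^sub>R v i) w + B (\<lambda>i. t *\<^sub>R v i) w"
        by (simp add: scaleR_add_left Badd)
      assume t: "\<bar>t\<bar> \<le> 1"
      have "l (\<lambda>i. t *\<^sub>R v i + w i) + l (\<lambda>i. t *\<^sub>R v i - w i) \<le> 2 * l v + 2 * l w"
        using par[of "\<lambda>i. t *\<^sub>R v i" w] contr[OF t, of v] by simp
      then show "\<bar>B (\<lambda>i. t *\<^sub>R v i) w\<bar> \<le> l v + l w"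
        unfolding B_def by (rule bnd[OF _ nonneg nonneg nonneg nonneg])
    qed
    then show ?thesis by simp
  qed
  have lscale: "l (\<lambda>i. t *\<^sub>R v i) = t\<^sup>2 * l v" for t v
    using Bscale[of t v "\<lambda>i. t *\<^sub>R v i"] Bscale[of t v v] Bsym[of "\<lambda>i. t *\<^sub>R v i" v]
    by (simp add: Bdiag[symmetric] power2_eq_square)
  have lmult: "l (\<lambda>i. c * v i) = (norm c)\<^sup>2 * l v" for c v
  proof (cases "c = 0")
    case False
    have "l (\<lambda>i. c * v i) = l (\<lambda>i. norm c *\<^sub>R (sgn c * v i))"
      using False by (simp add: sgn_div_norm)
    also have "\<dots> = (norm c)\<^sup>2 * l (\<lambda>i. sgn c * v i)" by (rule lscale)
    also have "l (\<lambda>i. sgn c * v i) = l v" by (rule unit) (simp add: norm_sgn False)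
    finally show ?thesis .
  qed (simp add: l0)
  have Bmult: "B (\<lambda>i. c * v i) (\<lambda>i. c * w i) = (norm c)\<^sup>2 * B v w" for c v w
    unfolding B_def distrib_left[symmetric] right_diff_distrib[symmetric]
      lmult[of c "\<lambda>i. v i + w i"] lmult[of c "\<lambda>i. v i - w i"] by simp
  have Bconj: "B (\<lambda>i. c * v i) (\<lambda>i. e * w i) = B (\<lambda>i. conjg e * c * v i) w" for c e v w
  proof (cases "e = 0")
    case True
    then show ?thesis using B0[of "\<lambda>i. c * v i"] B0[of w] Bsym[of "\<lambda>i. 0" w] by simp
  next
    case False
    have e: "conjg e = (norm e)\<^sup>2 *\<^sub>R inverse e"
    proof -
      have "conjg e = inverse e * (e * conjg e)" using False by (simp add: mult.assoc[symmetric])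
      then show ?thesis by (simp add: mult_conjg)
    qed
    have "B (\<lambda>i. c * v i) (\<lambda>i. e * w i) = B (\<lambda>i. e * (inverse e * c * v i)) (\<lambda>i. e * w i)"
      using False by (simp add: mult.assoc[symmetric])
    also have "\<dots> = (norm e)\<^sup>2 * B (\<lambda>i. inverse e * c * v i) w" by (rule Bmult)
    also have "\<dots> = B (\<lambda>i. (norm e)\<^sup>2 *\<^sub>R (inverse e * c * v i)) w" by (simp add: Bscale)
    also have "\<dots> = B (\<lambda>i. conjg e * c * v i) w" by (simp add: e)
    finally show ?thesis .
  qed
  define ev :: "'a \<Rightarrow> nat \<Rightarrow> nat \<Rightarrow> 'a" where "ev c i = (\<lambda>k. if k = i then c else 0)" for c i
  have ev_add: "ev (c + e) i = (\<lambda>k. ev c i k + ev e i k)" for c e i by (auto simp: ev_def)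
  have ev_scale: "ev (t *\<^sub>R c) i = (\<lambda>k. t *\<^sub>R ev c i k)" for t c i by (auto simp: ev_def)
  have ev_mult: "ev (c * e) i = (\<lambda>k. c * ev e i k)" for c e i by (auto simp: ev_def)
  define b where "b i j = (if i < q \<and> j < q then \<Sum>e\<in>Basis. B (ev e i) (ev 1 j) *\<^sub>R conjg e else 0)" for i j
  have Bsum: "B (\<lambda>k. \<Sum>x\<in>X. g x k) w = (\<Sum>x\<in>X. B (g x) w)" if "finite X" for X and g :: "'x \<Rightarrow> nat \<Rightarrow> 'a" and w
    using that
  proof (induction X)
    case empty then show ?case using B0[of w] Bsym[of "\<lambda>i. 0" w] by simp
  qed (simp add: Badd)
  have b: "repart (c * b i j) = B (ev c i) (ev 1 j)" if "i < q" "j < q" for c i j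
  proof -
    have "repart (c * b i j) = (\<Sum>e\<in>Basis. (c \<bullet> e) * B (ev e i) (ev 1 j))"
      using that by (simp add: b_def sum_distrib_left repart_sum inner_eq_repart mult.commute)
    also have "\<dots> = (\<Sum>e\<in>Basis. B (ev ((c \<bullet> e) *\<^sub>R e) i) (ev 1 j))"
      by (simp add: ev_scale Bscale)
    also have "\<dots> = B (\<lambda>k. \<Sum>e\<in>Basis. ev ((c \<bullet> e) *\<^sub>R e) i k) (ev 1 j)"
      by (rule Bsum[symmetric]) simp
    also have "(\<lambda>k. \<Sum>e\<in>Basis. ev ((c \<bullet> e) *\<^sub>R e) i k) = ev c i"
    proof
      fix k
      show "(\<Sum>e\<in>Basis. ev ((c \<bullet> e) *\<^sub>R e) i k) = ev c i k"
        by (cases "k = i") (simp_all add: ev_def euclidean_representation)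
    qed
    finally show ?thesis .
  qed
  have b': "repart (c * b i j) = repart (c * conjg (b j i))" for c i j
  proof (cases "i < q \<and> j < q")
    case True
    have "repart (c * conjg (b j i)) = repart (conjg c * b j i)"
      using repart_conjg[of "c * conjg (b j i)"] repart_mult_commute[of "b j i" "conjg c"]
      by (simp add: conjg_mult conjg_conjg)
    also have "\<dots> = B (ev (conjg c) j) (ev 1 i)" using True by (simp add: b)
    also have "\<dots> = B (\<lambda>k. conjg c * 1 * ev 1 j k) (ev 1 i)" using ev_mult[of "conjg c" 1 j] by simp
    also have "\<dots> = B (\<lambda>k. 1 * ev 1 j k) (\<lambda>k. c * ev 1 i k)" by (rule Bconj[symmetric])
    also have "\<dots> = B (ev c i) (ev 1 j)" using ev_mult[of c 1 i] Bsym by simp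
    finally show ?thesis using True by (simp add: b)
  qed (auto simp: b_def)
  have herm: "b i j = conjg (b j i)" for i j
  proof -
    define x where "x = b i j - conjg (b j i)"
    have "repart (c * x) = 0" for c using b'[of c i j] by (simp add: x_def right_diff_distrib repart_diff)
    from this[of "conjg x"] have "repart (x * conjg x) = 0" by (simp add: repart_mult_commute)
    then show ?thesis by (simp add: x_def)
  qed
  have rep: "l v = repart (\<Sum>i<q. \<Sum>j<q. v i * b i j * conjg (v j))" for v
  proof -
    have tr: "(\<lambda>i. if i < q then v i else 0) = (\<lambda>k. \<Sum>i<q. ev (v i) i k)"
      by (simp add: ev_def fun_eq_iff)
    have "l v = B (\<lambda>k. \<Sum>i<q. ev (v i) i k) (\<lambda>k. \<Sum>i<q. ev (v i) i k)"
      using trunc[of v] by (simp only: tr Bdiag)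
    also have "\<dots> = (\<Sum>i<q. B (ev (v i) i) (\<lambda>k. \<Sum>i<q. ev (v i) i k))" by (rule Bsum) simp
    also have "\<dots> = (\<Sum>i<q. B (\<lambda>k. \<Sum>j<q. ev (v j) j k) (ev (v i) i))" by (simp only: Bsym)
    also have "\<dots> = (\<Sum>i<q. \<Sum>j<q. B (ev (v j) j) (ev (v i) i))"
      by (intro sum.cong refl Bsum) simp
    also have "\<dots> = (\<Sum>i<q. \<Sum>j<q. repart (v i * b i j * conjg (v j)))"
    proof (intro sum.cong refl)
      fix i j assume "i \<in> {..<q}" "j \<in> {..<q}"
      then have ij: "i < q" "j < q" by auto
      have "B (ev (v j) j) (ev (v i) i) = B (ev (v i) i) (ev (v j) j)" by (rule Bsym)
      also have "\<dots> = B (\<lambda>k. v i * ev 1 i k) (\<lambda>k. v j * ev 1 j k)"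
        using ev_mult[of "v i" 1 i] ev_mult[of "v j" 1 j] by simp
      also have "\<dots> = B (ev (conjg (v j) * v i) i) (ev 1 j)"
        using ev_mult[of "conjg (v j) * v i" 1 i] by (simp add: Bconj)
      also have "\<dots> = repart (conjg (v j) * v i * b i j)" by (rule b[OF ij, symmetric])
      also have "\<dots> = repart (v i * b i j * conjg (v j))"
        using repart_mult_commute[of "conjg (v j)" "v i * b i j"] by (simp add: mult.assoc)
      finally show "B (ev (v j) j) (ev (v i) i) = repart (v i * b i j * conjg (v j))" .
    qed
    finally show ?thesis by (simp add: repart_sum)
  qed
  have "b \<in> PSD q"
    unfolding PSD_def Hermitians_def
  proof (intro CollectI conjI allI)
    show "b \<in> Mats q q" by (auto simp: Mats_def b_def)
    show "mat_star b = b" by (intro ext) (simp add: mat_star_def herm[symmetric])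
    show "0 \<le> repart (\<Sum>i<q. \<Sum>j<q. conjg (v i) * b i j * v j)" for v
      using rep[of "\<lambda>i. conjg (v i)"] nonneg[of "\<lambda>i. conjg (v i)"] by (simp add: conjg_conjg)
  qed
  with rep show ?thesis by blast
qed

section \<open>Multiplicativity over disjoint rows\<close>

definition Mlim :: "nat \<Rightarrow> 'a::conj_div_algebra inf_mat set" where
  "Mlim q = (\<Union>p. Mats p q)"

lemma Mats_Mlim: "x \<in> Mats p q \<Longrightarrow> x \<in> Mlim q"
  by (auto simp: Mlim_def)

text \<open>A minimum point of \<open>h\<close> on the compact group.\<close>

lemma haar_exists_le_integral:
  fixes h :: "'a::{conj_div_algebra, euclidean_space} mpair \<Rightarrow> real"
  assumes h: "continuous_on (Kgrp p) h"
  shows "\<exists>k\<in>Kgrp p. h k \<le> (LINT k|haarK q p. h k)"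
proof -
  interpret finite_measure "(haarK q p :: 'a mpair measure)" by (rule finite_measure_haar)
  have ne: "(Kgrp p :: 'a mpair set) \<noteq> {}"
  proof -
    have "(\<lambda>i j. 0, mat_id) \<in> (Kgrp p :: 'a mpair set)" by (simp add: in_Kgrp)
    then show ?thesis by blast
  qed
  from continuous_attains_inf[OF compact_Kgrp ne h]
  obtain k where k: "k \<in> Kgrp p" "\<forall>l\<in>Kgrp p. h k \<le> h l" by blast
  have "h k = (LINT l|(haarK q p :: 'a mpair measure). h k)"
    by (simp add: space_haar)
  also have "\<dots> \<le> (LINT l|haarK q p. h l)"
    by (rule integral_mono[OF _ haar_integrable[OF h]]) (use k in \<open>auto simp: space_haar\<close>)
  finally show ?thesis using k(1) by blast
qed

text \<open>What the Hilbert space argument uses of a positive definite spherical function, expressed by its restriction \<open>f\<close> to the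
elements \<open>(x, 1)\<close>.\<close>

locale spherical_kernel =
  fixes q :: nat and f :: "'a::{conj_div_algebra, euclidean_space} inf_mat \<Rightarrow> real"
  assumes zero: "f (\<lambda>i j. 0) = 1"
    and invariant: "\<And>u p x. u \<in> Unitaries p \<Longrightarrow> x \<in> Mlim q \<Longrightarrow> f (mat_times u x) = f x"
    and posdef: "\<And>(N::nat) z c. (\<And>k. k < N \<Longrightarrow> z k \<in> Mlim q) \<Longrightarrow>
      0 \<le> (\<Sum>k<N. \<Sum>l<N. c k * c l * f (\<lambda>i j. z k i j - z l i j))"
    and continuous: "\<And>p. continuous_on (Mats p q) f"
    and spherical: "\<And>x y. x \<in> Mlim q \<Longrightarrow> y \<in> Mlim q \<Longrightarrow>
      (\<lambda>p. LINT k|haarK q p. f (\<lambda>i j. x i j + mat_times (snd k) y i j)) \<longlonglongrightarrow> f x * f y"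
begin

lemma even: "x \<in> Mlim q \<Longrightarrow> f (\<lambda>i j. - x i j) = f x"
proof -
  assume x: "x \<in> Mlim q"
  then obtain p where p: "x \<in> Mats p q" by (auto simp: Mlim_def)
  have "mat_times (scal_mat p (-1)) x = (\<lambda>i j. - x i j)"
    using p by (auto simp: mat_times_scal Mats_def fun_eq_iff)
  then show ?thesis using invariant[OF scal_Unitaries[of "-1" p] x] by simp
qed

lemma diff_Mlim: "x \<in> Mlim q \<Longrightarrow> y \<in> Mlim q \<Longrightarrow> (\<lambda>i j. x i j - y i j) \<in> Mlim q"
proof -
  assume "x \<in> Mlim q" "y \<in> Mlim q"
  then obtain m n where "x \<in> Mats m q" "y \<in> Mats n q" by (auto simp: Mlim_def)
  then have "(\<lambda>i j. x i j - y i j) \<in> Mats (max m n) q" by (auto simp: Mats_def)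
  then show ?thesis by (rule Mats_Mlim)
qed

lemma diff_commute: "x \<in> Mlim q \<Longrightarrow> y \<in> Mlim q \<Longrightarrow> f (\<lambda>i j. x i j - y i j) = f (\<lambda>i j. y i j - x i j)"
  using even[OF diff_Mlim[of y x]] by simp

text \<open>The squared norm, in the Hilbert space of the kernel, of the combination of the points \<open>z k\<close>, \<open>0\<close> and \<open>y\<close> with weights
\<open>a\<close>, \<open>s\<close> and \<open>t\<close>. Pairs in opposite order agree because \<open>f\<close> is even.\<close>

lemma posdef_three:
  fixes N :: nat
  assumes z: "\<And>k. k < N \<Longrightarrow> z k \<in> Mlim q" and y: "y \<in> Mlim q"
  shows "0 \<le> a\<^sup>2 * (\<Sum>k<N. \<Sum>l<N. f (\<lambda>i j. z k i j - z l i j)) + s\<^sup>2 + t\<^sup>2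
    + 2 * a * s * (\<Sum>k<N. f (z k)) + 2 * a * t * (\<Sum>k<N. f (\<lambda>i j. y i j - z k i j)) + 2 * s * t * f y"
proof -
  define Z where "Z k = (if k < N then z k else if k = N then (\<lambda>i j. 0) else y)" for k
  define c where "c k = (if k < N then a else if k = N then s else t)" for k
  have y0: "(\<lambda>i j. 0 :: 'a) \<in> Mlim q" by (rule Mats_Mlim[of _ 0]) simp
  have Z: "Z k \<in> Mlim q" for k using z y y0 by (simp add: Z_def)
  have "0 \<le> (\<Sum>k<Suc (Suc N). \<Sum>l<Suc (Suc N). c k * c l * f (\<lambda>i j. Z k i j - Z l i j))"
    by (rule posdef[OF Z])
  also have "\<dots> = (\<Sum>k<N. (\<Sum>l<N. a * a * f (\<lambda>i j. z k i j - z l i j)) + a * s * f (z k) + a * t * f (\<lambda>i j. y i j - z k i j))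
     + ((\<Sum>l<N. s * a * f (z l)) + s * s * 1 + s * t * f y)
     + ((\<Sum>l<N. t * a * f (\<lambda>i j. y i j - z l i j)) + t * s * f y + t * t * 1)"
  proof -
    have 1: "(\<Sum>l<N. c k * c l * f (\<lambda>i j. Z k i j - Z l i j)) = (\<Sum>l<N. c k * a * f (\<lambda>i j. Z k i j - z l i j))" for k
      by (rule sum.cong) (simp_all add: c_def Z_def)
    have 2: "(\<Sum>k<N. (\<Sum>l<N. c k * a * f (\<lambda>i j. Z k i j - z l i j)) + c k * s * f (Z k) + c k * t * f (\<lambda>i j. Z k i j - y i j))
      = (\<Sum>k<N. (\<Sum>l<N. a * a * f (\<lambda>i j. z k i j - z l i j)) + a * s * f (z k) + a * t * f (\<lambda>i j. y i j - z k i j))"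
      by (rule sum.cong) (simp_all add: c_def Z_def diff_commute[OF z y])
    have 3: "(\<Sum>l<N. s * a * f (\<lambda>i j. - z l i j)) = (\<Sum>l<N. s * a * f (z l))"
      by (rule sum.cong) (simp_all add: even z)
    have N: "c N = s" "c (Suc N) = t" "Z N = (\<lambda>i j. 0)" "Z (Suc N) = y" by (simp_all add: c_def Z_def)
    show ?thesis
      unfolding sum.lessThan_Suc 1 N by (simp add: 2 3 even[OF y] zero)
  qed
  also have "\<dots> = a\<^sup>2 * (\<Sum>k<N. \<Sum>l<N. f (\<lambda>i j. z k i j - z l i j)) + s\<^sup>2 + t\<^sup>2
    + 2 * a * s * (\<Sum>k<N. f (z k)) + 2 * a * t * (\<Sum>k<N. f (\<lambda>i j. y i j - z k i j)) + 2 * s * t * f y"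
    by (simp add: sum.distrib sum_distrib_left[symmetric] power2_eq_square algebra_simps)
  finally show ?thesis .
qed

lemma le_1: "x \<in> Mlim q \<Longrightarrow> f x \<le> 1"
  using posdef_three[of 0 "\<lambda>_ _ _. 0" x 0 1 "-1"] by simp

definition mean :: "nat \<Rightarrow> 'a inf_mat \<Rightarrow> real" where
  "mean p x = (LINT k|haarK q p. f (\<lambda>i j. x i j - mat_times (snd k) x i j))"

lemma continuous_on_translate:
  assumes x: "x \<in> Mats n q" and y: "y \<in> Mats n q" and "n \<le> p"
  shows "continuous_on (Kgrp p) (\<lambda>k. f (\<lambda>i j. y i j - mat_times (snd k) x i j))"
proof -
  have g: "continuous_on (Kgrp p) (\<lambda>k. mat_times (snd k) x)"
    by (rule continuous_on_mat_times[where p=p])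
      (auto simp: in_Kgrp intro: continuous_on_snd continuous_on_id continuous_on_const)
  have "continuous_on (Kgrp p) (\<lambda>k i j. y i j - mat_times (snd k) x i j)"
    by (rule continuous_on_matI) (rule continuous_on_diff[OF continuous_on_const continuous_on_entry[OF g]])
  moreover have "(\<lambda>i j. y i j - mat_times (snd k) x i j) \<in> Mats p q" if "k \<in> Kgrp p" for k
    using that Unitaries_times_Mats[of "snd k" p x p q] Mats_mono[OF \<open>n \<le> p\<close> x] Mats_mono[OF \<open>n \<le> p\<close> y]
    by (auto simp: in_Kgrp Mats_def)
  ultimately show ?thesis
    by (intro continuous_on_compose2[OF continuous]) auto
qed

text \<open>The points are chosen one after another. By left invariance, the mean over \<open>k\<close> of the interaction of \<open>k x\<close> with an earlier
point is \<open>mean p x\<close>, whatever that point is; so the interaction of some \<open>k x\<close> with all earlier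
points together is at most its mean.\<close>

lemma exists_spread_rotations:
  assumes x: "x \<in> Mats n q" and np: "n \<le> p"
  shows "\<exists>w. (\<forall>k<N. w k \<in> Unitaries p) \<and>
    (\<Sum>k<N. \<Sum>l<N. f (\<lambda>i j. mat_times (w k) x i j - mat_times (w l) x i j)) \<le> real N + real N * (real N - 1) * mean p x"
proof (induction N)
  case (Suc N)
  then obtain w where w: "\<forall>k<N. w k \<in> Unitaries p"
    "(\<Sum>k<N. \<Sum>l<N. f (\<lambda>i j. mat_times (w k) x i j - mat_times (w l) x i j)) \<le> real N + real N * (real N - 1) * mean p x"
    by blast
  have xp: "x \<in> Mats p q" by (rule Mats_mono[OF np x])
  have wx: "mat_times u x \<in> Mats p q" if "u \<in> Unitaries p" for u
    by (rule Unitaries_times_Mats[OF that xp order_refl])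
  let ?g = "\<lambda>l k. f (\<lambda>i j. mat_times (w l) x i j - mat_times (snd k) x i j)"
  have cont: "continuous_on (Kgrp p) (?g l)" if "l < N" for l
    by (rule continuous_on_translate[OF xp wx order_refl]) (use w that in blast)
  have mean: "(LINT k|haarK q p. ?g l k) = mean p x" if "l < N" for l
  proof -
    have u: "w l \<in> Unitaries p" using w that by blast
    let ?k = "(\<lambda>i j. 0, w l)"
    have k: "?k \<in> Kgrp p" using u by (simp add: in_Kgrp)
    have "(LINT k|haarK q p. ?g l k) = (LINT k|haarK q p. ?g l (kmult ?k k))"
      by (rule haar_integral_left[OF cont[OF that] k, symmetric])
    also have "\<dots> = mean p x"
      unfolding mean_def
    proof (rule Bochner_Integration.integral_cong[OF refl])
      fix k :: "'a mpair" assume "k \<in> space (haarK q p)"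
      then have v: "snd k \<in> Unitaries p" by (simp add: space_haar in_Kgrp)
      have "mat_times (mat_times (w l) (snd k)) x = mat_times (w l) (mat_times (snd k) x)"
        by (rule mat_times_assoc[OF rowfin_Unitaries[OF u] rowfin_Unitaries[OF v]])
      then have "?g l (kmult ?k k) = f (\<lambda>i j. mat_times (w l) x i j + - mat_times (w l) (mat_times (snd k) x) i j)"
        by (simp add: kmult_def)
      also have "(\<lambda>i j. mat_times (w l) x i j + - mat_times (w l) (mat_times (snd k) x) i j)
        = mat_times (w l) (\<lambda>i j. x i j + - mat_times (snd k) x i j)"
        unfolding mat_times_add_right[OF rowfin_Unitaries[OF u]] mat_times_minus_right ..
      also have "f \<dots> = f (\<lambda>i j. x i j + - mat_times (snd k) x i j)"
        by (rule invariant[OF u]) (rule Mats_Mlim[of _ p], intro add_Mats minus_Mats xp wx v)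
      finally show "?g l (kmult ?k k) = f (\<lambda>i j. x i j - mat_times (snd k) x i j)" by simp
    qed
    finally show ?thesis .
  qed
  have "continuous_on (Kgrp p) (\<lambda>k. \<Sum>l<N. ?g l k)" by (intro continuous_on_sum cont) simp
  from haar_exists_le_integral[OF this, of q]
  obtain k where k: "k \<in> Kgrp p" "(\<Sum>l<N. ?g l k) \<le> (LINT k|haarK q p. (\<Sum>l<N. ?g l k))" by blast
  have "(LINT k|haarK q p. (\<Sum>l<N. ?g l k)) = (\<Sum>l<N. LINT k|haarK q p. ?g l k)"
    by (rule Bochner_Integration.integral_sum) (rule haar_integrable[OF cont], simp)
  also have "\<dots> = real N * mean p x" by (simp add: mean)
  finally have kN: "(\<Sum>l<N. ?g l k) \<le> real N * mean p x" using k(2) by simp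
  define w' where "w' = w(N := snd k)"
  have w': "\<forall>l<Suc N. w' l \<in> Unitaries p" using w(1) k(1) by (auto simp: w'_def less_Suc_eq in_Kgrp)
  have wl: "w' l = w l" if "l < N" for l using that by (simp add: w'_def)
  have wN: "w' N = snd k" by (simp add: w'_def)
  let ?h = "\<lambda>k l. f (\<lambda>i j. mat_times (w' k) x i j - mat_times (w' l) x i j)"
  have sym: "?h N l = ?h l N" if "l < N" for l
    by (rule diff_commute) (use wx w' that in \<open>auto intro!: Mats_Mlim[of _ p]\<close>)
  have 1: "(\<Sum>k<N. \<Sum>l<N. ?h k l) = (\<Sum>k<N. \<Sum>l<N. f (\<lambda>i j. mat_times (w k) x i j - mat_times (w l) x i j))"
    by (intro sum.cong refl) (simp add: wl)
  have 2: "(\<Sum>l<N. ?h l N) = (\<Sum>l<N. ?g l k)" by (intro sum.cong refl) (simp add: wl wN)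
  have 3: "(\<Sum>l<N. ?h N l) = (\<Sum>l<N. ?h l N)" by (rule sum.cong[OF refl]) (simp add: sym)
  have "(\<Sum>k<Suc N. \<Sum>l<Suc N. ?h k l) = (\<Sum>k<N. \<Sum>l<N. ?h k l) + (\<Sum>l<N. ?h l N) + ((\<Sum>l<N. ?h N l) + ?h N N)"
    by (simp add: sum.distrib)
  also have "\<dots> \<le> (real N + real N * (real N - 1) * mean p x) + real N * mean p x + (real N * mean p x + 1)"
    unfolding 1 3 2 using w(2) kN zero by simp
  also have "\<dots> = real (Suc N) + real (Suc N) * (real (Suc N) - 1) * mean p x" by (simp add: algebra_simps)
  finally show ?case using w' by blast
qed simp

text \<open>Cauchy--Schwarz in the Hilbert space of the kernel, between the vector of \<open>y\<close> and the mean of the vectors of \<open>- w k x\<close>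
minus \<open>f x\<close> times the vector of \<open>0\<close>. As \<open>w k\<close> fixes \<open>y\<close>, their inner product is \<open>f (x + y) - f x * f y\<close>.
The right hand side bounds the squared norm of the difference.\<close>

lemma mult_bound:
  assumes x: "x \<in> Mats n q" and y: "y \<in> Mlim q" and y0: "\<And>i j. i < p \<Longrightarrow> y i j = 0" and np: "n \<le> p" and "0 < p"
  shows "(f (\<lambda>i j. x i j + y i j) - f x * f y)\<^sup>2 \<le> 1 / real p + (1 - 1 / real p) * mean p x - (f x)\<^sup>2"
proof -
  obtain w where w: "\<And>k. k < p \<Longrightarrow> w k \<in> Unitaries p" 
    "(\<Sum>k<p. \<Sum>l<p. f (\<lambda>i j. mat_times (w k) x i j - mat_times (w l) x i j)) \<le> real p + real p * (real p - 1) * mean p x"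
    using exists_spread_rotations[OF x np, of p] by blast
  have xp: "x \<in> Mats p q" by (rule Mats_mono[OF np x])
  define z where "z k = (\<lambda>i j. - mat_times (w k) x i j)" for k
  have wx: "mat_times (w k) x \<in> Mats p q" if "k < p" for k
    by (rule Unitaries_times_Mats[OF w(1)[OF that] xp order_refl])
  have zM: "z k \<in> Mlim q" if "k < p" for k
    unfolding z_def by (rule Mats_Mlim[OF minus_Mats[OF wx[OF that]]])
  have zz: "f (\<lambda>i j. z k i j - z l i j) = f (\<lambda>i j. mat_times (w k) x i j - mat_times (w l) x i j)" if "k < p" "l < p" for k l
    using diff_commute[OF Mats_Mlim[OF wx[OF that(1)]] Mats_Mlim[OF wx[OF that(2)]]] by (simp add: z_def)
  have z1: "f (z k) = f x" if "k < p" for k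
    using even[OF Mats_Mlim[OF wx[OF that]]] invariant[OF w(1)[OF that] Mats_Mlim[OF x]] by (simp add: z_def)
  have yz: "f (\<lambda>i j. y i j - z k i j) = f (\<lambda>i j. x i j + y i j)" if "k < p" for k
  proof -
    note u = w(1)[OF that]
    have "mat_times (w k) y = y" using y0 by (auto simp: Unitaries_times[OF u] fun_eq_iff intro!: sum.neutral)
    then have "(\<lambda>i j. y i j - z k i j) = (\<lambda>i j. mat_times (w k) x i j + mat_times (w k) y i j)"
      by (simp add: z_def add.commute)
    then have e: "(\<lambda>i j. y i j - z k i j) = mat_times (w k) (\<lambda>i j. x i j + y i j)"
      unfolding mat_times_add_right[OF rowfin_Unitaries[OF u]] .
    have "f (mat_times (w k) (\<lambda>i j. x i j + y i j)) = f (\<lambda>i j. x i j + y i j)"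
    proof (rule invariant[OF u])
      obtain m where "y \<in> Mats m q" using y by (auto simp: Mlim_def)
      then have "(\<lambda>i j. x i j + y i j) \<in> Mats (max m n) q" using x by (auto simp: Mats_def)
      then show "(\<lambda>i j. x i j + y i j) \<in> Mlim q" by (rule Mats_Mlim)
    qed
    then show ?thesis unfolding e .
  qed
  define A where "A = f (\<lambda>i j. x i j + y i j) - f x * f y"
  define S where "S = (\<Sum>k<p. \<Sum>l<p. f (\<lambda>i j. z k i j - z l i j))"
  have Z1: "(\<Sum>k<p. f (z k)) = real p * f x" by (simp add: z1)
  have Z2: "(\<Sum>k<p. f (\<lambda>i j. y i j - z k i j)) = real p * f (\<lambda>i j. x i j + y i j)" by (simp add: yz)
  \<comment> \<open>the weight \<open>- A\<close> of \<open>y\<close> minimizes the quadratic form\<close>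
  have "0 \<le> (1 / real p)\<^sup>2 * S + (- f x)\<^sup>2 + (- A)\<^sup>2
    + 2 * (1 / real p) * (- f x) * (real p * f x) + 2 * (1 / real p) * (- A) * (real p * f (\<lambda>i j. x i j + y i j)) + 2 * (- f x) * (- A) * f y"
    unfolding S_def Z1[symmetric] Z2[symmetric] by (rule posdef_three[OF _ y]) (rule zM)
  also have "\<dots> = (1 / real p)\<^sup>2 * S - (f x)\<^sup>2 + A\<^sup>2 - 2 * A * (f (\<lambda>i j. x i j + y i j) - f x * f y)"
    using \<open>0 < p\<close> by (simp add: power2_eq_square algebra_simps)
  also have "\<dots> = (1 / real p)\<^sup>2 * S - (f x)\<^sup>2 - A\<^sup>2"
    unfolding A_def[symmetric] by (simp add: power2_eq_square)
  finally have "A\<^sup>2 \<le> (1 / real p)\<^sup>2 * S - (f x)\<^sup>2" by simp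
  also have "S \<le> real p + real p * (real p - 1) * mean p x"
    using w(2) unfolding S_def by (simp add: zz)
  then have "(1 / real p)\<^sup>2 * S \<le> (1 / real p)\<^sup>2 * (real p + real p * (real p - 1) * mean p x)"
    by (rule mult_left_mono) simp
  also have "\<dots> = 1 / real p + (1 - 1 / real p) * mean p x"
    using \<open>0 < p\<close> by (simp add: power2_eq_square field_simps)
  finally show ?thesis by (simp add: A_def)
qed

lemma mean_tendsto: assumes x: "x \<in> Mlim q" shows "(\<lambda>p. mean p x) \<longlonglongrightarrow> (f x)\<^sup>2"
proof -
  obtain n where n: "x \<in> Mats n q" using x by (auto simp: Mlim_def)
  have "(\<lambda>p. LINT k|haarK q p. f (\<lambda>i j. x i j + mat_times (snd k) (\<lambda>i j. - x i j) i j)) \<longlonglongrightarrow> f x * f (\<lambda>i j. - x i j)"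
    by (rule spherical[OF x Mats_Mlim[OF minus_Mats[OF n]]])
  then show ?thesis by (simp add: mat_times_minus_right even[OF x] mean_def power2_eq_square)
qed

text \<open>For every large \<open>p\<close>, swapping the rows \<open>i\<close> and \<open>i + p\<close> for \<open>m \<le> i < n\<close> moves \<open>y\<close> out of the first \<open>p\<close> rows without changing \<open>x\<close>.
This leaves \<open>f y\<close> and \<open>f (x + y)\<close> unchanged, and the bound of the previous lemma tends to \<open>0\<close>.\<close>

lemma mult_disjoint_rows:
  assumes x: "x \<in> Mats m q" and y: "y \<in> Mlim q" and y0: "\<And>i j. i < m \<Longrightarrow> y i j = 0"
  shows "f (\<lambda>i j. x i j + y i j) = f x * f y"
proof -
  obtain n0 where n0: "y \<in> Mats n0 q" using y by (auto simp: Mlim_def)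
  \<comment> \<open>the successor only ensures that \<open>p \<ge> n\<close> is positive\<close>
  define n where "n = Suc (max m n0)"
  have yn: "y \<in> Mats n q" by (rule Mats_mono[OF _ n0]) (simp add: n_def)
  have mn: "m \<le> n" "0 < n" by (auto simp: n_def)
  have bound: "(f (\<lambda>i j. x i j + y i j) - f x * f y)\<^sup>2 \<le> 1 / real p + (1 - 1 / real p) * mean p x - (f x)\<^sup>2" if p: "n \<le> p" for p
  proof -
    define \<sigma> where "\<sigma> i = (if m \<le> i \<and> i < n then i + p else if m + p \<le> i \<and> i < n + p then i - p else i)" for i
    have inv: "\<sigma> (\<sigma> i) = i" for i using p by (auto simp: \<sigma>_def)
    have perm: "\<sigma> permutes {..<n + p}"
      unfolding permutes_def
    proof (intro conjI allI impI)
      show "\<sigma> i = i" if "i \<notin> {..<n + p}" for i using that by (auto simp: \<sigma>_def)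
      show "\<exists>!i. \<sigma> i = j" for j
      proof (rule ex1I[of _ "\<sigma> j"])
        fix i assume "\<sigma> i = j"
        then have "\<sigma> (\<sigma> i) = \<sigma> j" by simp
        then show "i = \<sigma> j" by (simp only: inv)
      qed (rule inv)
    qed
    define Y where "Y = mat_times (perm_mat \<sigma>) y"
    have Y: "Y i j = y (\<sigma> i) j" for i j by (simp add: Y_def mat_times_perm)
    note u = perm_Unitaries[OF perm, where 'a='a]
    have x\<sigma>: "mat_times (perm_mat \<sigma>) x = x"
    proof (intro ext)
      fix i j
      have "\<sigma> i = i \<or> m \<le> i \<and> m \<le> \<sigma> i" using p by (auto simp: \<sigma>_def)
      then show "mat_times (perm_mat \<sigma>) x i j = x i j"
        using MatsD[OF x, of i j] MatsD[OF x, of "\<sigma> i" j] by (auto simp: mat_times_perm)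
    qed
    have Ymem: "Y \<in> Mats (n + p) q" unfolding Y_def by (rule Unitaries_times_Mats[OF u Mats_mono[OF _ yn]]) auto
    have xy: "(\<lambda>i j. x i j + y i j) \<in> Mlim q"
      by (rule Mats_Mlim[OF add_Mats[OF Mats_mono[OF mn(1) x] yn]])
    have "Y i j = 0" if "i < p" for i j
    proof -
      have "\<sigma> i < m \<or> n \<le> \<sigma> i" using that p by (auto simp: \<sigma>_def)
      then show ?thesis using y0[of "\<sigma> i" j] MatsD[OF yn, of "\<sigma> i" j] by (auto simp: Y)
    qed
    then have "(f (\<lambda>i j. x i j + Y i j) - f x * f Y)\<^sup>2 \<le> 1 / real p + (1 - 1 / real p) * mean p x - (f x)\<^sup>2"
      using mn p by (intro mult_bound[OF x Mats_Mlim[OF Ymem]]) auto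
    moreover have "f Y = f y" unfolding Y_def by (rule invariant[OF u y])
    moreover have "f (\<lambda>i j. x i j + Y i j) = f (\<lambda>i j. x i j + y i j)"
    proof -
      have "(\<lambda>i j. x i j + Y i j) = (\<lambda>i j. mat_times (perm_mat \<sigma>) x i j + mat_times (perm_mat \<sigma>) y i j)"
        by (simp add: x\<sigma> Y_def)
      also have "\<dots> = mat_times (perm_mat \<sigma>) (\<lambda>i j. x i j + y i j)"
        by (rule mat_times_add_right[OF rowfin_Unitaries[OF u], symmetric])
      finally show ?thesis using invariant[OF u xy] by simp
    qed
    ultimately show ?thesis by simp
  qed
  have inv_p: "(\<lambda>p. 1 / real p) \<longlonglongrightarrow> 0" by (rule lim_1_over_n)
  have "(\<lambda>p. 1 / real p + (1 - 1 / real p) * mean p x - (f x)\<^sup>2) \<longlonglongrightarrow> 0 + (1 - 0) * (f x)\<^sup>2 - (f x)\<^sup>2"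
    by (intro tendsto_intros inv_p mean_tendsto Mats_Mlim[OF x])
  then have "(f (\<lambda>i j. x i j + y i j) - f x * f y)\<^sup>2 \<le> 0 + (1 - 0) * (f x)\<^sup>2 - (f x)\<^sup>2"
    by (rule LIMSEQ_le_const) (use bound in blast)
  then show ?thesis by simp
qed

end

section \<open>Exponential form of the kernel\<close>

text \<open>Cyclicity of the real trace turns \<open>Re tr (x\<^sup>* x b)\<close> into a sum of \<open>v b v\<^sup>*\<close> over the rows \<open>v\<close> of \<open>x\<close>.\<close>

lemma herm_inner_gram:
  fixes b :: "'a::conj_div_algebra inf_mat"
  assumes x: "x \<in> Mats n q"
  shows "herm_inner q (mat_times (mat_star x) x) b
    = (\<Sum>k<n. repart (\<Sum>i<q. \<Sum>j<q. x k i * b i j * conjg (x k j)))"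
proof -
  have g: "mat_times (mat_star x) x i j = (\<Sum>k<n. conjg (x k i) * x k j)" for i j
    using mat_times_eq_sum_right[of "{..<n}" x j "mat_star x" i] MatsD[OF x] by (simp add: mat_star_def)
  have g0: "mat_times (mat_star x) x i j = 0" if "q \<le> j" for i j
    using MatsD[OF x, of _ j] that by (simp add: g)
  have "mat_times (mat_times (mat_star x) x) b i i = (\<Sum>j<q. \<Sum>k<n. conjg (x k i) * x k j * b j i)" for i
    using mat_times_eq_sum_left[of "{..<q}" "mat_times (mat_star x) x" i b i] g0 by (simp add: g sum_distrib_right)
  then have "herm_inner q (mat_times (mat_star x) x) b = (\<Sum>i<q. \<Sum>j<q. \<Sum>k<n. repart (conjg (x k i) * x k j * b j i))"
    by (simp add: herm_inner_def repart_sum)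
  also have "\<dots> = (\<Sum>i<q. \<Sum>j<q. \<Sum>k<n. repart (x k j * b j i * conjg (x k i)))"
  proof (intro sum.cong refl)
    show "repart (conjg (x k i) * x k j * b j i) = repart (x k j * b j i * conjg (x k i))" for i j k
      using repart_mult_commute[of "conjg (x k i)" "x k j * b j i"] by (simp add: mult.assoc)
  qed
  also have "\<dots> = (\<Sum>i<q. \<Sum>k<n. \<Sum>j<q. repart (x k j * b j i * conjg (x k i)))"
    by (intro sum.cong refl sum.swap)
  also have "\<dots> = (\<Sum>k<n. \<Sum>i<q. \<Sum>j<q. repart (x k j * b j i * conjg (x k i)))"
    by (rule sum.swap)
  also have "\<dots> = (\<Sum>k<n. \<Sum>j<q. \<Sum>i<q. repart (x k j * b j i * conjg (x k i)))"
    by (intro sum.cong refl sum.swap)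
  finally show ?thesis by (simp add: repart_sum)
qed

context spherical_kernel
begin

definition row :: "(nat \<Rightarrow> 'a) \<Rightarrow> 'a inf_mat" where
  "row v = (\<lambda>i j. if i = 0 \<and> j < q then v j else 0)"

text \<open>The argument may be any sequence. Its entries from \<open>q\<close> on are ignored, so that rows form a vector space without side
conditions.\<close>

definition h :: "(nat \<Rightarrow> 'a) \<Rightarrow> real" where
  "h v = f (row v)"

lemma row_Mats: "row v \<in> Mats 1 q"
  by (auto simp: row_def Mats_def)

lemma row_Mlim: "row v \<in> Mlim q"
  by (rule Mats_Mlim[OF row_Mats])

lemma h_trunc: "h (\<lambda>j. if j < q then v j else 0) = h v"
proof -
  have "row (\<lambda>j. if j < q then v j else 0) = row v" by (auto simp: row_def fun_eq_iff)
  then show ?thesis by (simp add: h_def)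
qed

lemma f_eq_prod: "x \<in> Mats n q \<Longrightarrow> f x = (\<Prod>k<n. h (x k))"
proof (induction n arbitrary: x)
  case 0
  then have "x = (\<lambda>i j. 0)" by (auto simp: Mats_def fun_eq_iff)
  then show ?case by (simp add: zero)
next
  case (Suc n)
  define x' where "x' = (\<lambda>i j. if i < n then x i j else 0)"
  define y where "y = (\<lambda>i j. if i = n then x i j else 0)"
  have x': "x' \<in> Mats n q" using Suc.prems by (auto simp: x'_def Mats_def)
  have y: "y \<in> Mats (Suc n) q" using Suc.prems by (auto simp: y_def Mats_def)
  have "x i j = x' i j + y i j" for i j
    using MatsD[OF Suc.prems, of i j] by (auto simp: x'_def y_def)
  then have "x = (\<lambda>i j. x' i j + y i j)" by (intro ext)
  then have "f x = f x' * f y"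
    using mult_disjoint_rows[OF x' Mats_Mlim[OF y]] by (simp add: y_def)
  moreover have "f x' = (\<Prod>k<n. h (x k))"
  proof -
    have "x' k = x k" if "k < n" for k using that by (auto simp: x'_def)
    then show ?thesis using Suc.IH[OF x'] by simp
  qed
  moreover have "f y = h (x n)"
  proof -
    let ?t = "Transposition.transpose 0 n"
    have t: "?t permutes {..<Suc n}" by (rule permutes_swap_id) auto
    have "y = mat_times (perm_mat ?t) (row (x n))"
      using MatsD[OF Suc.prems, of n]
      by (auto simp: y_def mat_times_perm row_def fun_eq_iff Transposition.transpose_def not_less)
    then show ?thesis
      using invariant[OF perm_Unitaries[OF t] row_Mlim, of "x n"] by (simp add: h_def)
  qed
  ultimately show ?case by simp
qed

definition row2 :: "(nat \<Rightarrow> 'a) \<Rightarrow> (nat \<Rightarrow> 'a) \<Rightarrow> 'a inf_mat" where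
  "row2 v w = (\<lambda>i j. if j < q then if i = 0 then v j else if i = 1 then w j else 0 else 0)"

lemma row2_Mats: "row2 v w \<in> Mats 2 q"
  by (auto simp: row2_def Mats_def)

lemma f_row2: "f (row2 v w) = h v * h w"
proof -
  have "{..<2::nat} = {0, 1}" by auto
  then have "f (row2 v w) = h (row2 v w 0) * h (row2 v w 1)" using f_eq_prod[OF row2_Mats, of v w] by simp
  also have "row2 v w 0 = (\<lambda>j. if j < q then v j else 0)" by (rule ext) (simp add: row2_def)
  also have "row2 v w 1 = (\<lambda>j. if j < q then w j else 0)" by (rule ext) (simp add: row2_def)
  finally show ?thesis by (simp only: h_trunc)
qed

text \<open>The two rows \<open>v\<close> and \<open>w\<close> are rotated into each other by a unitary \<open>2 \<times> 2\<close> matrix.\<close>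

lemma h_rotation:
  assumes "c\<^sup>2 + s\<^sup>2 = 1"
  shows "h (\<lambda>j. c *\<^sub>R v j - s *\<^sub>R w j) * h (\<lambda>j. s *\<^sub>R v j + c *\<^sub>R w j) = h v * h w"
proof -
  note u = rot_Unitaries[OF assms, where 'a='a]
  have two: "{..<2::nat} = {0, 1}" by auto
  have "mat_times (rot_mat c s) (row2 v w) i j = row2 (\<lambda>j. c *\<^sub>R v j - s *\<^sub>R w j) (\<lambda>j. s *\<^sub>R v j + c *\<^sub>R w j) i j" for i j
  proof (cases "i = 0 \<or> i = 1")
    case True
    then show ?thesis unfolding Unitaries_times[OF u] two by (auto simp: rot_mat_def row2_def)
  next
    case False
    then show ?thesis unfolding Unitaries_times[OF u] by (simp add: row2_def)
  qed
  then have "mat_times (rot_mat c s) (row2 v w) = row2 (\<lambda>j. c *\<^sub>R v j - s *\<^sub>R w j) (\<lambda>j. s *\<^sub>R v j + c *\<^sub>R w j)"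
    by (intro ext)
  then show ?thesis using invariant[OF u Mats_Mlim[OF row2_Mats], of v w] by (simp add: f_row2)
qed

lemma h_zero: "h (\<lambda>j. 0) = 1"
proof -
  have "row (\<lambda>j. 0) = (\<lambda>i j. 0)" by (auto simp: row_def fun_eq_iff)
  then show ?thesis by (simp add: h_def zero)
qed

lemma h_split: "c\<^sup>2 + s\<^sup>2 = 1 \<Longrightarrow> h v = h (\<lambda>j. c *\<^sub>R v j) * h (\<lambda>j. s *\<^sub>R v j)"
  using h_rotation[of c s v "\<lambda>j. 0"] by (simp add: h_zero)

lemma h_le_1: "h v \<le> 1"
  unfolding h_def by (rule le_1[OF row_Mlim])

text \<open>As \<open>h v\<close> is the square of \<open>h (v / \<surd>2)\<close>, a zero at \<open>v\<close> would give zeros tending to the origin, where \<open>h\<close> is \<open>1\<close>.\<close>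

lemma h_pos: "0 < h v"
proof -
  define r where "r = 1 / sqrt 2"
  have r: "r\<^sup>2 + r\<^sup>2 = 1" by (simp add: r_def power_divide)
  have sq: "h v = (h (\<lambda>j. r *\<^sub>R v j))\<^sup>2" for v using h_split[OF r, of v] by (simp add: power2_eq_square)
  have "h v \<noteq> 0"
  proof
    assume h0: "h v = 0"
    have zero: "h (\<lambda>j. (r ^ n) *\<^sub>R v j) = 0" for n
    proof (induction n)
      case (Suc n)
      then show ?case using sq[of "\<lambda>j. (r ^ n) *\<^sub>R v j"] by simp
    qed (simp add: h0)
    have "continuous_on UNIV (\<lambda>t. f (row (\<lambda>j. t *\<^sub>R v j)))"
    proof (rule continuous_on_compose2[OF continuous[of 1]])
      have "continuous_on UNIV (\<lambda>t. if i = 0 \<and> j < q then t *\<^sub>R v j else 0)" for i j :: nat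
        by (cases "i = 0 \<and> j < q") (auto intro!: continuous_intros)
      then show "continuous_on UNIV (\<lambda>t. row (\<lambda>j. t *\<^sub>R v j))"
        unfolding row_def by (rule continuous_on_matI)
    qed (use row_Mats in auto)
    then have "isCont (\<lambda>t. h (\<lambda>j. t *\<^sub>R v j)) 0"
      by (simp add: h_def continuous_on_eq_continuous_at)
    moreover have "(\<lambda>n. r ^ n) \<longlonglongrightarrow> 0"
      by (rule LIMSEQ_realpow_zero) (simp_all add: r_def)
    ultimately have "(\<lambda>n. h (\<lambda>j. (r ^ n) *\<^sub>R v j)) \<longlonglongrightarrow> h (\<lambda>j. 0 *\<^sub>R v j)"
      by (rule isCont_tendsto_compose)
    then have "h (\<lambda>j. 0 *\<^sub>R v j) = 0" unfolding zero by (simp add: LIMSEQ_const_iff)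
    then show False using h_zero by simp
  qed
  then show ?thesis using sq[of v] by (simp add: less_le)
qed

lemma h_unit: "norm c = 1 \<Longrightarrow> h (\<lambda>j. c * v j) = h v"
proof -
  assume c: "norm c = 1"
  have "row (\<lambda>j. c * v j) = mat_times (scal_mat 1 c) (row v)"
    by (auto simp: mat_times_scal row_def fun_eq_iff)
  then show ?thesis using invariant[OF scal_Unitaries[OF c] row_Mlim] by (simp add: h_def)
qed

text \<open>For \<open>l = - ln h\<close>, rotation by 45 degrees of the rows \<open>\<surd>2 v\<close> and \<open>\<surd>2 w\<close> and \<open>l (\<surd>2 v) = 2 l v\<close> give the parallelogram law, and splitting \<open>v\<close> into
\<open>t v\<close> and \<open>\<surd>(1 - t\<^sup>2) v\<close> bounds \<open>l (t v)\<close> by \<open>l v\<close>.\<close>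

lemma exponential_form:
  "\<exists>b\<in>PSD q. \<forall>n. \<forall>x\<in>Mats n q. f x = exp (- herm_inner q (mat_times (mat_star x) x) b)"
proof -
  define l where "l v = - ln (h v)" for v
  have h: "h v = exp (- l v)" for v using h_pos[of v] by (simp add: l_def)
  have l_rot: "l (\<lambda>j. c *\<^sub>R v j - s *\<^sub>R w j) + l (\<lambda>j. s *\<^sub>R v j + c *\<^sub>R w j) = l v + l w" if "c\<^sup>2 + s\<^sup>2 = 1" for c s v w
    using h_rotation[OF that, of v w] unfolding h exp_add[symmetric] by simp
  have l0: "l (\<lambda>j. 0) = 0" by (simp add: l_def h_zero)
  have nonneg: "0 \<le> l v" for v using h_le_1[of v] h_pos[of v] by (simp add: l_def)
  define r where "r = 1 / sqrt 2"
  have r: "r\<^sup>2 + r\<^sup>2 = 1" by (simp add: r_def power_divide)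
  have rs: "r *\<^sub>R (sqrt 2 *\<^sub>R x) = x" for x :: 'a by (simp add: r_def)
  have l_sqrt2: "l (\<lambda>j. sqrt 2 *\<^sub>R v j) = 2 * l v" for v
    using l_rot[OF r, of "\<lambda>j. sqrt 2 *\<^sub>R v j" "\<lambda>j. 0"] l0 by (simp only: rs scaleR_zero_right diff_zero add_0_right)
  have "\<exists>b\<in>PSD q. \<forall>v. l v = repart (\<Sum>i<q. \<Sum>j<q. v i * b i j * conjg (v j))"
  proof (rule hermitian_form_of_parallelogram)
    fix v w :: "nat \<Rightarrow> 'a"
    show "0 \<le> l v" by (rule nonneg)
    show "l (\<lambda>i. v i + w i) + l (\<lambda>i. v i - w i) = 2 * l v + 2 * l w"
      using l_rot[OF r, of "\<lambda>j. sqrt 2 *\<^sub>R v j" "\<lambda>j. sqrt 2 *\<^sub>R w j"] l_sqrt2[of v] l_sqrt2[of w] by (simp only: rs)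
    show "l (\<lambda>i. c * v i) = l v" if "norm c = 1" for c
      by (simp add: l_def h_unit[OF that])
    show "l (\<lambda>i. t *\<^sub>R v i) \<le> l v" if "\<bar>t\<bar> \<le> 1" for t
    proof -
      have "t\<^sup>2 \<le> 1" using that by (simp add: abs_square_le_1)
      then have ts: "t\<^sup>2 + (sqrt (1 - t\<^sup>2))\<^sup>2 = 1" by simp
      have "l (\<lambda>i. t *\<^sub>R v i) + l (\<lambda>i. sqrt (1 - t\<^sup>2) *\<^sub>R v i) = l v"
        using l_rot[OF ts, of v "\<lambda>j. 0"] l0 by (simp only: scaleR_zero_right diff_zero add_0_right)
      then show ?thesis using nonneg[of "\<lambda>i. sqrt (1 - t\<^sup>2) *\<^sub>R v i"] by linarith
    qed
    show "l v = l (\<lambda>i. if i < q then v i else 0)" by (simp add: l_def h_trunc)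
  qed
  then obtain b where b: "b \<in> PSD q" "\<And>v. l v = repart (\<Sum>i<q. \<Sum>j<q. v i * b i j * conjg (v j))" by blast
  have "f x = exp (- herm_inner q (mat_times (mat_star x) x) b)" if x: "x \<in> Mats n q" for n x
  proof -
    have "f x = (\<Prod>k<n. exp (- l (x k)))" using f_eq_prod[OF x] by (simp add: h)
    also have "\<dots> = exp (- (\<Sum>k<n. l (x k)))" by (simp add: exp_sum sum_negf[symmetric])
    finally show ?thesis by (simp only: herm_inner_gram[OF x] b(2))
  qed
  with b(1) show ?thesis by blast
qed

end

section \<open>From spherical functions to kernels\<close>

lemma mult_grp_lim:
  "g \<otimes>\<^bsub>grp_lim q\<^esub> h = (\<lambda>i j. fst g i j + mat_times (snd g) (fst h) i j, mat_times (snd g) (snd h))"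
  by (simp add: grp_lim_def split_beta')

lemma one_grp_lim: "\<one>\<^bsub>grp_lim q\<^esub> = (\<lambda>i j. 0, mat_id)"
  by (simp add: grp_lim_def)

lemma carrier_grp: "carrier (grp q p) = Mats p q \<times> Unitaries p"
  by (simp add: grp_def)

lemma carrier_grp_lim: "g \<in> carrier (grp_lim q) \<longleftrightarrow> (\<exists>p\<ge>q. fst g \<in> Mats p q \<and> snd g \<in> Unitaries p)"
  by (auto simp: grp_lim_def grp_def mem_Times_iff)

lemma carrier_grp_limI: "x \<in> Mats m q \<Longrightarrow> u \<in> Unitaries n \<Longrightarrow> (x, u) \<in> carrier (grp_lim q)"
  unfolding carrier_grp_lim
  by (rule exI[of _ "max q (max m n)"]) (auto intro: Mats_mono[of m] Unitaries_mono[of n])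

lemma carrier_grp_lim_pair:
  assumes "g \<in> carrier (grp_lim q)" "h \<in> carrier (grp_lim q)"
  obtains p where "q \<le> p" "fst g \<in> Mats p q" "snd g \<in> Unitaries p" "fst h \<in> Mats p q" "snd h \<in> Unitaries p"
proof -
  obtain m where m: "q \<le> m" "fst g \<in> Mats m q" "snd g \<in> Unitaries m" using assms(1) by (auto simp: carrier_grp_lim)
  obtain n where n: "q \<le> n" "fst h \<in> Mats n q" "snd h \<in> Unitaries n" using assms(2) by (auto simp: carrier_grp_lim)
  show thesis
    by (rule that[of "max m n"])
      (use m n in \<open>auto intro: Mats_mono[of m] Mats_mono[of n] Unitaries_mono[of m] Unitaries_mono[of n]\<close>)
qed

lemma mult_closed_grp_lim:
  assumes "g \<in> carrier (grp_lim q)" "h \<in> carrier (grp_lim q)"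
  shows "g \<otimes>\<^bsub>grp_lim q\<^esub> h \<in> carrier (grp_lim q)"
proof -
  obtain p where p: "q \<le> p" "fst g \<in> Mats p q" "snd g \<in> Unitaries p" "fst h \<in> Mats p q" "snd h \<in> Unitaries p"
    by (rule carrier_grp_lim_pair[OF assms])
  show ?thesis
    unfolding mult_grp_lim
    by (rule carrier_grp_limI[OF add_Mats[OF p(2) Unitaries_times_Mats[OF p(3,4) order_refl]] times_Unitaries[OF p(3,5)]])
qed

lemma inverse_closed_grp_lim:
  assumes "g \<in> carrier (grp_lim q)"
  shows "(\<lambda>i j. - mat_times (mat_star (snd g)) (fst g) i j, mat_star (snd g)) \<in> carrier (grp_lim q)"
proof -
  obtain p where p: "q \<le> p" "fst g \<in> Mats p q" "snd g \<in> Unitaries p" using assms by (auto simp: carrier_grp_lim)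
  show ?thesis
    by (rule carrier_grp_limI[OF minus_Mats[OF Unitaries_times_Mats[OF star_Unitaries[OF p(3)] p(2) order_refl]] star_Unitaries[OF p(3)]])
qed

lemma inverse_mult_grp_lim:
  assumes "g \<in> carrier (grp_lim q)"
  shows "(\<lambda>i j. - mat_times (mat_star (snd g)) (fst g) i j, mat_star (snd g)) \<otimes>\<^bsub>grp_lim q\<^esub> g = \<one>\<^bsub>grp_lim q\<^esub>"
  using assms by (auto simp: mult_grp_lim one_grp_lim carrier_grp_lim Unitaries_star_times)

lemma group_grp_lim: "group (grp_lim q)"
proof (rule groupI)
  fix g h k :: "'a mpair"
  assume g: "g \<in> carrier (grp_lim q)"
  show "\<one>\<^bsub>grp_lim q\<^esub> \<otimes>\<^bsub>grp_lim q\<^esub> g = g" by (simp add: mult_grp_lim one_grp_lim)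
  show "\<exists>k\<in>carrier (grp_lim q). k \<otimes>\<^bsub>grp_lim q\<^esub> g = \<one>\<^bsub>grp_lim q\<^esub>"
    using inverse_mult_grp_lim[OF g] inverse_closed_grp_lim[OF g] by blast
  assume h: "h \<in> carrier (grp_lim q)"
  show "g \<otimes>\<^bsub>grp_lim q\<^esub> h \<in> carrier (grp_lim q)" by (rule mult_closed_grp_lim[OF g h])
  have rf: "rowfin (snd g)" "rowfin (snd h)"
    using g h by (auto simp: carrier_grp_lim intro: rowfin_Unitaries)
  show "g \<otimes>\<^bsub>grp_lim q\<^esub> h \<otimes>\<^bsub>grp_lim q\<^esub> k = g \<otimes>\<^bsub>grp_lim q\<^esub> (h \<otimes>\<^bsub>grp_lim q\<^esub> k)"
    by (simp add: mult_grp_lim mat_times_add_right rf mat_times_assoc add.assoc)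
next
  show "\<one>\<^bsub>grp_lim q\<^esub> \<in> carrier (grp_lim q)"
    unfolding one_grp_lim by (rule carrier_grp_limI[of _ 0 _ _ 0]) simp_all
qed

lemma inv_grp_lim:
  assumes "g \<in> carrier (grp_lim q)"
  shows "inv\<^bsub>grp_lim q\<^esub> g = (\<lambda>i j. - mat_times (mat_star (snd g)) (fst g) i j, mat_star (snd g))"
  by (rule group.inv_equality[OF group_grp_lim inverse_mult_grp_lim[OF assms] assms inverse_closed_grp_lim[OF assms]])

lemma Kgrp_Klim: "k \<in> Kgrp p \<Longrightarrow> k \<in> Klim q"
  unfolding Klim_def by (rule UN_I[of "max p q"]) (auto simp: in_Kgrp intro: Unitaries_mono[of p])

lemma Klim_cases: "k \<in> Klim q \<Longrightarrow> \<exists>p. fst k = (\<lambda>i j. 0) \<and> snd k \<in> Unitaries p"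
  by (auto simp: Klim_def in_Kgrp)

lemma carrier_grp_subset: "q \<le> p \<Longrightarrow> carrier (grp q p) \<subseteq> carrier (grp_lim q)"
  by (auto simp: grp_lim_def)

lemma topspace_lim_topology: "topspace (lim_topology q) = carrier (grp_lim q)"
proof
  show "topspace (lim_topology q) \<subseteq> carrier (grp_lim q)"
    using openin_topspace[of "lim_topology q"] unfolding openin_lim_topology by blast
  have "openin (lim_topology q) (carrier (grp_lim q))"
    unfolding openin_lim_topology by (simp add: Int_absorb1 carrier_grp_subset)
  then show "carrier (grp_lim q) \<subseteq> topspace (lim_topology q)" by (rule openin_subset)
qed

text \<open>A preimage in the inductive limit is open exactly if its traces on all the groups \<open>grp q p\<close> are.\<close>

lemma continuous_map_lim_topology:
  "continuous_map (lim_topology q) euclidean \<phi> \<longleftrightarrow> (\<forall>p\<ge>q. continuous_on (carrier (grp q p)) \<phi>)"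
proof -
  have *: "{g \<in> carrier (grp_lim q). \<phi> g \<in> U} \<inter> carrier (grp q p) = carrier (grp q p) \<inter> \<phi> -` U" if "q \<le> p" for p U
    using carrier_grp_subset[OF that] by auto
  show ?thesis
    unfolding continuous_map_def topspace_lim_topology openin_lim_topology continuous_openin_preimage_eq
    by (auto simp: *)
qed

text \<open>The matrix \<open>-1\<close> of size \<open>p\<close> is unitary, so \<open>F\<close> is even, and positive definiteness for two points makes it real and bounded
by \<open>F 0\<close>. The spherical equation at the identity gives \<open>F 0 * F 0 = F 0\<close>, where \<open>F 0\<close> cannot vanish.\<close>

lemma spherical_kernel_of_spherical:
  fixes \<phi> :: "'a::{conj_div_algebra, euclidean_space} mpair \<Rightarrow> complex"
  assumes sph: "olshanski_spherical q \<phi>" and pd: "positive_definite_on (grp_lim q) \<phi>"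
  shows "spherical_kernel q (\<lambda>x. Re (\<phi> (x, mat_id))) \<and> (\<forall>x\<in>Mlim q. \<phi> (x, mat_id) = Re (\<phi> (x, mat_id)))"
proof -
  define F where "F x = \<phi> (x, mat_id)" for x
  have bi: "\<phi> (k \<otimes>\<^bsub>grp_lim q\<^esub> g \<otimes>\<^bsub>grp_lim q\<^esub> l) = \<phi> g"
    if "g \<in> carrier (grp_lim q)" "k \<in> Klim q" "l \<in> Klim q" for g k l
    using sph that unfolding olshanski_spherical_def by blast
  have lim: "(\<lambda>p. LINT k|haarK q p. \<phi> (g \<otimes>\<^bsub>grp_lim q\<^esub> k \<otimes>\<^bsub>grp_lim q\<^esub> h)) \<longlonglongrightarrow> \<phi> g * \<phi> h"
    if "g \<in> carrier (grp_lim q)" "h \<in> carrier (grp_lim q)" for g h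
    using sph that unfolding olshanski_spherical_def by blast
  have cont: "continuous_on (carrier (grp q p)) \<phi>" if "q \<le> p" for p
    using sph that unfolding olshanski_spherical_def continuous_map_lim_topology by blast
  have carr: "(x, mat_id) \<in> carrier (grp_lim q)" if "x \<in> Mlim q" for x :: "'a inf_mat"
    using that by (auto simp: Mlim_def intro: carrier_grp_limI[of _ _ _ _ 0])
  have K: "(\<lambda>i j. 0, u) \<in> Klim q" if "u \<in> Unitaries p" for u :: "'a inf_mat" and p
    by (rule Kgrp_Klim[of _ p]) (simp add: in_Kgrp that)
  have right: "\<phi> (x, u) = F x" if "x \<in> Mlim q" "u \<in> Unitaries p" for x u p
    using bi[OF carr[OF that(1)] K[OF id_Unitaries] K[OF that(2)]] by (simp add: mult_grp_lim F_def)
  have F_inv: "F (mat_times u x) = F x" if u: "u \<in> Unitaries p" and x: "x \<in> Mlim q" for u x p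
  proof -
    obtain n where "x \<in> Mats n q" using x by (auto simp: Mlim_def)
    then have "x \<in> Mats (max n p) q" by (rule Mats_mono[rotated]) simp
    then have "mat_times u x \<in> Mlim q" by (rule Mats_Mlim[OF Unitaries_times_Mats[OF u _ max.cobounded2]])
    from right[OF this u] show ?thesis
      using bi[OF carr[OF x] K[OF u] K[OF id_Unitaries]] by (simp add: mult_grp_lim F_def)
  qed
  have zero_M: "(\<lambda>i j. 0 :: 'a) \<in> Mlim q" by (rule Mats_Mlim[of _ 0]) simp
  have F_pd: "(\<Sum>k<N. \<Sum>l<N. c k * cnj (c l) * F (\<lambda>i j. z k i j - z l i j)) \<in> \<real>\<^sub>\<ge>\<^sub>0"
    if z: "\<And>k. k < N \<Longrightarrow> z k \<in> Mlim q" for N :: nat and c z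
  proof -
    have "(\<Sum>k<N. \<Sum>l<N. c k * cnj (c l) * \<phi> ((z k, mat_id) \<otimes>\<^bsub>grp_lim q\<^esub> inv\<^bsub>grp_lim q\<^esub> (z l, mat_id))) \<in> \<real>\<^sub>\<ge>\<^sub>0"
      by (rule pd[unfolded positive_definite_on_def, rule_format]) (rule carr[OF z])
    moreover have "(z k, mat_id) \<otimes>\<^bsub>grp_lim q\<^esub> inv\<^bsub>grp_lim q\<^esub> (z l, mat_id) = (\<lambda>i j. z k i j - z l i j, mat_id)" if "l < N" for k l
      by (simp add: inv_grp_lim[OF carr[OF z[OF that]]] mult_grp_lim)
    ultimately show ?thesis by (simp add: F_def)
  qed
  have F_even: "F (\<lambda>i j. - x i j) = F x" if x: "x \<in> Mlim q" for x
  proof -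
    obtain p where p: "x \<in> Mats p q" using x by (auto simp: Mlim_def)
    have "mat_times (scal_mat p (-1)) x = (\<lambda>i j. - x i j)"
      using p by (auto simp: mat_times_scal Mats_def fun_eq_iff)
    then show ?thesis using F_inv[OF scal_Unitaries[of "-1" p] x] by simp
  qed
  have F0_nn: "F (\<lambda>i j. 0) \<in> \<real>\<^sub>\<ge>\<^sub>0"
    using F_pd[of 1 "\<lambda>_ _ _. 0" "\<lambda>_. 1"] zero_M by simp
  have two: "{..<2::nat} = {0, 1}" by auto
  have F_pm: "2 * F (\<lambda>i j. 0) + 2 * s * F x \<in> \<real>\<^sub>\<ge>\<^sub>0" if "x \<in> Mlim q" "s = 1 \<or> s = -1" for x s
    using F_pd[of 2 "\<lambda>k. if k = 0 then x else (\<lambda>i j. 0)" "\<lambda>k. if k = 0 then 1 else s"] that zero_M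
    unfolding two by (auto simp: F_even algebra_simps)
  have F_real: "F x = Re (F x)" and F_bound: "\<bar>Re (F x)\<bar> \<le> Re (F (\<lambda>i j. 0))" if x: "x \<in> Mlim q" for x
    using F_pm[OF x, of 1] F_pm[OF x, of "-1"] F0_nn by (auto simp: complex_nonneg_Reals_iff complex_eq_iff)
  have F0: "F (\<lambda>i j. 0) = 1"
  proof -
    obtain g where g: "g \<in> carrier (grp_lim q)" "\<phi> g \<noteq> 0" using sph unfolding olshanski_spherical_def by blast
    have gM: "fst g \<in> Mlim q" and u: "\<exists>p. snd g \<in> Unitaries p"
      using g(1) by (auto simp: carrier_grp_lim intro: Mats_Mlim)
    then have "\<phi> g = F (fst g)" using right[OF gM] by (metis prod.collapse)
    then have "F (\<lambda>i j. 0) \<noteq> 0" using g(2) F_bound[OF gM] F_real[OF gM] by (metis abs_le_zero_iff of_real_0 zero_complex.sel(1))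
    moreover have "F (\<lambda>i j. 0) * F (\<lambda>i j. 0) = F (\<lambda>i j. 0)"
    proof -
      have "(LINT k|haarK q p. \<phi> ((\<lambda>i j. 0, mat_id) \<otimes>\<^bsub>grp_lim q\<^esub> k \<otimes>\<^bsub>grp_lim q\<^esub> (\<lambda>i j. 0, mat_id)))
         = (LINT k|(haarK q p :: 'a mpair measure). F (\<lambda>i j. 0))" for p
      proof (rule Bochner_Integration.integral_cong[OF refl])
        fix k :: "'a mpair" assume "k \<in> space (haarK q p)"
        then have k: "fst k = (\<lambda>i j. 0)" "snd k \<in> Unitaries p" by (auto simp: space_haar in_Kgrp)
        then show "\<phi> ((\<lambda>i j. 0, mat_id) \<otimes>\<^bsub>grp_lim q\<^esub> k \<otimes>\<^bsub>grp_lim q\<^esub> (\<lambda>i j. 0, mat_id)) = F (\<lambda>i j. 0)"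
          using right[OF zero_M k(2)] by (simp add: mult_grp_lim)
      qed
      then have "(LINT k|haarK q p. \<phi> ((\<lambda>i j. 0, mat_id) \<otimes>\<^bsub>grp_lim q\<^esub> k \<otimes>\<^bsub>grp_lim q\<^esub> (\<lambda>i j. 0, mat_id)))
         = F (\<lambda>i j. 0)" for p by (simp add: space_haar)
      then have "(\<lambda>p::nat. F (\<lambda>i j. 0)) \<longlonglongrightarrow> F (\<lambda>i j. 0) * F (\<lambda>i j. 0)"
        using lim[OF carr[OF zero_M] carr[OF zero_M]] by (simp add: F_def)
      then show ?thesis by (simp add: LIMSEQ_const_iff)
    qed
    ultimately show ?thesis by simp
  qed
  have kernel: "spherical_kernel q (\<lambda>x. Re (F x))"
  proof
    show "Re (F (\<lambda>i j. 0)) = 1" by (simp add: F0)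
    show "Re (F (mat_times u x)) = Re (F x)" if "u \<in> Unitaries p" "x \<in> Mlim q" for u p x
      using F_inv[OF that] by simp
    show "0 \<le> (\<Sum>k<N. \<Sum>l<N. c k * c l * Re (F (\<lambda>i j. z k i j - z l i j)))"
      if "\<And>k. k < N \<Longrightarrow> z k \<in> Mlim q" for N :: nat and z c
    proof -
      have "(\<Sum>k<N. \<Sum>l<N. complex_of_real (c k) * cnj (complex_of_real (c l)) * F (\<lambda>i j. z k i j - z l i j)) \<in> \<real>\<^sub>\<ge>\<^sub>0"
        by (rule F_pd[OF that])
      then have "0 \<le> Re (\<Sum>k<N. \<Sum>l<N. complex_of_real (c k) * cnj (complex_of_real (c l)) * F (\<lambda>i j. z k i j - z l i j))"
        by (simp add: complex_nonneg_Reals_iff)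
      then show ?thesis by simp
    qed
    show "continuous_on (Mats p q) (\<lambda>x. Re (F x))" for p
    proof -
      have "continuous_on (Mats p q) (\<lambda>x. \<phi> (x, mat_id))"
      proof (rule continuous_on_compose2[OF cont[of "max p q"]])
        show "continuous_on (Mats p q) (\<lambda>x :: 'a inf_mat. (x, mat_id :: 'a inf_mat))"
          by (intro continuous_on_Pair continuous_on_id continuous_on_const)
      qed (auto simp: carrier_grp intro: Mats_mono[of p])
      then show ?thesis unfolding F_def by (rule continuous_on_Re)
    qed
    show "(\<lambda>p. LINT k|haarK q p. Re (F (\<lambda>i j. x i j + mat_times (snd k) y i j))) \<longlonglongrightarrow> Re (F x) * Re (F y)"
      if x: "x \<in> Mlim q" and y: "y \<in> Mlim q" for x y
    proof -
      have "(LINT k|haarK q p. \<phi> ((x, mat_id) \<otimes>\<^bsub>grp_lim q\<^esub> k \<otimes>\<^bsub>grp_lim q\<^esub> (y, mat_id)))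
        = (LINT k|haarK q p. complex_of_real (Re (F (\<lambda>i j. x i j + mat_times (snd k) y i j))))" for p
      proof (rule Bochner_Integration.integral_cong[OF refl])
        fix k :: "'a mpair" assume "k \<in> space (haarK q p)"
        then have k: "fst k = (\<lambda>i j. 0)" "snd k \<in> Unitaries p" by (auto simp: space_haar in_Kgrp)
        obtain m n where mn: "x \<in> Mats m q" "y \<in> Mats n q" using x y by (auto simp: Mlim_def)
        have M: "(\<lambda>i j. x i j + mat_times (snd k) y i j) \<in> Mats (max p (max m n)) q"
          by (intro add_Mats Mats_mono[OF _ mn(1)] Unitaries_times_Mats[OF k(2)] Mats_mono[OF _ mn(2)]) auto
        have "\<phi> ((x, mat_id) \<otimes>\<^bsub>grp_lim q\<^esub> k \<otimes>\<^bsub>grp_lim q\<^esub> (y, mat_id)) = F (\<lambda>i j. x i j + mat_times (snd k) y i j)"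
          using right[OF Mats_Mlim[OF M] k(2)] k(1) by (simp add: mult_grp_lim)
        then show "\<phi> ((x, mat_id) \<otimes>\<^bsub>grp_lim q\<^esub> k \<otimes>\<^bsub>grp_lim q\<^esub> (y, mat_id))
          = complex_of_real (Re (F (\<lambda>i j. x i j + mat_times (snd k) y i j)))"
          using F_real[OF Mats_Mlim[OF M]] by simp
      qed
      then have "(\<lambda>p. complex_of_real (LINT k|haarK q p. Re (F (\<lambda>i j. x i j + mat_times (snd k) y i j))))
         \<longlonglongrightarrow> \<phi> (x, mat_id) * \<phi> (y, mat_id)"
        using lim[OF carr[OF x] carr[OF y]] by simp
      also have "\<phi> (x, mat_id) * \<phi> (y, mat_id) = complex_of_real (Re (F x) * Re (F y))"
        using F_real[OF x] F_real[OF y] by (simp add: F_def)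
      finally show ?thesis by (simp only: tendsto_of_real_iff)
    qed
  qed
  then show ?thesis using F_real by (simp add: F_def)
qed

theorem spherical_imp_psi:
  fixes \<phi> :: "'a::{conj_div_algebra, euclidean_space} mpair \<Rightarrow> complex"
  assumes sph: "olshanski_spherical q \<phi>" and pd: "positive_definite_on (grp_lim q) \<phi>"
  shows "\<exists>b\<in>PSD q. \<forall>a\<in>PSD q. \<phi> (grp_elem a) = psi q b a"
proof -
  from spherical_kernel_of_spherical[OF assms]
  interpret spherical_kernel q "\<lambda>x. Re (\<phi> (x, mat_id))" by blast
  have real: "\<forall>x\<in>Mlim q. \<phi> (x, mat_id) = Re (\<phi> (x, mat_id))"
    using spherical_kernel_of_spherical[OF assms] by blast
  obtain b where b: "b \<in> PSD q"
    "\<forall>n. \<forall>x\<in>Mats n q. Re (\<phi> (x, mat_id)) = exp (- herm_inner q (mat_times (mat_star x) x) b)"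
    using exponential_form by blast
  have "\<phi> (grp_elem a) = psi q b a" if "a \<in> PSD q" for a
  proof -
    have a: "a \<in> Mats q q" "mat_star a = a" using that by (auto simp: PSD_def Hermitians_def)
    have "\<phi> (grp_elem a) = complex_of_real (Re (\<phi> (a, mat_id)))"
      using real Mats_Mlim[OF a(1)] by (simp add: grp_elem_def)
    also have "Re (\<phi> (a, mat_id)) = exp (- herm_inner q (mat_times (mat_star a) a) b)" using b(2) a(1) by blast
    finally show ?thesis by (simp add: psi_def a(2))
  qed
  with b(1) show ?thesis by blast
qed

section \<open>Exponentials of positive semidefinite kernels\<close>

text \<open>Symmetric elimination of the last index. If the pivot \<open>d\<close> is \<open>0\<close>, its row vanishes; otherwise the
Schur complement \<open>C\<close> is again positive semidefinite.\<close>

lemma posdef_imp_gram: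
  fixes B :: "nat \<Rightarrow> nat \<Rightarrow> real"
  assumes "\<And>k l. k < N \<Longrightarrow> l < N \<Longrightarrow> B k l = B l k"
    and "\<And>c. 0 \<le> (\<Sum>k<N. \<Sum>l<N. c k * c l * B k l)"
  shows "\<exists>m a. \<forall>k<N. \<forall>l<N. B k l = (\<Sum>e<m::nat. a e k * a e l)"
  using assms
proof (induction N arbitrary: B)
  case (Suc N)
  define d where "d = B N N"
  have sym: "B N k = B k N" if "k < N" for k using Suc.prems(1)[of N k] that by simp
  have expand: "(\<Sum>k<Suc N. \<Sum>l<Suc N. c k * c l * B k l)
      = (\<Sum>k<N. \<Sum>l<N. c k * c l * B k l) + 2 * c N * (\<Sum>k<N. c k * B k N) + (c N)\<^sup>2 * d" for c
  proof -
    have "(\<Sum>l<N. c N * c l * B N l) = c N * (\<Sum>l<N. c l * B l N)"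
      unfolding sum_distrib_left by (intro sum.cong refl) (simp add: sym)
    moreover have "(\<Sum>k<N. c k * c N * B k N) = c N * (\<Sum>l<N. c l * B l N)"
      unfolding sum_distrib_left by (intro sum.cong refl) simp
    ultimately show ?thesis by (simp add: sum.distrib d_def power2_eq_square)
  qed
  have pos: "0 \<le> (\<Sum>k<N. \<Sum>l<N. c k * c l * B k l) + 2 * t * (\<Sum>k<N. c k * B k N) + t\<^sup>2 * d" for c t
    using Suc.prems(2)[of "c(N := t)"] unfolding expand by simp
  have d0: "0 \<le> d" using pos[of "\<lambda>_. 0" 1] by simp
  show ?case
  proof (cases "d = 0")
    case True
    have BN: "B k N = 0" if k: "k < N" for k
    proof (rule ccontr)
      assume nz: "B k N \<noteq> 0"
      define c where "c l = (if l = k then 1 else 0 :: real)" for l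
      have 1: "(\<Sum>j<N. c j * B j N) = B k N"
        using k by (simp add: c_def if_distrib[of "\<lambda>x. x * _"] cong: if_cong)
      have "0 \<le> (\<Sum>i<N. \<Sum>l<N. c i * c l * B i l) + 2 * t * B k N" for t
        using pos[of c t] True unfolding 1 by simp
      \<comment> \<open>a nonconstant affine function of \<open>t\<close> takes the value \<open>-1\<close>\<close>
      from this[of "- ((\<Sum>i<N. \<Sum>l<N. c i * c l * B i l) + 1) / (2 * B k N)"] nz
      show False by (simp add: field_simps)
    qed
    have "\<exists>m a. \<forall>k<N. \<forall>l<N. B k l = (\<Sum>e<m::nat. a e k * a e l)"
    proof (rule Suc.IH)
      show "B k l = B l k" if "k < N" "l < N" for k l using Suc.prems(1)[of k l] that by simp
      show "0 \<le> (\<Sum>k<N. \<Sum>l<N. c k * c l * B k l)" for c using pos[of c 0] by simp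
    qed
    then obtain m a where a: "\<forall>k<N. \<forall>l<N. B k l = (\<Sum>e<m::nat. a e k * a e l)" by (elim exE)
    have "B k l = (\<Sum>e<m. (if k < N then a e k else 0) * (if l < N then a e l else 0))" if "k < Suc N" "l < Suc N" for k l
    proof (cases "k < N \<and> l < N")
      case True
      then show ?thesis using a by simp
    next
      case False
      then have "k = N \<or> l = N" using that by auto
      moreover have "B k l = 0" using False that BN sym True by (auto simp: less_Suc_eq d_def)
      ultimately show ?thesis by auto
    qed
    then show ?thesis by (intro exI[of _ m] exI[of _ "\<lambda>e k. if k < N then a e k else 0"]) blast
  next
    case False
    then have d: "0 < d" using d0 by simp
    define C where "C k l = B k l - B k N * B l N / d" for k l
    have C_pos: "0 \<le> (\<Sum>k<N. \<Sum>l<N. c k * c l * C k l)" for c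
    proof -
      define S where "S = (\<Sum>k<N. c k * B k N)"
      have "(\<Sum>k<N. \<Sum>l<N. c k * c l * C k l) = (\<Sum>k<N. \<Sum>l<N. c k * c l * B k l) - (\<Sum>k<N. \<Sum>l<N. (c k * B k N) * (c l * B l N)) / d"
        by (simp add: C_def right_diff_distrib sum_subtractf sum_divide_distrib mult_ac)
      also have "(\<Sum>k<N. \<Sum>l<N. (c k * B k N) * (c l * B l N)) = S * S" by (simp add: S_def sum_product)
      finally have "(\<Sum>k<N. \<Sum>l<N. c k * c l * C k l) = (\<Sum>k<N. \<Sum>l<N. c k * c l * B k l) - S * S / d" .
      moreover have "2 * (- S / d) * S + (- S / d)\<^sup>2 * d = - (S * S / d)"
        using d by (simp add: power2_eq_square field_simps)
      ultimately show ?thesis using pos[of c "- S / d"] unfolding S_def[symmetric] by linarith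
    qed
    have C_sym: "C k l = C l k" if "k < N" "l < N" for k l
      using Suc.prems(1)[of k l] that by (simp add: C_def mult.commute)
    have "\<exists>m a. \<forall>k<N. \<forall>l<N. C k l = (\<Sum>e<m::nat. a e k * a e l)"
      by (rule Suc.IH[OF C_sym C_pos])
    then obtain m a where a: "\<forall>k<N. \<forall>l<N. C k l = (\<Sum>e<m::nat. a e k * a e l)" by (elim exE)
    define a' where "a' e k = (if e < m then (if k < N then a e k else 0) else B k N / sqrt d)" for e k
    have sq: "B k N / sqrt d * (B l N / sqrt d) = B k N * B l N / d" for k l
      using d by (simp add: times_divide_times_eq)
    have "B k l = (\<Sum>e<Suc m. a' e k * a' e l)" if "k < Suc N" "l < Suc N" for k l
    proof -
      have s: "(\<Sum>e<Suc m. a' e k * a' e l) = (\<Sum>e<m. (if k < N then a e k else 0) * (if l < N then a e l else 0)) + B k N * B l N / d"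
        using sq[of k l] by (simp add: a'_def)
      show ?thesis
      proof (cases "k < N \<and> l < N")
        case True
        then have "(\<Sum>e<m. (if k < N then a e k else 0) * (if l < N then a e l else 0)) = C k l" using a by simp
        then show ?thesis unfolding s by (simp add: C_def)
      next
        case False
        then have kl: "k = N \<or> l = N" using that by auto
        then have "(\<Sum>e<m. (if k < N then a e k else 0) * (if l < N then a e l else 0)) = 0" by auto
        moreover have "B k N * B l N / d = B k l"
          using kl d that sym[of k] sym[of l] by (auto simp: d_def less_Suc_eq)
        ultimately show ?thesis unfolding s by simp
      qed
    qed
    then show ?thesis by blast
  qed
qed simp

text \<open>Multiplying a positive semidefinite kernel by \<open>a k * a l\<close> only rescales the weights. Hence products with a Gram kernel,
and then all powers of \<open>B\<close>, stay positive semidefinite, and the exponential series concludes.\<close>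

lemma exp_posdef:
  fixes B :: "nat \<Rightarrow> nat \<Rightarrow> real"
  assumes sym: "\<And>k l. k < N \<Longrightarrow> l < N \<Longrightarrow> B k l = B l k"
    and pos: "\<And>c. 0 \<le> (\<Sum>k<N. \<Sum>l<N. c k * c l * B k l)"
  shows "0 \<le> (\<Sum>k<N. \<Sum>l<N. c k * c l * exp (B k l))"
proof -
  have "\<exists>m a. \<forall>k<N. \<forall>l<N. B k l = (\<Sum>e<m::nat. a e k * a e l)"
  proof (rule posdef_imp_gram)
    show "B k l = B l k" if "k < N" "l < N" for k l by (rule sym[OF that])
  qed (rule pos)
  then obtain m a where a: "\<forall>k<N. \<forall>l<N. B k l = (\<Sum>e<m::nat. a e k * a e l)" by (elim exE)
  have power: "0 \<le> (\<Sum>k<N. \<Sum>l<N. c k * c l * B k l ^ n)" for n c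
  proof (induction n arbitrary: c)
    case 0
    have "(\<Sum>k<N. \<Sum>l<N. c k * c l) = (\<Sum>k<N. c k) * (\<Sum>k<N. c k)" by (simp add: sum_product)
    then show ?case by simp
  next
    case (Suc n)
    have "(\<Sum>k<N. \<Sum>l<N. c k * c l * B k l ^ Suc n) = (\<Sum>k<N. \<Sum>l<N. \<Sum>e<m. (c k * a e k) * (c l * a e l) * B k l ^ n)"
      using a by (intro sum.cong refl) (simp add: sum_distrib_left sum_distrib_right mult_ac)
    also have "\<dots> = (\<Sum>k<N. \<Sum>e<m. \<Sum>l<N. (c k * a e k) * (c l * a e l) * B k l ^ n)"
      by (intro sum.cong refl sum.swap)
    also have "\<dots> = (\<Sum>e<m. \<Sum>k<N. \<Sum>l<N. (c k * a e k) * (c l * a e l) * B k l ^ n)"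
      by (rule sum.swap)
    also have "0 \<le> \<dots>" by (intro sum_nonneg Suc.IH)
    finally show ?case .
  qed
  have "(\<lambda>n. \<Sum>k<N. \<Sum>l<N. c k * c l * (B k l ^ n /\<^sub>R fact n)) sums (\<Sum>k<N. \<Sum>l<N. c k * c l * exp (B k l))"
    by (intro sums_sum sums_mult exp_converges)
  moreover have "0 \<le> (\<Sum>k<N. \<Sum>l<N. c k * c l * (B k l ^ n /\<^sub>R fact n))" for n
  proof -
    have "(\<Sum>k<N. \<Sum>l<N. c k * c l * (B k l ^ n /\<^sub>R fact n)) = inverse (fact n) * (\<Sum>k<N. \<Sum>l<N. c k * c l * B k l ^ n)"
      by (simp add: sum_distrib_left mult_ac)
    then show ?thesis using power by simp
  qed
  ultimately show ?thesis by (rule sums_le[OF _ sums_zero, rotated]) 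
qed

lemma complex_posdef_of_real:
  fixes K :: "nat \<Rightarrow> nat \<Rightarrow> real"
  assumes sym: "\<And>k l. k < N \<Longrightarrow> l < N \<Longrightarrow> K k l = K l k"
    and pos: "\<And>c. 0 \<le> (\<Sum>k<N. \<Sum>l<N. c k * c l * K k l)"
  shows "(\<Sum>k<N. \<Sum>l<N. c k * cnj (c l) * complex_of_real (K k l)) \<in> \<real>\<^sub>\<ge>\<^sub>0"
proof -
  let ?s = "\<Sum>k<N. \<Sum>l<N. c k * cnj (c l) * complex_of_real (K k l)"
  have "Re ?s = (\<Sum>k<N. \<Sum>l<N. Re (c k) * Re (c l) * K k l) + (\<Sum>k<N. \<Sum>l<N. Im (c k) * Im (c l) * K k l)"
    by (simp add: sum.distrib[symmetric] algebra_simps)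
  then have re: "0 \<le> Re ?s" using pos[of "\<lambda>k. Re (c k)"] pos[of "\<lambda>k. Im (c k)"] by simp
  have "cnj ?s = (\<Sum>k<N. \<Sum>l<N. c l * cnj (c k) * complex_of_real (K k l))"
    by (simp add: mult_ac)
  also have "\<dots> = (\<Sum>l<N. \<Sum>k<N. c l * cnj (c k) * complex_of_real (K k l))" by (rule sum.swap)
  also have "\<dots> = ?s" by (intro sum.cong refl) (simp add: sym)
  finally have "cnj ?s = ?s" .
  moreover have "Im w = 0" if "cnj w = w" for w using that by (simp add: complex_eq_iff)
  ultimately have "Im ?s = 0" by blast
  with re show ?thesis by (simp add: complex_nonneg_Reals_iff)
qed

section \<open>The exponential functions are spherical and positive definite\<close>

text \<open>The polarization \<open>Re tr (x b y\<^sup>*)\<close> of \<open>gram_form\<close> on matrices whose rows from \<open>n\<close> on vanish.\<close>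

definition row_form :: "nat \<Rightarrow> 'a::conj_div_algebra inf_mat \<Rightarrow> nat \<Rightarrow> 'a inf_mat \<Rightarrow> 'a inf_mat \<Rightarrow> real" where
  "row_form q b n x y = (\<Sum>k<n. \<Sum>i<q. \<Sum>j<q. repart (x k i * b i j * conjg (y k j)))"

definition gram_form :: "nat \<Rightarrow> 'a::conj_div_algebra inf_mat \<Rightarrow> 'a inf_mat \<Rightarrow> real" where
  "gram_form q b x = herm_inner q (mat_times (mat_star x) x) b"

lemma gram_form_eq: "x \<in> Mats n q \<Longrightarrow> gram_form q b x = row_form q b n x x"
  by (simp add: gram_form_def herm_inner_gram row_form_def repart_sum)

lemma gram_form_unitary:
  assumes u: "u \<in> Unitaries p" and x: "x \<in> Mats n q"
  shows "gram_form q b (mat_times u x) = gram_form q b x"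
proof -
  have "mat_star x \<in> Mats q n" using x by (auto simp: mat_star_def Mats_def)
  then have rf: "rowfin (mat_star x)" by (rule rowfin_Mats)
  note ru = rowfin_Unitaries[OF u] rowfin_Unitaries[OF star_Unitaries[OF u]]
  have "mat_times (mat_star (mat_times u x)) (mat_times u x) = mat_times (mat_star x) (mat_times (mat_times (mat_star u) u) x)"
    by (simp only: mat_star_times mat_times_assoc rf ru rowfin_mat_times)
  then show ?thesis by (simp add: gram_form_def Unitaries_star_times[OF u])
qed

lemma row_form_add_left: "row_form q b n (\<lambda>i j. x i j + y i j) z = row_form q b n x z + row_form q b n y z"
  by (simp add: row_form_def distrib_right repart_add sum.distrib)

lemma row_form_scaleR_left: "row_form q b n (\<lambda>i j. t *\<^sub>R x i j) z = t * row_form q b n x z"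
  by (simp add: row_form_def sum_distrib_left)

lemma row_form_commute:
  assumes b: "mat_star b = b"
  shows "row_form q b n x y = row_form q b n y x"
proof -
  have "repart (x k i * b i j * conjg (y k j)) = repart (y k j * b j i * conjg (x k i))" for k i j
  proof -
    have "conjg (b i j) = b j i" using fun_cong[OF fun_cong[OF b], of j i] by (simp add: mat_star_def)
    then show ?thesis
      using repart_conjg[of "x k i * b i j * conjg (y k j)"] by (simp add: conjg_mult conjg_conjg mult.assoc)
  qed
  then have "row_form q b n x y = (\<Sum>k<n. \<Sum>i<q. \<Sum>j<q. repart (y k j * b j i * conjg (x k i)))"
    by (simp add: row_form_def)
  also have "\<dots> = row_form q b n y x" unfolding row_form_def by (intro sum.cong refl sum.swap)
  finally show ?thesis .
qed

lemma row_form_nonneg: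
  assumes b: "b \<in> PSD q"
  shows "0 \<le> row_form q b n x x"
proof -
  have "\<forall>v. 0 \<le> repart (\<Sum>i<q. \<Sum>j<q. conjg (v i) * b i j * v j)" using b by (simp add: PSD_def)
  from spec[OF this, of "\<lambda>i. conjg (x _ i)"]
  have "0 \<le> (\<Sum>i<q. \<Sum>j<q. repart (x k i * b i j * conjg (x k j)))" for k
    by (simp add: conjg_conjg repart_sum)
  then show ?thesis unfolding row_form_def by (rule sum_nonneg)
qed

lemma row_form_sum_left:
  "row_form q b n (\<lambda>i j. \<Sum>k<N::nat. c k *\<^sub>R z k i j) y = (\<Sum>k<N. c k * row_form q b n (z k) y)"
proof (induction N)
  case 0
  show ?case using row_form_scaleR_left[of q b n 0 "\<lambda>i j. 0" y] by simp
next
  case (Suc N)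
  then show ?case
    using row_form_add_left[of q b n "\<lambda>i j. \<Sum>k<N. c k *\<^sub>R z k i j" "\<lambda>i j. c N *\<^sub>R z N i j" y]
    by (simp add: row_form_scaleR_left)
qed

lemma row_form_posdef:
  assumes b: "b \<in> PSD q"
  shows "0 \<le> (\<Sum>k<N::nat. \<Sum>l<N. c k * c l * row_form q b n (z k) (z l))"
proof -
  let ?y = "\<lambda>i j. \<Sum>k<N. c k *\<^sub>R z k i j"
  have s: "mat_star b = b" using b by (simp add: PSD_def Hermitians_def)
  have "row_form q b n ?y ?y = (\<Sum>k<N. c k * row_form q b n (z k) ?y)" by (rule row_form_sum_left)
  also have "\<dots> = (\<Sum>k<N. c k * row_form q b n ?y (z k))" by (simp only: row_form_commute[OF s, of q n _ ?y])
  also have "\<dots> = (\<Sum>k<N. \<Sum>l<N. c k * (c l * row_form q b n (z l) (z k)))"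
    by (simp only: row_form_sum_left sum_distrib_left)
  also have "\<dots> = (\<Sum>k<N. \<Sum>l<N. c k * c l * row_form q b n (z k) (z l))"
  proof (intro sum.cong refl)
    show "c k * (c l * row_form q b n (z l) (z k)) = c k * c l * row_form q b n (z k) (z l)" for k l
      by (subst row_form_commute[OF s]) (simp only: mult.assoc)
  qed
  finally show ?thesis using row_form_nonneg[OF b, of n ?y] by simp
qed

lemma row_form_binomial:
  assumes b: "mat_star b = b"
  shows "row_form q b n (\<lambda>i j. x i j + t *\<^sub>R y i j) (\<lambda>i j. x i j + t *\<^sub>R y i j)
    = row_form q b n x x + t\<^sup>2 * row_form q b n y y + 2 * t * row_form q b n x y"
proof -
  let ?z = "\<lambda>i j. x i j + t *\<^sub>R y i j"
  have 1: "row_form q b n ?z w = row_form q b n x w + t * row_form q b n y w" for w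
    by (simp add: row_form_add_left row_form_scaleR_left)
  have "row_form q b n ?z ?z = row_form q b n ?z x + t * row_form q b n ?z y"
    unfolding 1[of ?z] by (simp only: row_form_commute[OF b, of q n _ ?z])
  also have "\<dots> = row_form q b n x x + t\<^sup>2 * row_form q b n y y + 2 * t * row_form q b n x y"
    unfolding 1 row_form_commute[OF b, of q n y x] by (simp add: power2_eq_square algebra_simps)
  finally show ?thesis .
qed

text \<open>Permuting rows shows that all entries of a column have the same mean modulus, and the moduli in a column
of norm \<open>1\<close> add up to at most \<open>\<surd>p\<close>.\<close>

lemma haar_entry_mean:
  assumes ij: "i < p" "j < p"
  shows "(LINT k|(haarK q p :: 'a::{conj_div_algebra, euclidean_space} mpair measure). norm (snd k i j)) \<le> 1 / sqrt (real p)"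
proof -
  let ?H = "(haarK q p :: 'a mpair measure)"
  interpret finite_measure ?H by (rule finite_measure_haar)
  have c: "continuous_on (Kgrp p) (\<lambda>k :: 'a mpair. norm (snd k i j))" for i
    by (rule continuous_on_norm[OF continuous_on_entry[OF continuous_on_snd[OF continuous_on_id]]])
  have eq: "(LINT k|?H. norm (snd k i' j)) = (LINT k|?H. norm (snd k i j))" if "i' < p" for i'
  proof -
    let ?t = "Transposition.transpose i i'"
    have t: "?t permutes {..<p}" by (rule permutes_swap_id) (use ij that in auto)
    have "(\<lambda>i j. 0, perm_mat ?t) \<in> (Kgrp p :: 'a mpair set)"
      by (simp add: in_Kgrp perm_Unitaries[OF t])
    from haar_integral_left[OF c this, of q i']
    show ?thesis by (simp add: kmult_def mat_times_perm)
  qed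
  have p: "0 < p" using ij by simp
  have "real p * (LINT k|?H. norm (snd k i j)) = (\<Sum>i'<p. LINT k|?H. norm (snd k i' j))" by (simp add: eq)
  also have "\<dots> = (LINT k|?H. (\<Sum>i'<p. norm (snd k i' j)))"
    by (rule Bochner_Integration.integral_sum[symmetric]) (rule haar_integrable[OF c])
  also have "\<dots> \<le> (LINT k|?H. sqrt (real p))"
  proof (rule integral_mono[OF haar_integrable])
    show "continuous_on (Kgrp p) (\<lambda>k :: 'a mpair. \<Sum>i'<p. norm (snd k i' j))"
      by (intro continuous_on_sum c)
    fix k :: "'a mpair" assume "k \<in> space ?H"
    then have u: "snd k \<in> Unitaries p" by (simp add: space_haar in_Kgrp)
    have "(\<Sum>i'<p. norm (snd k i' j))\<^sup>2 \<le> (\<Sum>i'<p. (norm (snd k i' j))\<^sup>2) * real (card {..<p})"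
      by (rule sum_squared_le_sum_of_squares)
    also have "\<dots> = real p" using Unitaries_column_norm[OF u ij(2)] by simp
    finally show "(\<Sum>i'<p. norm (snd k i' j)) \<le> sqrt (real p)" by (rule real_le_rsqrt)
  qed simp
  also have "\<dots> = sqrt (real p)" by (simp add: space_haar)
  finally have "sqrt (real p) * (sqrt (real p) * (LINT k|?H. norm (snd k i j))) \<le> sqrt (real p) * 1"
    by (simp add: mult.assoc[symmetric])
  then have "sqrt (real p) * (LINT k|?H. norm (snd k i j)) \<le> 1"
    using p by (subst (asm) mult_le_cancel_left_pos) simp_all
  then show ?thesis using p by (simp add: pos_le_divide_eq mult.commute)
qed

lemma abs_exp_minus_1_le: "\<bar>exp t - 1\<bar> \<le> \<bar>t\<bar> * exp \<bar>t\<bar>" for t :: real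
proof (cases "0 \<le> t")
  case True
  have "1 - t \<le> exp (- t)" using exp_ge_add_one_self[of "- t"] by simp
  then have "(1 - t) * exp t \<le> exp (- t) * exp t" by (rule mult_right_mono) simp
  then have "exp t - 1 \<le> t * exp t" by (simp add: exp_minus algebra_simps)
  then show ?thesis using True by simp
next
  case False
  have "1 + t \<le> exp t" by (rule exp_ge_add_one_self)
  moreover have "exp t \<le> 1" using False by simp
  ultimately have "\<bar>exp t - 1\<bar> \<le> \<bar>t\<bar> * 1" using False by linarith
  also have "\<dots> \<le> \<bar>t\<bar> * exp \<bar>t\<bar>" by (intro mult_left_mono) simp_all
  finally show ?thesis .
qed

text \<open>The bound involves only entries of \<open>u\<close> in a fixed \<open>n \<times> n\<close> block, with weights independent of \<open>p\<close>.\<close>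

lemma row_form_rotated_bound:
  fixes b :: "'a::conj_div_algebra inf_mat"
  assumes u: "u \<in> Unitaries p" and y: "y \<in> Mats n q" and x: "x \<in> Mats n q" and np: "n \<le> p"
  shows "\<bar>row_form q b p x (mat_times u y)\<bar>
    \<le> (\<Sum>k<n. \<Sum>l<n. (\<Sum>i<q. \<Sum>j<q. norm (x k i) * norm (b i j) * norm (y l j)) * norm (u k l))"
proof -
  have uy: "mat_times u y k j = (\<Sum>l<n. u k l * y l j)" for k j
    by (rule mat_times_eq_sum_right) (use MatsD[OF y] in auto)
  have "row_form q b p x (mat_times u y) = (\<Sum>k<n. \<Sum>i<q. \<Sum>j<q. repart (x k i * b i j * conjg (mat_times u y k j)))"
    unfolding row_form_def
    by (rule sum.mono_neutral_right) (use np MatsD[OF x] in auto)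
  then have "\<bar>row_form q b p x (mat_times u y)\<bar> = \<bar>\<Sum>k<n. \<Sum>i<q. \<Sum>j<q. repart (x k i * b i j * conjg (mat_times u y k j))\<bar>"
    by (simp only:)
  also have "\<dots> \<le> (\<Sum>k<n. \<Sum>i<q. \<Sum>j<q. \<Sum>l<n. norm (x k i) * norm (b i j) * (norm (u k l) * norm (y l j)))"
  proof (intro order_trans[OF sum_abs] sum_mono)
    fix k i j
    have "\<bar>repart (x k i * b i j * conjg (mat_times u y k j))\<bar> \<le> norm (x k i) * norm (b i j) * norm (mat_times u y k j)"
      using repart_le_norm[of "x k i * b i j * conjg (mat_times u y k j)"] by (simp add: norm_mult)
    also have "\<dots> \<le> norm (x k i) * norm (b i j) * (\<Sum>l<n. norm (u k l) * norm (y l j))"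
    proof (rule mult_left_mono)
      show "norm (mat_times u y k j) \<le> (\<Sum>l<n. norm (u k l) * norm (y l j))"
        unfolding uy norm_mult[symmetric] by (rule norm_sum)
    qed simp
    finally show "\<bar>repart (x k i * b i j * conjg (mat_times u y k j))\<bar>
        \<le> (\<Sum>l<n. norm (x k i) * norm (b i j) * (norm (u k l) * norm (y l j)))"
      by (simp only: sum_distrib_left)
  qed
  also have "\<dots> = (\<Sum>k<n. \<Sum>l<n. \<Sum>i<q. \<Sum>j<q. norm (x k i) * norm (b i j) * (norm (u k l) * norm (y l j)))"
  proof (rule sum.cong[OF refl])
    fix k
    have "(\<Sum>i<q. \<Sum>j<q. \<Sum>l<n. norm (x k i) * norm (b i j) * (norm (u k l) * norm (y l j)))
      = (\<Sum>i<q. \<Sum>l<n. \<Sum>j<q. norm (x k i) * norm (b i j) * (norm (u k l) * norm (y l j)))"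
      by (intro sum.cong refl sum.swap)
    also have "\<dots> = (\<Sum>l<n. \<Sum>i<q. \<Sum>j<q. norm (x k i) * norm (b i j) * (norm (u k l) * norm (y l j)))"
      by (rule sum.swap)
    finally show "(\<Sum>i<q. \<Sum>j<q. \<Sum>l<n. norm (x k i) * norm (b i j) * (norm (u k l) * norm (y l j)))
      = (\<Sum>l<n. \<Sum>i<q. \<Sum>j<q. norm (x k i) * norm (b i j) * (norm (u k l) * norm (y l j)))" .
  qed
  also have "\<dots> = (\<Sum>k<n. \<Sum>l<n. (\<Sum>i<q. \<Sum>j<q. norm (x k i) * norm (b i j) * norm (y l j)) * norm (u k l))"
    unfolding sum_distrib_right by (intro sum.cong refl) (simp only: mult_ac)
  finally show ?thesis .
qed

text \<open>The biinvariant function on the group that corresponds to \<open>psi q b\<close>.\<close>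

definition psi_lift :: "nat \<Rightarrow> 'a::conj_div_algebra inf_mat \<Rightarrow> 'a mpair \<Rightarrow> complex" where
  "psi_lift q b g = complex_of_real (exp (- gram_form q b (fst g)))"

lemma continuous_on_gram_form:
  "continuous_on (carrier (grp q p)) (\<lambda>g :: 'a::conj_div_algebra mpair. gram_form q b (fst g))"
proof -
  have e: "continuous_on (carrier (grp q p)) (\<lambda>g :: 'a mpair. fst g k i)" for k i
    by (rule continuous_on_entry[OF continuous_on_fst[OF continuous_on_id]])
  have "continuous_on (carrier (grp q p)) (\<lambda>g :: 'a mpair. row_form q b p (fst g) (fst g))"
    unfolding row_form_def
    by (intro continuous_on_sum continuous_on_repart continuous_on_mult continuous_on_conjg continuous_on_const e)
  then show ?thesis
    by (rule continuous_on_eq) (auto simp: carrier_grp gram_form_eq)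
qed

text \<open>After moving the unitary part \<open>snd g\<close> to the other factor, the integrand is \<open>E * exp (- 2 t)\<close> with \<open>t\<close> linear in
finitely many entries of \<open>k\<close>. These are bounded by \<open>1\<close>, so the integrand differs from \<open>E\<close> by at most a
constant times their moduli, which have small mean.\<close>

lemma psi_lift_spherical_limit:
  fixes b :: "'a::{conj_div_algebra, euclidean_space} inf_mat"
  assumes b: "b \<in> PSD q" and g: "g \<in> carrier (grp_lim q)" and h: "h \<in> carrier (grp_lim q)"
  shows "(\<lambda>p. LINT k|haarK q p. psi_lift q b (g \<otimes>\<^bsub>grp_lim q\<^esub> k \<otimes>\<^bsub>grp_lim q\<^esub> h))
     \<longlonglongrightarrow> psi_lift q b g * psi_lift q b h"
proof -
  have bs: "mat_star b = b" using b by (simp add: PSD_def Hermitians_def)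
  obtain n where n: "q \<le> n" "fst g \<in> Mats n q" "snd g \<in> Unitaries n" "fst h \<in> Mats n q" "snd h \<in> Unitaries n"
    by (rule carrier_grp_lim_pair[OF g h])
  define x where "x = mat_times (mat_star (snd g)) (fst g)"
  define y where "y = fst h"
  have x: "x \<in> Mats n q" unfolding x_def by (rule Unitaries_times_Mats[OF star_Unitaries[OF n(3)] n(2) order_refl])
  have y: "y \<in> Mats n q" using n(4) by (simp add: y_def)
  have gx: "mat_times (snd g) x = fst g"
    unfolding x_def mat_times_assoc[OF rowfin_Unitaries[OF n(3)] rowfin_Unitaries[OF star_Unitaries[OF n(3)]], symmetric]
    by (simp add: Unitaries_times_star[OF n(3)])
  have Qx: "gram_form q b x = gram_form q b (fst g)" using gram_form_unitary[OF n(3) x] by (simp add: gx)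
  define D where "D k l = (\<Sum>i<q. \<Sum>j<q. norm (x k i) * norm (b i j) * norm (y l j))" for k l
  have D0: "0 \<le> D k l" for k l unfolding D_def by (intro sum_nonneg mult_nonneg_nonneg norm_ge_zero)
  define C where "C = (\<Sum>k<n. \<Sum>l<n. D k l)"
  define E where "E = exp (- gram_form q b x) * exp (- gram_form q b y)"
  have val: "psi_lift q b (g \<otimes>\<^bsub>grp_lim q\<^esub> k \<otimes>\<^bsub>grp_lim q\<^esub> h) = complex_of_real (E * exp (- 2 * row_form q b p x (mat_times (snd k) y)))"
    if p: "n \<le> p" and k: "k \<in> Kgrp p" for p k
  proof -
    have u: "snd k \<in> Unitaries p" and k0: "fst k = (\<lambda>i j. 0)" using k by (auto simp: in_Kgrp)
    note rg = rowfin_Unitaries[OF n(3)] rowfin_Unitaries[OF u]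
    have xp: "x \<in> Mats p q" by (rule Mats_mono[OF p x])
    have uy: "mat_times (snd k) y \<in> Mats p q" by (rule Unitaries_times_Mats[OF u Mats_mono[OF p y] order_refl])
    have "fst (g \<otimes>\<^bsub>grp_lim q\<^esub> k \<otimes>\<^bsub>grp_lim q\<^esub> h) = (\<lambda>i j. mat_times (snd g) x i j + mat_times (snd g) (mat_times (snd k) y) i j)"
      by (simp add: mult_grp_lim k0 gx y_def mat_times_assoc rg)
    also have "\<dots> = mat_times (snd g) (\<lambda>i j. x i j + mat_times (snd k) y i j)"
      by (rule mat_times_add_right[OF rg(1), symmetric])
    finally have "gram_form q b (fst (g \<otimes>\<^bsub>grp_lim q\<^esub> k \<otimes>\<^bsub>grp_lim q\<^esub> h)) = gram_form q b (\<lambda>i j. x i j + mat_times (snd k) y i j)"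
      using gram_form_unitary[OF n(3) add_Mats[OF xp uy]] by simp
    also have "\<dots> = gram_form q b x + gram_form q b (mat_times (snd k) y) + 2 * row_form q b p x (mat_times (snd k) y)"
      unfolding gram_form_eq[OF add_Mats[OF xp uy]] gram_form_eq[OF xp] gram_form_eq[OF uy]
      using row_form_binomial[OF bs, of q p x 1 "mat_times (snd k) y"] by simp
    also have "gram_form q b (mat_times (snd k) y) = gram_form q b y" by (rule gram_form_unitary[OF u y])
    finally show ?thesis by (simp add: psi_lift_def E_def exp_add[symmetric])
  qed
  have bound: "norm ((LINT k|haarK q p. psi_lift q b (g \<otimes>\<^bsub>grp_lim q\<^esub> k \<otimes>\<^bsub>grp_lim q\<^esub> h)) - complex_of_real E)
      \<le> E * (2 * exp (2 * C) * C) * (1 / sqrt (real p))" if p: "Suc n \<le> p" for p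
  proof -
    let ?H = "(haarK q p :: 'a mpair measure)"
    interpret finite_measure ?H by (rule finite_measure_haar)
    have np: "n \<le> p" using p by simp
    let ?r = "\<lambda>k :: 'a mpair. E * exp (- 2 * row_form q b p x (mat_times (snd k) y))"
    have e: "continuous_on (Kgrp p) (\<lambda>k :: 'a mpair. snd k i j)" for i j
      by (rule continuous_on_entry[OF continuous_on_snd[OF continuous_on_id]])
    have "continuous_on (Kgrp p) (\<lambda>k :: 'a mpair. mat_times (snd k) y)"
      by (rule continuous_on_mat_times[where p=p])
        (auto simp: in_Kgrp intro: continuous_on_snd continuous_on_id continuous_on_const)
    note e' = continuous_on_entry[OF this]
    have cr: "continuous_on (Kgrp p) ?r"
      unfolding row_form_def
      by (intro continuous_on_mult continuous_on_const continuous_on_exp continuous_on_sum continuous_on_repart continuous_on_conjg e')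
    have cn: "continuous_on (Kgrp p) (\<lambda>k :: 'a mpair. norm (snd k i j))" for i j
      by (rule continuous_on_norm[OF e])
    have pointwise: "\<bar>?r k - E\<bar> \<le> E * (2 * exp (2 * C)) * (\<Sum>i<n. \<Sum>l<n. D i l * norm (snd k i l))" if k: "k \<in> Kgrp p" for k
    proof -
      have u: "snd k \<in> Unitaries p" using k by (simp add: in_Kgrp)
      define t where "t = row_form q b p x (mat_times (snd k) y)"
      define s where "s = (\<Sum>i<n. \<Sum>l<n. D i l * norm (snd k i l))"
      have ts: "\<bar>t\<bar> \<le> s" unfolding t_def s_def D_def by (rule row_form_rotated_bound[OF u y x np])
      have sC: "s \<le> C" unfolding s_def C_def
        by (intro sum_mono) (use Unitaries_entry_le[OF u] D0 in \<open>simp add: mult_left_le\<close>)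
      have "\<bar>exp (- 2 * t) - 1\<bar> \<le> \<bar>- 2 * t\<bar> * exp \<bar>- 2 * t\<bar>" by (rule abs_exp_minus_1_le)
      also have "\<dots> \<le> (2 * s) * exp (2 * C)"
        using ts sC by (intro mult_mono) auto
      finally have "E * \<bar>exp (- 2 * t) - 1\<bar> \<le> E * ((2 * s) * exp (2 * C))"
        by (rule mult_left_mono) (simp add: E_def)
      moreover have "\<bar>?r k - E\<bar> = E * \<bar>exp (- 2 * t) - 1\<bar>"
      proof -
        have "?r k - E = E * (exp (- 2 * t) - 1)" by (simp add: t_def right_diff_distrib)
        moreover have "\<bar>E\<bar> = E" by (simp add: E_def)
        ultimately show ?thesis by (simp only: abs_mult)
      qed
      ultimately show ?thesis unfolding s_def[symmetric] by (simp add: mult_ac)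
    qed
    have "(LINT k|?H. psi_lift q b (g \<otimes>\<^bsub>grp_lim q\<^esub> k \<otimes>\<^bsub>grp_lim q\<^esub> h)) = (LINT k|?H. complex_of_real (?r k))"
      by (rule Bochner_Integration.integral_cong[OF refl]) (rule val[OF np], simp add: space_haar)
    also have "\<dots> = complex_of_real (LINT k|?H. ?r k)" by simp
    finally have "norm ((LINT k|?H. psi_lift q b (g \<otimes>\<^bsub>grp_lim q\<^esub> k \<otimes>\<^bsub>grp_lim q\<^esub> h)) - complex_of_real E) = \<bar>(LINT k|?H. ?r k) - E\<bar>"
      by (simp only: of_real_diff[symmetric] norm_of_real)
    also have "\<dots> = \<bar>LINT k|?H. ?r k - E\<bar>"
      using haar_integrable[OF cr, of q] by (simp add: space_haar)
    also have "\<dots> \<le> (LINT k|?H. \<bar>?r k - E\<bar>)" by (rule integral_abs_bound)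
    also have "\<dots> \<le> (LINT k|?H. E * (2 * exp (2 * C)) * (\<Sum>i<n. \<Sum>l<n. D i l * norm (snd k i l)))"
    proof (rule integral_mono)
      show "integrable ?H (\<lambda>k. \<bar>?r k - E\<bar>)"
        by (rule haar_integrable) (intro continuous_on_rabs continuous_on_diff cr continuous_on_const)
      show "integrable ?H (\<lambda>k. E * (2 * exp (2 * C)) * (\<Sum>i<n. \<Sum>l<n. D i l * norm (snd k i l)))"
        by (rule haar_integrable) (intro continuous_on_mult continuous_on_sum cn continuous_on_const)
    qed (simp only: space_haar, rule pointwise)
    also have "\<dots> = E * (2 * exp (2 * C)) * (\<Sum>i<n. \<Sum>l<n. D i l * (LINT k|?H. norm (snd k i l)))"
    proof -
      have i1: "integrable ?H (\<lambda>k. D i l * norm (snd k i l))" for i l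
        by (rule haar_integrable) (intro continuous_on_mult cn continuous_on_const)
      have "(LINT k|?H. (\<Sum>i<n. \<Sum>l<n. D i l * norm (snd k i l))) = (\<Sum>i<n. LINT k|?H. (\<Sum>l<n. D i l * norm (snd k i l)))"
        by (rule Bochner_Integration.integral_sum) (intro Bochner_Integration.integrable_sum i1)
      also have "\<dots> = (\<Sum>i<n. \<Sum>l<n. LINT k|?H. D i l * norm (snd k i l))"
        by (intro sum.cong refl Bochner_Integration.integral_sum i1)
      also have "\<dots> = (\<Sum>i<n. \<Sum>l<n. D i l * (LINT k|?H. norm (snd k i l)))" by simp
      finally show ?thesis by simp
    qed
    also have "\<dots> \<le> E * (2 * exp (2 * C)) * (\<Sum>i<n. \<Sum>l<n. D i l * (1 / sqrt (real p)))"
    proof (intro mult_left_mono sum_mono D0)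
      fix i l assume "i \<in> {..<n}" "l \<in> {..<n}"
      then show "(LINT k|?H. norm (snd k i l)) \<le> 1 / sqrt (real p)" using np by (intro haar_entry_mean) auto
    qed (simp add: E_def)
    also have "\<dots> = E * (2 * exp (2 * C) * C) * (1 / sqrt (real p))"
      unfolding C_def by (simp add: sum_distrib_right sum_distrib_left mult_ac)
    finally show ?thesis .
  qed
  have "(\<lambda>p. E * (2 * exp (2 * C) * C) * (1 / sqrt (real p))) \<longlonglongrightarrow> E * (2 * exp (2 * C) * C) * 0"
    by (intro tendsto_mult tendsto_const tendsto_divide_0[OF tendsto_const]
        filterlim_at_top_imp_at_infinity[OF filterlim_compose[OF sqrt_at_top filterlim_real_sequentially]])
  then have lim0: "(\<lambda>p. E * (2 * exp (2 * C) * C) * (1 / sqrt (real p))) \<longlonglongrightarrow> 0" by simp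
  have "(\<lambda>p. (LINT k|haarK q p. psi_lift q b (g \<otimes>\<^bsub>grp_lim q\<^esub> k \<otimes>\<^bsub>grp_lim q\<^esub> h)) - complex_of_real E) \<longlonglongrightarrow> 0"
    by (rule Lim_null_comparison[OF eventually_sequentiallyI[of "Suc n"] lim0]) (rule bound)
  then have "(\<lambda>p. LINT k|haarK q p. psi_lift q b (g \<otimes>\<^bsub>grp_lim q\<^esub> k \<otimes>\<^bsub>grp_lim q\<^esub> h)) \<longlonglongrightarrow> complex_of_real E"
    by (simp only: LIM_zero_iff)
  moreover have "complex_of_real E = psi_lift q b g * psi_lift q b h"
    by (simp add: psi_lift_def E_def Qx y_def)
  ultimately show ?thesis by simp
qed

lemma psi_lift_olshanski_spherical:
  fixes b :: "'a::{conj_div_algebra, euclidean_space} inf_mat"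
  assumes b: "b \<in> PSD q"
  shows "olshanski_spherical q (psi_lift q b)"
  unfolding olshanski_spherical_def
proof (intro conjI ballI)
  show "continuous_map (lim_topology q) euclidean (psi_lift q b)"
    unfolding continuous_map_lim_topology psi_lift_def
    by (intro allI impI continuous_on_of_real continuous_on_exp continuous_on_minus continuous_on_gram_form)
  have "(\<lambda>i j. 0, mat_id) \<in> carrier (grp_lim q)" by (rule carrier_grp_limI[of _ 0 _ _ 0]) simp_all
  then show "\<exists>g\<in>carrier (grp_lim q). psi_lift q b g \<noteq> 0" by (intro bexI) (simp_all add: psi_lift_def)
  fix g :: "'a mpair" assume g: "g \<in> carrier (grp_lim q)"
  show "psi_lift q b (k \<otimes>\<^bsub>grp_lim q\<^esub> g \<otimes>\<^bsub>grp_lim q\<^esub> l) = psi_lift q b g" if kl: "k \<in> Klim q" "l \<in> Klim q" for k l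
  proof -
    obtain p where k: "fst k = (\<lambda>i j. 0)" "snd k \<in> Unitaries p" using Klim_cases[OF kl(1)] by blast
    have l: "fst l = (\<lambda>i j. 0)" using Klim_cases[OF kl(2)] by blast
    obtain n where n: "fst g \<in> Mats n q" using g by (auto simp: carrier_grp_lim)
    show ?thesis using gram_form_unitary[OF k(2) n] by (simp add: psi_lift_def mult_grp_lim k(1) l)
  qed
  show "(\<lambda>p. LINT k|haarK q p. psi_lift q b (g \<otimes>\<^bsub>grp_lim q\<^esub> k \<otimes>\<^bsub>grp_lim q\<^esub> h))
     \<longlonglongrightarrow> psi_lift q b g * psi_lift q b h" if "h \<in> carrier (grp_lim q)" for h
    by (rule psi_lift_spherical_limit[OF b g that])
qed

text \<open>With \<open>z k = u\<^sub>k\<^sup>* x\<^sub>k\<close> for \<open>g k = (x\<^sub>k, u\<^sub>k)\<close>, the kernel is the Gaussian \<open>exp (- Q (z k - z l))\<close>. It splits into factors that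
depend on \<open>k\<close> and on \<open>l\<close> alone and the exponential of a positive semidefinite kernel.\<close>

lemma psi_lift_positive_definite:
  fixes b :: "'a::conj_div_algebra inf_mat"
  assumes b: "b \<in> PSD q"
  shows "positive_definite_on (grp_lim q) (psi_lift q b)"
  unfolding positive_definite_on_def
proof (intro allI impI)
  fix N :: nat and g :: "nat \<Rightarrow> 'a mpair" and c :: "nat \<Rightarrow> complex"
  assume "\<forall>k<N. g k \<in> carrier (grp_lim q)"
  then have g: "g k \<in> carrier (grp_lim q)" if "k < N" for k using that by blast
  have bs: "mat_star b = b" using b by (simp add: PSD_def Hermitians_def)
  define z where "z k = mat_times (mat_star (snd (g k))) (fst (g k))" for k
  have "\<forall>k<N. \<exists>p. fst (g k) \<in> Mats p q \<and> snd (g k) \<in> Unitaries p" using g by (auto simp: carrier_grp_lim)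
  then obtain P where P: "\<And>k. k < N \<Longrightarrow> fst (g k) \<in> Mats (P k) q \<and> snd (g k) \<in> Unitaries (P k)" by metis
  \<comment> \<open>the sum is a size that fits all \<open>g k\<close> at once\<close>
  define p where "p = (\<Sum>k<N. P k)"
  have Pp: "P k \<le> p" if "k < N" for k unfolding p_def by (rule member_le_sum) (use that in auto)
  have x: "fst (g k) \<in> Mats p q" and u: "snd (g k) \<in> Unitaries p" if "k < N" for k
    using P[OF that] Mats_mono[OF Pp[OF that]] Unitaries_mono[OF Pp[OF that]] by auto
  have zM: "z k \<in> Mats p q" if "k < N" for k
    unfolding z_def by (rule Unitaries_times_Mats[OF star_Unitaries[OF u[OF that]] x[OF that] order_refl])
  have uz: "mat_times (snd (g k)) (z k) = fst (g k)" if "k < N" for k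
    unfolding z_def mat_times_assoc[OF rowfin_Unitaries[OF u[OF that]] rowfin_Unitaries[OF star_Unitaries[OF u[OF that]]], symmetric]
    by (simp add: Unitaries_times_star[OF u[OF that]])
  define Q where "Q k = row_form q b p (z k) (z k)" for k
  define B where "B k l = 2 * row_form q b p (z k) (z l)" for k l
  have val: "psi_lift q b (g k \<otimes>\<^bsub>grp_lim q\<^esub> inv\<^bsub>grp_lim q\<^esub> (g l)) = complex_of_real (exp (- Q k) * exp (- Q l) * exp (B k l))"
    if k: "k < N" and l: "l < N" for k l
  proof -
    have "fst (g k \<otimes>\<^bsub>grp_lim q\<^esub> inv\<^bsub>grp_lim q\<^esub> (g l)) = (\<lambda>i j. mat_times (snd (g k)) (z k) i j + mat_times (snd (g k)) (\<lambda>i j. - z l i j) i j)"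
      by (simp add: inv_grp_lim[OF g[OF l]] mult_grp_lim uz[OF k] z_def[symmetric])
    also have "\<dots> = mat_times (snd (g k)) (\<lambda>i j. z k i j + - z l i j)"
      by (rule mat_times_add_right[OF rowfin_Unitaries[OF u[OF k]], symmetric])
    finally have "gram_form q b (fst (g k \<otimes>\<^bsub>grp_lim q\<^esub> inv\<^bsub>grp_lim q\<^esub> (g l))) = gram_form q b (\<lambda>i j. z k i j + - z l i j)"
      using gram_form_unitary[OF u[OF k] add_Mats[OF zM[OF k] minus_Mats[OF zM[OF l]]]] by simp
    also have "\<dots> = Q k + Q l - B k l"
      unfolding gram_form_eq[OF add_Mats[OF zM[OF k] minus_Mats[OF zM[OF l]]]] Q_def B_def
      using row_form_binomial[OF bs, of q p "z k" "-1" "z l"] by simp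
    finally show ?thesis by (simp add: psi_lift_def exp_add[symmetric] algebra_simps)
  qed
  have "(\<Sum>k<N. \<Sum>l<N. c k * cnj (c l) * psi_lift q b (g k \<otimes>\<^bsub>grp_lim q\<^esub> inv\<^bsub>grp_lim q\<^esub> (g l)))
    = (\<Sum>k<N. \<Sum>l<N. (c k * exp (- Q k)) * cnj (c l * exp (- Q l)) * complex_of_real (exp (B k l)))"
    by (intro sum.cong refl) (simp add: val mult_ac)
  also have "\<dots> \<in> \<real>\<^sub>\<ge>\<^sub>0"
  proof (rule complex_posdef_of_real)
    have sym: "B k l = B l k" for k l using row_form_commute[OF bs, of q p "z k" "z l"] by (simp add: B_def)
    then show "exp (B k l) = exp (B l k)" for k l by simp
    have "0 \<le> (\<Sum>k<N. \<Sum>l<N. c k * c l * B k l)" for c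
    proof -
      have "(\<Sum>k<N. \<Sum>l<N. c k * c l * B k l) = 2 * (\<Sum>k<N. \<Sum>l<N. c k * c l * row_form q b p (z k) (z l))"
        by (simp add: B_def sum_distrib_left mult_ac)
      then show ?thesis using row_form_posdef[OF b] by simp
    qed
    then show "0 \<le> (\<Sum>k<N. \<Sum>l<N. c k * c l * exp (B k l))" for c by (intro exp_posdef sym)
  qed
  finally show "(\<Sum>k<N. \<Sum>l<N. c k * cnj (c l) * psi_lift q b (g k \<otimes>\<^bsub>grp_lim q\<^esub> inv\<^bsub>grp_lim q\<^esub> (g l))) \<in> \<real>\<^sub>\<ge>\<^sub>0" .
qed

theorem positive_definite_spherical_functions:
  "{\<lambda>a\<in>PSD q. \<phi> (grp_elem a) |
             \<phi> :: 'a::{conj_div_algebra, euclidean_space} mpair \<Rightarrow> complex.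
             olshanski_spherical q \<phi> \<and> positive_definite_on (grp_lim q) \<phi>}
          = {\<lambda>a\<in>PSD q. psi q b a | b. b \<in> PSD q}" (is "?L = ?R")
proof (intro equalityI subsetI)
  fix f assume "f \<in> ?L"
  then obtain \<phi> :: "'a mpair \<Rightarrow> complex" where f: "f = (\<lambda>a\<in>PSD q. \<phi> (grp_elem a))"
    and \<phi>: "olshanski_spherical q \<phi>" "positive_definite_on (grp_lim q) \<phi>" by blast
  obtain b where b: "b \<in> PSD q" "\<forall>a\<in>PSD q. \<phi> (grp_elem a) = psi q b a"
    using spherical_imp_psi[OF \<phi>] by blast
  have "f = (\<lambda>a\<in>PSD q. psi q b a)" unfolding f using b(2) by (intro restrict_ext) blast
  with b(1) show "f \<in> ?R" by blast
next
  fix f :: "'a inf_mat \<Rightarrow> complex" assume "f \<in> ?R"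
  then obtain b where f: "f = (\<lambda>a\<in>PSD q. psi q b a)" and b: "b \<in> PSD q" by blast
  have "psi_lift q b (grp_elem a) = psi q b a" if "a \<in> PSD q" for a
    using that by (simp add: PSD_def Hermitians_def psi_lift_def grp_elem_def psi_def gram_form_def)
  then have "f = (\<lambda>a\<in>PSD q. psi_lift q b (grp_elem a))" unfolding f by (intro restrict_ext) simp
  with psi_lift_olshanski_spherical[OF b] psi_lift_positive_definite[OF b] show "f \<in> ?L" by blast
qed

theorem theorem4p8:
  fixes q :: nat
  assumes "1 \<le> q"
  shows "({\<lambda>a\<in>PSD q. \<phi> (grp_elem a) |
             \<phi> :: real inf_mat \<times> real inf_mat \<Rightarrow> complex.
             olshanski_spherical q \<phi> \<and> positive_definite_on (grp_lim q) \<phi>}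
          = {\<lambda>a\<in>PSD q. psi q b a | b. b \<in> PSD q}) \<and>
         ({\<lambda>a\<in>PSD q. \<phi> (grp_elem a) |
             \<phi> :: complex inf_mat \<times> complex inf_mat \<Rightarrow> complex.
             olshanski_spherical q \<phi> \<and> positive_definite_on (grp_lim q) \<phi>}
          = {\<lambda>a\<in>PSD q. psi q b a | b. b \<in> PSD q}) \<and>
         ({\<lambda>a\<in>PSD q. \<phi> (grp_elem a) |
             \<phi> :: quat inf_mat \<times> quat inf_mat \<Rightarrow> complex.
             olshanski_spherical q \<phi> \<and> positive_definite_on (grp_lim q) \<phi>}
          = {\<lambda>a\<in>PSD q. psi q b a | b. b \<in> PSD q})"
  by (intro conjI positive_definite_spherical_functions)

end
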